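(* Suppose that $B\colon\Lambda\to H_{\square}$ satisfies Assumption 1 (stated in the context), and let $\overline{B}\colon H\to H_\square$ be its continuous extension. Then for every $q\ge2$, $\phi\in\mathcal{H}^q$ and $s,t\in[0,T]$ with $s\le t$, there exists a unique solution $w^{s,\phi}_t\in\mathcal{H}^q$ of the equation $$w=\phi+\int_s^t\overline{B}(r,w)\,\mathrm{d}r+\int_s^t\sigma(r)\,\mathrm{d}W_r .$$ In particular, if $\phi\in\mathcal{H}^q_s$ then $w^{s,\phi}_t\in\mathcal{H}^q_t$. Furthermore, the following cocycle property holds in $\mathcal{H}^q$: $$w^{s,\phi}_t=w_t^{u,w^{s,\phi}_u},\qquad 0\le s<u<t\le T,\ \phi\in\mathcal{H}^q .$$
   Context: Fix $T>0$, $d\in\mathbb{N}$. $(\Omega,\mathcal{F},\mathbb{P},\mathbb{F})$ is a complete filtered probability space, $\mathbb{F}=(\mathcal{F}_t)_{t\in[0,T]}$ satisfies the usual conditions, and $W$ is a standard $\mathbb{R}^d$-valued $\mathbb{F}$-Brownian motion. $k_2(t)=\frac{1}{\Gamma(\alpha)}t^{\alpha-1}$, $t>0$, for some $\alpha\in(\frac12,1)$. $H=L^2(0,T;\mathbb{R}^d)$ with norm $\|\cdot\|_2$; $\Lambda=C([0,T];\mathbb{R}^d)$; $H_\square=L^2((0,T)\times(0,T);\mathbb{R}^d)$ with norm $\|\cdot\|_{2,\square}$. The map $\sigma\colon[0,T]\to\mathcal{L}(\mathbb{R}^d;H)$ is $[\sigma(t)x](\xi)=k_2(\xi-t)1_{\{t<\xi\}}x$,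 and $\int_s^t\sigma(r)\,\mathrm{d}W_r$ is the $H$-valued stochastic integral. For $q\ge2$, $\mathcal{H}^q=L^q(\Omega;H)$ and $\mathcal{H}^q_t\subset\mathcal{H}^q$ is the subspace of $\mathcal{F}_t$-measurable elements. Assumption 1. The function $B\colon\Lambda\to H_\square$ satisfies, for some constant $C_0=C_0(d,T)>0$ and all $w_1,w_2\in\Lambda$, $\|B(w_1)\|_{2,\square}\le C_0(1+\|w_1\|_2)$ and $\|B(w_1)-B(w_2)\|_{2,\square}\le C_0\|w_1-w_2\|_2$. Moreover, given $w\in\Lambda$ and $0<t\le T$, for a.e. $r\in(0,t)$ the function $B(w)(r,\cdot)\in H$ is of Volterra type, i.e. $B(w)(r,\xi)=0$ for a.e. $\xi\in(0,r)$, and depends on $w$ only via its restriction $w|_{(0,t)}$. Under Assumption 1, $\overline{B}\colon H\to H_\square$ denotes the unique continuous map with $\overline{B}|_\Lambda=B$ (extension of uniformly continuous functions, $\Lambda$ being dense in $H$). For $w\in H$ one writes $\overline{B}(r,w)=\overline{B}(w)(r,\cdot)\in H$, which is well defined for a.e. $r\in(0,T)$. Integrals in $\mathrm{d}r$ are Bochner integrals in $H$, and the equation is understood as an equality in $H$, $\mathbb{P}$-a.s. *)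

theory Defs
  imports "HOL-Probability.Probability"
begin

section \<open>Square-integrable functions modulo null sets\<close>

definition sq_integrable :: "('b::euclidean_space \<Rightarrow> 'a::euclidean_space) \<Rightarrow> bool" where
  "sq_integrable f \<longleftrightarrow> f \<in> borel_measurable lborel \<and> integrable lborel (\<lambda>x. (norm (f x))\<^sup>2)"

lemma sq_integrable_zero [simp]: "sq_integrable (\<lambda>x. 0)"
  by (simp add: sq_integrable_def)

lemma sq_integrable_measurable: "sq_integrable f \<Longrightarrow> f \<in> borel_measurable lborel"
  by (simp add: sq_integrable_def)

lemma sq_integrable_bound:
  assumes "sq_integrable f" "g \<in> borel_measurable lborel" "AE x in lborel. norm (g x) \<le> c * norm (f x)"
  shows "sq_integrable g"
proof -
  have i: "integrable lborel (\<lambda>x. c\<^sup>2 * (norm (f x))\<^sup>2)"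
    using assms(1) by (auto simp: sq_integrable_def)
  have ae: "AE x in lborel. norm ((norm (g x))\<^sup>2) \<le> norm (c\<^sup>2 * (norm (f x))\<^sup>2)"
    using assms(3)
  proof eventually_elim
    case (elim x)
    from power_mono[OF this, of 2] show ?case by (simp add: power_mult_distrib)
  qed
  have "integrable lborel (\<lambda>x. (norm (g x))\<^sup>2)"
    by (rule Bochner_Integration.integrable_bound[OF i _ ae]) (use assms(2) in measurable)
  then show ?thesis using assms(2) by (simp add: sq_integrable_def)
qed

lemma norm_add_sq: "(norm (x + y :: 'a::real_inner))\<^sup>2 \<le> 2 * (norm x)\<^sup>2 + 2 * (norm y)\<^sup>2"
proof -
  have "(norm (x + y))\<^sup>2 \<le> (norm x + norm y)\<^sup>2"
    by (intro power_mono norm_triangle_ineq) auto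
  also have "\<dots> \<le> 2 * (norm x)\<^sup>2 + 2 * (norm y)\<^sup>2"
    using sum_squares_bound[of "norm x" "norm y"] by (simp add: power2_sum)
  finally show ?thesis .
qed

lemma sq_integrable_add:
  assumes "sq_integrable f" "sq_integrable g"
  shows "sq_integrable (\<lambda>x. f x + g x)"
proof -
  have m: "f \<in> borel_measurable lborel" "g \<in> borel_measurable lborel"
    using assms by (auto simp: sq_integrable_def)
  have "integrable lborel (\<lambda>x. 2 * (norm (f x))\<^sup>2 + 2 * (norm (g x))\<^sup>2)"
    using assms by (auto simp: sq_integrable_def)
  then have "integrable lborel (\<lambda>x. (norm (f x + g x))\<^sup>2)"
    using m norm_add_sq by (auto intro!: Bochner_Integration.integrable_bound[where g="\<lambda>x. (norm (f x + g x))\<^sup>2"] AE_I2)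
  then show ?thesis using m by (simp add: sq_integrable_def)
qed

lemma sq_integrable_scaleR: "sq_integrable f \<Longrightarrow> sq_integrable (\<lambda>x. c *\<^sub>R f x)"
  by (rule sq_integrable_bound[where c="\<bar>c\<bar>" and f=f]) (auto simp: sq_integrable_def)

lemma sq_integrable_uminus: "sq_integrable f \<Longrightarrow> sq_integrable (\<lambda>x. - f x)"
  using sq_integrable_scaleR[of f "-1"] by simp

lemma sq_integrable_diff: "sq_integrable f \<Longrightarrow> sq_integrable g \<Longrightarrow> sq_integrable (\<lambda>x. f x - g x)"
  using sq_integrable_add[OF _ sq_integrable_uminus, of f g] by simp

lemma sq_integrable_inner:
  assumes "sq_integrable f" "sq_integrable g"
  shows "integrable lborel (\<lambda>x. f x \<bullet> g x)"
proof -
  have m: "f \<in> borel_measurable lborel" "g \<in> borel_measurable lborel"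
    using assms by (auto simp: sq_integrable_def)
  have "integrable lborel (\<lambda>x. (norm (f x))\<^sup>2 + (norm (g x))\<^sup>2)"
    using assms by (auto simp: sq_integrable_def)
  moreover have "norm (f x \<bullet> g x) \<le> norm ((norm (f x))\<^sup>2 + (norm (g x))\<^sup>2)" for x
  proof -
    have "\<bar>f x \<bullet> g x\<bar> \<le> norm (f x) * norm (g x)" by (rule Cauchy_Schwarz_ineq2)
    also have "\<dots> \<le> (norm (f x))\<^sup>2 + (norm (g x))\<^sup>2"
      using sum_squares_bound[of "norm (f x)" "norm (g x)"]
        mult_nonneg_nonneg[OF norm_ge_zero norm_ge_zero, of "f x" "g x"] by linarith
    finally show ?thesis by simp
  qed
  ultimately show ?thesis using m by (auto intro!: Bochner_Integration.integrable_bound[where g="\<lambda>x. f x \<bullet> g x"])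
qed

definition ae_eq :: "('b::euclidean_space \<Rightarrow> 'a::euclidean_space) \<Rightarrow> ('b \<Rightarrow> 'a) \<Rightarrow> bool" where
  "ae_eq f g \<longleftrightarrow> sq_integrable f \<and> sq_integrable g \<and> (AE x in lborel. f x = g x)"

lemma part_equivp_ae_eq: "part_equivp ae_eq"
proof (rule part_equivpI)
  show "\<exists>f. ae_eq f f" by (auto simp: ae_eq_def intro!: exI[of _ "\<lambda>x. 0"])
  show "symp ae_eq" by (auto simp: ae_eq_def symp_def)
  show "transp ae_eq" by (auto simp: transp_def ae_eq_def)
qed

quotient_type (overloaded) ('b, 'a) L2 = "'b::euclidean_space \<Rightarrow> 'a::euclidean_space" / partial: ae_eq
  morphisms L2_rep L2_abs
  by (rule part_equivp_ae_eq)

instantiation L2 :: (euclidean_space, euclidean_space) real_inner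
begin

lift_definition zero_L2 :: "('a, 'b) L2" is "\<lambda>_. 0" by (simp add: ae_eq_def)

lift_definition plus_L2 :: "('a, 'b) L2 \<Rightarrow> ('a, 'b) L2 \<Rightarrow> ('a, 'b) L2" is "\<lambda>f g x. f x + g x"
  by (auto simp: ae_eq_def intro: sq_integrable_add)

lift_definition minus_L2 :: "('a, 'b) L2 \<Rightarrow> ('a, 'b) L2 \<Rightarrow> ('a, 'b) L2" is "\<lambda>f g x. f x - g x"
  by (auto simp: ae_eq_def intro: sq_integrable_diff)

lift_definition uminus_L2 :: "('a, 'b) L2 \<Rightarrow> ('a, 'b) L2" is "\<lambda>f x. - f x"
  by (auto simp: ae_eq_def intro: sq_integrable_uminus)

lift_definition scaleR_L2 :: "real \<Rightarrow> ('a, 'b) L2 \<Rightarrow> ('a, 'b) L2" is "\<lambda>c f x. c *\<^sub>R f x"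
  by (auto simp: ae_eq_def intro: sq_integrable_scaleR)

lift_definition inner_L2 :: "('a, 'b) L2 \<Rightarrow> ('a, 'b) L2 \<Rightarrow> real" is "\<lambda>f g. LINT x|lborel. f x \<bullet> g x"
  by (auto simp: ae_eq_def intro!: integral_cong_AE dest!: sq_integrable_measurable)

definition norm_L2 :: "('a, 'b) L2 \<Rightarrow> real" where "norm_L2 f = sqrt (f \<bullet> f)"
definition dist_L2 :: "('a, 'b) L2 \<Rightarrow> ('a, 'b) L2 \<Rightarrow> real" where "dist_L2 f g = norm (f - g)"
definition sgn_L2 :: "('a, 'b) L2 \<Rightarrow> ('a, 'b) L2" where "sgn_L2 f = scaleR (inverse (norm f)) f"
definition uniformity_L2 :: "(('a, 'b) L2 \<times> ('a, 'b) L2) filter" where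
  "uniformity_L2 = (INF e\<in>{0<..}. principal {(x, y). dist x y < e})"
definition open_L2 :: "('a, 'b) L2 set \<Rightarrow> bool" where
  "open_L2 U \<longleftrightarrow> (\<forall>x\<in>U. \<forall>\<^sub>F (x', y) in uniformity. x' = x \<longrightarrow> y \<in> U)"

instance
proof
  fix f g h :: "('a, 'b) L2" and a b :: real
  show "f + g + h = f + (g + h)" by transfer (auto simp: ae_eq_def add.assoc intro: sq_integrable_add)
  show "f + g = g + f" by transfer (auto simp: ae_eq_def add.commute intro: sq_integrable_add)
  show "0 + f = f" by transfer (auto simp: ae_eq_def)
  show "- f + f = 0" by transfer (auto simp: ae_eq_def)
  show "f - g = f + - g" by transfer (auto simp: ae_eq_def intro: sq_integrable_diff)
  show "a *\<^sub>R (f + g) = a *\<^sub>R f + a *\<^sub>R g"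
    by transfer (auto simp: ae_eq_def scaleR_add_right intro: sq_integrable_add sq_integrable_scaleR)
  show "(a + b) *\<^sub>R f = a *\<^sub>R f + b *\<^sub>R f"
    by transfer (auto simp: ae_eq_def scaleR_add_left intro: sq_integrable_add sq_integrable_scaleR)
  show "a *\<^sub>R b *\<^sub>R f = (a * b) *\<^sub>R f"
    by transfer (auto simp: ae_eq_def intro: sq_integrable_scaleR)
  show "1 *\<^sub>R f = f" by transfer (auto simp: ae_eq_def)
  show "dist f g = norm (f - g)" by (rule dist_L2_def)
  show "sgn f = inverse (norm f) *\<^sub>R f" by (rule sgn_L2_def)
  show "uniformity = (INF e\<in>{0<..}. principal {(x :: ('a, 'b) L2, y). dist x y < e})"
    by (rule uniformity_L2_def)
  show "open U \<longleftrightarrow> (\<forall>x\<in>U. \<forall>\<^sub>F (x', y) in uniformity. x' = x \<longrightarrow> y \<in> U)" for U :: "('a, 'b) L2 set"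
    by (rule open_L2_def)
  show "f \<bullet> g = g \<bullet> f" by transfer (simp add: inner_commute)
  show "(f + g) \<bullet> h = f \<bullet> h + g \<bullet> h"
    by transfer (auto simp: ae_eq_def inner_add_left sq_integrable_inner)
  show "(a *\<^sub>R f) \<bullet> g = a * (f \<bullet> g)" by transfer (auto simp: ae_eq_def)
  show "0 \<le> f \<bullet> f" by transfer (auto intro: integral_nonneg_AE)
  show "f \<bullet> f = 0 \<longleftrightarrow> f = 0"
  proof transfer
    fix f :: "'a \<Rightarrow> 'b" assume "ae_eq f f"
    then have f: "sq_integrable f" by (simp add: ae_eq_def)
    have "(LINT x|lborel. f x \<bullet> f x) = 0 \<longleftrightarrow> (AE x in lborel. f x \<bullet> f x = 0)"
      using sq_integrable_inner[OF f f] by (intro integral_nonneg_eq_0_iff_AE) auto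
    then show "(LINT x|lborel. f x \<bullet> f x) = 0 \<longleftrightarrow> ae_eq f (\<lambda>_. 0)"
      using f by (simp add: ae_eq_def)
  qed
  show "norm f = sqrt (f \<bullet> f)" by (rule norm_L2_def)
qed

end

text \<open>The class of a function; functions that are not square-integrable are sent to \<open>0\<close>.\<close>

definition L2_of :: "('b::euclidean_space \<Rightarrow> 'a::euclidean_space) \<Rightarrow> ('b, 'a) L2" where
  "L2_of f = (if sq_integrable f then L2_abs f else 0)"

lemma sq_integrable_L2_rep: "sq_integrable (L2_rep f)"
  by (metis Quotient3_L2 Quotient3_rep_reflp ae_eq_def)

lemma L2_of_rep [simp]: "L2_of (L2_rep f) = f"
  by (metis L2_of_def Quotient3_L2 Quotient3_abs_rep sq_integrable_L2_rep)

lemma L2_rep_of: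
  assumes "sq_integrable f"
  shows "AE x in lborel. L2_rep (L2_of f) x = f x"
proof -
  have "ae_eq f f" using assms by (simp add: ae_eq_def)
  then have "ae_eq (L2_rep (L2_abs f)) f" using Quotient3_L2 by (rule rep_abs_rsp_left[rotated])
  then show ?thesis using assms by (simp add: L2_of_def ae_eq_def)
qed

lemma L2_of_eq_iff:
  assumes "sq_integrable f" "sq_integrable g"
  shows "L2_of f = L2_of g \<longleftrightarrow> (AE x in lborel. f x = g x)"
  using assms Quotient3_rel[OF Quotient3_L2, of f g] by (auto simp: L2_of_def ae_eq_def)

lemma L2_of_add: "sq_integrable f \<Longrightarrow> sq_integrable g \<Longrightarrow> L2_of f + L2_of g = L2_of (\<lambda>x. f x + g x)"
  by (simp add: L2_of_def sq_integrable_add plus_L2.abs_eq ae_eq_def)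

lemma L2_of_diff: "sq_integrable f \<Longrightarrow> sq_integrable g \<Longrightarrow> L2_of f - L2_of g = L2_of (\<lambda>x. f x - g x)"
  by (simp add: L2_of_def sq_integrable_diff minus_L2.abs_eq ae_eq_def)

lemma L2_of_scaleR: "sq_integrable f \<Longrightarrow> c *\<^sub>R L2_of f = L2_of (\<lambda>x. c *\<^sub>R f x)"
  by (simp add: L2_of_def sq_integrable_scaleR scaleR_L2.abs_eq ae_eq_def)

lemma L2_of_zero [simp]: "L2_of (\<lambda>x. 0) = 0"
  by (simp add: L2_of_def zero_L2.abs_eq)

lemma L2_of_sum:
  "(\<And>i. i \<in> I \<Longrightarrow> sq_integrable (f i)) \<Longrightarrow>
    (\<Sum>i\<in>I. L2_of (f i)) = L2_of (\<lambda>x. \<Sum>i\<in>I. f i x) \<and> sq_integrable (\<lambda>x. \<Sum>i\<in>I. f i x)"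
  by (induction I rule: infinite_finite_induct) (auto simp: L2_of_add intro: sq_integrable_add)

lemma inner_L2_of:
  "sq_integrable f \<Longrightarrow> sq_integrable g \<Longrightarrow> L2_of f \<bullet> L2_of g = (LINT x|lborel. f x \<bullet> g x)"
  by (simp add: L2_of_def inner_L2.abs_eq ae_eq_def)

lemma norm_L2_of: "sq_integrable f \<Longrightarrow> norm (L2_of f) = sqrt (LINT x|lborel. (norm (f x))\<^sup>2)"
  by (simp add: norm_eq_sqrt_inner[of "L2_of f"] inner_L2_of power2_norm_eq_inner)

lemma norm_L2_of_sq: "sq_integrable f \<Longrightarrow> (norm (L2_of f))\<^sup>2 = (LINT x|lborel. (norm (f x))\<^sup>2)"
  by (simp add: norm_L2_of)

lemma nn_integral_L2_of:
  "sq_integrable f \<Longrightarrow> (\<integral>\<^sup>+x. ennreal ((norm (f x))\<^sup>2) \<partial>lborel) = ennreal ((norm (L2_of f))\<^sup>2)"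
  by (simp add: norm_L2_of_sq nn_integral_eq_integral sq_integrable_def)


lemma L2_of_Fatou:
  fixes f :: "nat \<Rightarrow> 'b::euclidean_space \<Rightarrow> 'a::euclidean_space"
  assumes f: "\<And>n. sq_integrable (f n)"
    and g: "g \<in> borel_measurable lborel" "AE x in lborel. (\<lambda>n. f n x) \<longlonglongrightarrow> g x"
    and e: "\<forall>\<^sub>F n in sequentially. norm (L2_of (f n)) \<le> e"
  shows "sq_integrable g" "norm (L2_of g) \<le> e"
proof -
  obtain N where N: "\<And>n. n \<ge> N \<Longrightarrow> norm (L2_of (f n)) \<le> e"
    using e by (auto simp: eventually_sequentially)
  have e0: "0 \<le> e" using N[of N] norm_ge_zero[of "L2_of (f N)"] by linarith
  have fm: "f n \<in> borel_measurable lborel" for n using f by (simp add: sq_integrable_def)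
  note [measurable] = fm g(1)
  have "(\<integral>\<^sup>+x. ennreal ((norm (g x))\<^sup>2) \<partial>lborel)
      = (\<integral>\<^sup>+x. liminf (\<lambda>n. ennreal ((norm (f n x))\<^sup>2)) \<partial>lborel)"
  proof (rule nn_integral_cong_AE)
    show "AE x in lborel. ennreal ((norm (g x))\<^sup>2) = liminf (\<lambda>n. ennreal ((norm (f n x))\<^sup>2))"
      using g(2)
    proof eventually_elim
      case (elim x)
      have "(\<lambda>n. ennreal ((norm (f n x))\<^sup>2)) \<longlonglongrightarrow> ennreal ((norm (g x))\<^sup>2)"
        by (intro tendsto_intros elim)
      then show ?case by (intro lim_imp_Liminf[symmetric]) auto
    qed
  qed
  also have "\<dots> \<le> liminf (\<lambda>n. \<integral>\<^sup>+x. ennreal ((norm (f n x))\<^sup>2) \<partial>lborel)"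
    by (rule nn_integral_liminf) measurable
  also have "\<dots> \<le> liminf (\<lambda>n. ennreal (e\<^sup>2))"
  proof (rule Liminf_mono)
    show "\<forall>\<^sub>F n in sequentially. (\<integral>\<^sup>+x. ennreal ((norm (f n x))\<^sup>2) \<partial>lborel) \<le> ennreal (e\<^sup>2)"
      using e by eventually_elim (simp add: nn_integral_L2_of[OF f] power_mono)
  qed
  also have "\<dots> = ennreal (e\<^sup>2)" by (simp add: Liminf_const)
  finally have le: "(\<integral>\<^sup>+x. ennreal ((norm (g x))\<^sup>2) \<partial>lborel) \<le> ennreal (e\<^sup>2)" .
  then have "integrable lborel (\<lambda>x. (norm (g x))\<^sup>2)"
    by (intro integrableI_bounded) (auto intro: le_less_trans)
  then show gi: "sq_integrable g" using g(1) by (simp add: sq_integrable_def)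
  from le have "(norm (L2_of g))\<^sup>2 \<le> e\<^sup>2" by (simp add: nn_integral_L2_of[OF gi])
  then show "norm (L2_of g) \<le> e" using e0 by (rule power2_le_imp_le)
qed

lemma norm_series_Cauchy:
  fixes f :: "nat \<Rightarrow> 'a::banach"
  assumes "summable (\<lambda>n. 2 ^ n * (norm (f (Suc n) - f n))\<^sup>2)"
  shows "convergent f"
proof -
  have "(\<lambda>n. 2 ^ n * (norm (f (Suc n) - f n))\<^sup>2) \<longlonglongrightarrow> 0" by (rule summable_LIMSEQ_zero[OF assms])
  then have "Bseq (\<lambda>n. 2 ^ n * (norm (f (Suc n) - f n))\<^sup>2)"
    using convergent_imp_Bseq convergent_def by blast
  then obtain K where K: "K > 0" "\<And>n. norm (2 ^ n * (norm (f (Suc n) - f n))\<^sup>2) \<le> K"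
    by (auto simp: Bseq_def)
  have "norm (f (Suc n) - f n) \<le> sqrt K * (1 / sqrt 2) ^ n" for n
  proof -
    have "(norm (f (Suc n) - f n))\<^sup>2 \<le> K / 2 ^ n" using K(2)[of n] by (simp add: field_simps)
    then have "norm (f (Suc n) - f n) \<le> sqrt (K / 2 ^ n)" by (simp add: real_le_rsqrt)
    also have "\<dots> = sqrt K * (1 / sqrt 2) ^ n"
      by (simp add: real_sqrt_divide real_sqrt_power power_divide)
    finally show ?thesis .
  qed
  then have "\<exists>N. \<forall>n\<ge>N. norm (f (Suc n) - f n) \<le> sqrt K * (1 / sqrt 2) ^ n" by blast
  moreover have "summable (\<lambda>n. sqrt K * (1 / sqrt 2) ^ n)"
    by (rule summable_mult, rule summable_geometric) simp
  ultimately have "summable (\<lambda>n. f (Suc n) - f n)" by (rule summable_comparison_test)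
  then have "convergent (\<lambda>n. \<Sum>i<n. f (Suc i) - f i)" by (simp add: summable_iff_convergent)
  then have "convergent (\<lambda>n. f n - f 0)" by (simp add: sum_lessThan_telescope)
  then show ?thesis
    using convergent_add[OF _ convergent_const[of "f 0"], of "\<lambda>n. f n - f 0"] by simp
qed

instance L2 :: (euclidean_space, euclidean_space) complete_space
proof
  fix X :: "nat \<Rightarrow> ('a, 'b) L2" assume X: "Cauchy X"
  have "\<forall>n. \<exists>N. \<forall>i\<ge>N. \<forall>j\<ge>N. dist (X i) (X j) < (1/2) ^ n"
    using X by (auto simp: Cauchy_def)
  then obtain N0 where N0: "\<And>n i j. i \<ge> N0 n \<Longrightarrow> j \<ge> N0 n \<Longrightarrow> dist (X i) (X j) < (1/2) ^ n"
    by metis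
  define r where "r n = (\<Sum>k\<le>n. N0 k) + n" for n
  have r: "strict_mono r" by (auto simp: r_def strict_mono_Suc_iff)
  have rN: "r n \<ge> N0 n" for n by (auto simp: r_def intro: trans_le_add1 member_le_sum)
  define f where "f n = L2_rep (X (r n))" for n
  have f: "sq_integrable (f n)" for n by (simp add: f_def sq_integrable_L2_rep)
  have Xf: "X (r n) = L2_of (f n)" for n by (simp add: f_def)
  have fd: "sq_integrable (\<lambda>x. f i x - f j x)" for i j by (intro sq_integrable_diff f)
  have dist: "norm (L2_of (\<lambda>x. f i x - f j x)) < (1/2) ^ n" if "i \<ge> n" "j \<ge> n" for i j n
    using N0[of n "r i" "r j"] rN[of n] that strict_mono_leD[OF r, of n i] strict_mono_leD[OF r, of n j]
    by (simp add: dist_norm Xf L2_of_diff f)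
  have [measurable]: "f n \<in> borel_measurable lborel" for n using f by (simp add: sq_integrable_def)
  have "(\<integral>\<^sup>+x. (\<Sum>n. ennreal (2 ^ n * (norm (f (Suc n) x - f n x))\<^sup>2)) \<partial>lborel)
      = (\<Sum>n. \<integral>\<^sup>+x. ennreal (2 ^ n * (norm (f (Suc n) x - f n x))\<^sup>2) \<partial>lborel)"
    by (rule nn_integral_suminf) measurable
  also have "\<dots> \<le> (\<Sum>n. ennreal ((1/2) ^ n))"
  proof (intro suminf_le allI)
    fix n
    have "(\<integral>\<^sup>+x. ennreal (2 ^ n * (norm (f (Suc n) x - f n x))\<^sup>2) \<partial>lborel)
      = ennreal (2 ^ n) * ennreal ((norm (L2_of (\<lambda>x. f (Suc n) x - f n x)))\<^sup>2)"
      by (simp add: ennreal_mult nn_integral_cmult nn_integral_L2_of[OF fd])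
    also have "\<dots> \<le> ennreal (2 ^ n) * ennreal (((1/2) ^ n)\<^sup>2)"
      using dist[of n "Suc n" n] by (intro mult_left_mono ennreal_leI power_mono) auto
    also have "\<dots> = ennreal ((1/2) ^ n)"
      by (simp add: ennreal_mult[symmetric] power2_eq_square power_one_over field_simps)
    finally show "(\<integral>\<^sup>+x. ennreal (2 ^ n * (norm (f (Suc n) x - f n x))\<^sup>2) \<partial>lborel) \<le> ennreal ((1/2) ^ n)" .
  qed auto
  also have "\<dots> = ennreal (\<Sum>n. (1/2) ^ n)"
    by (intro suminf_ennreal2) (auto intro: summable_geometric)
  also have "\<dots> < \<infinity>" by simp
  finally have "AE x in lborel. (\<Sum>n. ennreal (2 ^ n * (norm (f (Suc n) x - f n x))\<^sup>2)) \<noteq> \<infinity>"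
    by (intro nn_integral_PInf_AE) auto
  then have conv: "AE x in lborel. convergent (\<lambda>n. f n x)"
  proof eventually_elim
    case (elim x)
    then have "summable (\<lambda>n. 2 ^ n * (norm (f (Suc n) x - f n x))\<^sup>2)"
      by (intro summable_suminf_not_top) auto
    then show ?case by (rule norm_series_Cauchy[of "\<lambda>n. f n x"])
  qed
  define g where "g x = lim (\<lambda>n. f n x)" for x
  have gm [measurable]: "g \<in> borel_measurable lborel"
    unfolding g_def by (rule borel_measurable_lim_metric) measurable
  have lim: "AE x in lborel. (\<lambda>n. f n x) \<longlonglongrightarrow> g x"
    using conv by eventually_elim (simp add: g_def convergent_LIMSEQ_iff)
  have G: "sq_integrable (\<lambda>x. g x - f n x) \<and> norm (L2_of (\<lambda>x. g x - f n x)) \<le> (1/2) ^ n" for n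
  proof -
    have 1: "AE x in lborel. (\<lambda>k. f k x - f n x) \<longlonglongrightarrow> g x - f n x"
      using lim by eventually_elim (intro tendsto_intros)
    have 2: "\<forall>\<^sub>F k in sequentially. norm (L2_of (\<lambda>x. f k x - f n x)) \<le> (1/2) ^ n"
      using eventually_ge_at_top[of n] by eventually_elim (use dist in \<open>force intro: less_imp_le\<close>)
    show ?thesis using L2_of_Fatou[OF fd _ 1 2] by auto
  qed
  have g: "sq_integrable g" using sq_integrable_add[OF conjunct1[OF G[of 0]] f[of 0]] by simp
  have "norm ((X \<circ> r) n - L2_of g) \<le> (1/2) ^ n" for n
  proof -
    have "norm ((X \<circ> r) n - L2_of g) = norm (L2_of g - L2_of (f n))"
      by (simp add: Xf norm_minus_commute)
    then show ?thesis using G[of n] by (simp add: L2_of_diff f g)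
  qed
  then have "(\<lambda>n. norm ((X \<circ> r) n - L2_of g)) \<longlonglongrightarrow> 0"
    by (intro tendsto_sandwich[OF _ _ tendsto_const LIMSEQ_realpow_zero[of "1/2"]]) auto
  then have "(X \<circ> r) \<longlonglongrightarrow> L2_of g"
    by (simp add: LIM_zero_iff tendsto_norm_zero_iff o_def)
  then have "X \<longlonglongrightarrow> L2_of g"
    using Cauchy_converges_subseq[OF X r] by blast
  then show "convergent X" by (auto simp: convergent_def)
qed

instance L2 :: (euclidean_space, euclidean_space) banach ..

lemma tendsto_L2_of_dominated:
  fixes f :: "nat \<Rightarrow> 'b::euclidean_space \<Rightarrow> 'a::euclidean_space"
  assumes f: "\<And>n. f n \<in> borel_measurable lborel" and g: "sq_integrable g"
    and lim: "AE x in lborel. (\<lambda>n. f n x) \<longlonglongrightarrow> g x"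
    and dom: "\<And>n. AE x in lborel. norm (f n x) \<le> c * norm (g x)"
  shows "(\<lambda>n. L2_of (f n)) \<longlonglongrightarrow> L2_of g"
proof -
  have fi: "sq_integrable (f n)" for n by (rule sq_integrable_bound[OF g f dom])
  have [measurable]: "g \<in> borel_measurable lborel" "\<And>n. f n \<in> borel_measurable lborel"
    using g f by (auto simp: sq_integrable_def)
  have "(\<lambda>n. LINT x|lborel. (norm (f n x - g x))\<^sup>2) \<longlonglongrightarrow> (LINT (x::'b)|lborel. 0 :: real)"
  proof (rule integral_dominated_convergence[where w="\<lambda>x::'b. (2 * c\<^sup>2 + 2) * (norm (g x))\<^sup>2"])
    show "integrable lborel (\<lambda>x. (2 * c\<^sup>2 + 2) * (norm (g x))\<^sup>2)"
      using g by (simp add: sq_integrable_def)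
    show "AE x in lborel. (\<lambda>n. (norm (f n x - g x))\<^sup>2) \<longlonglongrightarrow> 0"
      using lim
    proof eventually_elim
      case (elim x)
      have "(\<lambda>n. (norm (f n x - g x))\<^sup>2) \<longlonglongrightarrow> (norm (g x - g x))\<^sup>2"
        by (intro tendsto_intros elim)
      then show ?case by simp
    qed
    show "AE x in lborel. norm ((norm (f n x - g x))\<^sup>2) \<le> (2 * c\<^sup>2 + 2) * (norm (g x))\<^sup>2" for n
      using dom[of n]
    proof eventually_elim
      case (elim x)
      then have "(norm (f n x))\<^sup>2 \<le> c\<^sup>2 * (norm (g x))\<^sup>2"
        using power_mono[OF elim, of 2] by (simp add: power_mult_distrib)
      with norm_add_sq[of "f n x" "- g x"] show ?case by (simp add: algebra_simps)
    qed
  qed measurable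
  then have "(\<lambda>n. sqrt (LINT x|lborel. (norm (f n x - g x))\<^sup>2)) \<longlonglongrightarrow> sqrt 0"
    by (intro tendsto_real_sqrt) simp
  then have "(\<lambda>n. norm (L2_of (f n) - L2_of g)) \<longlonglongrightarrow> 0"
    by (simp add: L2_of_diff fi g norm_L2_of sq_integrable_diff)
  then show ?thesis by (simp add: LIM_zero_iff tendsto_norm_zero_iff)
qed

lemma sq_integrable_indicator:
  assumes "A \<in> sets borel" "emeasure lborel A < \<infinity>"
  shows "sq_integrable (\<lambda>x::'b::euclidean_space. indicator A x *\<^sub>R (v :: 'a::euclidean_space))"
proof -
  have "(\<lambda>x. (norm (indicator A x *\<^sub>R v))\<^sup>2) = (\<lambda>x. (norm v)\<^sup>2 * indicator A x)"
    by (auto simp: indicator_def)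
  then show ?thesis using assms by (auto simp: sq_integrable_def)
qed

lemma L2_closed_contains_all:
  fixes E :: "'b::euclidean_space set set" and S :: "('b, 'a::euclidean_space) L2 set"
  assumes S: "closed S" "subspace S"
    and E: "Int_stable E" "sets borel = sigma_sets UNIV E"
    and basic: "\<And>U n b. U \<in> E \<Longrightarrow> b \<in> Basis \<Longrightarrow> L2_of (\<lambda>x. indicator (U \<inter> ball 0 (real n)) x *\<^sub>R b) \<in> S"
    and whole: "\<And>n b. b \<in> Basis \<Longrightarrow> L2_of (\<lambda>x. indicator (ball 0 (real n)) x *\<^sub>R b) \<in> S"
  shows "f \<in> S"
proof -
  have meas: "A \<in> sets borel \<Longrightarrow> A \<inter> ball 0 (real n) \<in> sets borel" for A :: "'b set" and n by simp
  have fin: "A \<in> sets borel \<Longrightarrow> emeasure lborel (A \<inter> ball 0 (real n)) < \<infinity>" for A :: "'b set" and n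
  proof -
    have "emeasure lborel (A \<inter> ball 0 (real n)) \<le> emeasure lborel (ball (0::'b) (real n))"
      by (rule emeasure_mono) auto
    also have "\<dots> < \<infinity>" by (rule emeasure_bounded_finite) simp
    finally show "emeasure lborel (A \<inter> ball 0 (real n)) < \<infinity>" .
  qed
  have int: "sq_integrable (\<lambda>x. indicator (A \<inter> ball 0 (real n)) x *\<^sub>R v)"
    if "A \<in> sets borel" for A :: "'b set" and n and v :: 'a
    using that by (intro sq_integrable_indicator meas fin)
  have EU: "E \<subseteq> Pow UNIV" by simp
  have ind: "L2_of (\<lambda>x. indicator (A \<inter> ball 0 (real n)) x *\<^sub>R b) \<in> S"
    if "A \<in> sets borel" "b \<in> Basis" for A n b
    using E(1) EU that(1)[unfolded E(2)]
  proof (induction A rule: sigma_sets_induct_disjoint)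
    case (basic A)
    then show ?case using assms(5) that by auto
  next
    case empty
    then show ?case using subspace_0[OF S(2)] by simp
  next
    case (compl A)
    have A: "A \<in> sets borel" using compl(1) by (simp add: E(2))
    have "L2_of (\<lambda>x. indicator ((UNIV - A) \<inter> ball 0 (real n)) x *\<^sub>R b) =
      L2_of (\<lambda>x. indicator (ball 0 (real n)) x *\<^sub>R b) - L2_of (\<lambda>x. indicator (A \<inter> ball 0 (real n)) x *\<^sub>R b)"
    proof (subst L2_of_diff)
      show "sq_integrable (\<lambda>x::'b. indicator (ball 0 (real n)) x *\<^sub>R b)"
        using int[of UNIV n b] by simp
      show "sq_integrable (\<lambda>x. indicator (A \<inter> ball 0 (real n)) x *\<^sub>R b)" by (rule int[OF A])
    qed (auto intro!: arg_cong[of _ _ L2_of] simp: fun_eq_iff indicator_def)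
    then show ?case using compl whole[OF that(2)] subspace_diff[OF S(2)] by metis
  next
    case (union A)
    have A: "A i \<in> sets borel" for i using union(2) by (auto simp: E(2))
    define h where "h k x = (\<Sum>i<k. indicator (A i \<inter> ball 0 (real n)) x *\<^sub>R b)" for k :: nat and x
    have hS: "L2_of (h k) \<in> S" for k
    proof -
      have "L2_of (h k) = (\<Sum>i<k. L2_of (\<lambda>x. indicator (A i \<inter> ball 0 (real n)) x *\<^sub>R b))"
        unfolding h_def[abs_def] by (intro conjunct1[OF L2_of_sum, symmetric] int A)
      then show ?thesis by (simp only: subspace_sum[OF S(2)] union(3))
    qed
    have heq: "h k x = indicator ((\<Union>i<k. A i) \<inter> ball 0 (real n)) x *\<^sub>R b" for k x
    proof -
      have "(\<Sum>i<k. indicator (A i) x) = (indicator (\<Union>i<k. A i) x :: real)"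
        using union(1) by (intro indicator_UN_disjoint[symmetric])
          (auto simp: disjoint_family_on_def)
      then show ?thesis by (simp add: h_def indicator_inter_arith scaleR_sum_left[symmetric] sum_distrib_right[symmetric])
    qed
    have "(\<lambda>k. L2_of (h k)) \<longlonglongrightarrow> L2_of (\<lambda>x. indicator ((\<Union>i. A i) \<inter> ball 0 (real n)) x *\<^sub>R b)"
    proof (rule tendsto_L2_of_dominated[where c=1])
      show "h k \<in> borel_measurable lborel" for k
      proof -
        have "sq_integrable (\<lambda>x. indicator ((\<Union>i<k. A i) \<inter> ball 0 (real n)) x *\<^sub>R b)"
          using A by (intro int) auto
        then show ?thesis unfolding heq[abs_def] by (rule sq_integrable_measurable)
      qed
      show "sq_integrable (\<lambda>x. indicator ((\<Union>i. A i) \<inter> ball 0 (real n)) x *\<^sub>R b)"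
        using A by (intro int) auto
      show "AE x in lborel. (\<lambda>k. h k x) \<longlonglongrightarrow> indicator ((\<Union>i. A i) \<inter> ball 0 (real n)) x *\<^sub>R b"
      proof (rule AE_I2)
        fix x :: 'b
        have "(\<lambda>k. indicator (\<Union>i<k. A i) x :: real) \<longlonglongrightarrow> indicator (\<Union>i. A i) x"
          by (rule LIMSEQ_indicator_UN)
        then show "(\<lambda>k. h k x) \<longlonglongrightarrow> indicator ((\<Union>i. A i) \<inter> ball 0 (real n)) x *\<^sub>R b"
          unfolding heq indicator_inter_arith by (intro tendsto_intros)
      qed
      show "AE x in lborel. norm (h k x) \<le> 1 * norm (indicator ((\<Union>i. A i) \<inter> ball 0 (real n)) x *\<^sub>R b)" for k
        unfolding heq by (auto simp: indicator_def)
    qed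
    with hS show ?case by (rule closed_sequentially[OF S(1)])
  qed
  have ind2: "L2_of (\<lambda>x. indicator (A \<inter> ball 0 (real n)) x *\<^sub>R v) \<in> S" if A: "A \<in> sets borel" for A n v
  proof -
    have "(\<Sum>b\<in>Basis. (v \<bullet> b) *\<^sub>R L2_of (\<lambda>x. indicator (A \<inter> ball 0 (real n)) x *\<^sub>R b))
        = (\<Sum>b\<in>Basis. L2_of (\<lambda>x. (v \<bullet> b) *\<^sub>R indicator (A \<inter> ball 0 (real n)) x *\<^sub>R b))"
      using int[OF A, of n] by (intro sum.cong refl L2_of_scaleR) auto
    also have "\<dots> = L2_of (\<lambda>x. \<Sum>b\<in>Basis. (v \<bullet> b) *\<^sub>R indicator (A \<inter> ball 0 (real n)) x *\<^sub>R b)"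
      by (intro conjunct1[OF L2_of_sum] sq_integrable_scaleR int[OF A])
    also have "(\<lambda>x. \<Sum>b\<in>Basis. (v \<bullet> b) *\<^sub>R indicator (A \<inter> ball 0 (real n)) x *\<^sub>R b)
        = (\<lambda>x. indicator (A \<inter> ball 0 (real n)) x *\<^sub>R v)"
      by (auto simp: fun_eq_iff indicator_def euclidean_representation)
    finally show ?thesis
      using ind[OF A] subspace_sum[OF S(2)] subspace_scale[OF S(2)] by (metis (no_types, lifting))
  qed
  define g where "g = L2_rep f"
  have g: "sq_integrable g" by (simp add: g_def sq_integrable_L2_rep)
  obtain s where s: "\<And>i. simple_function lborel (s i)" "\<And>x. (\<lambda>i. s i x) \<longlonglongrightarrow> g x"
      "\<And>i x. norm (s i x) \<le> 2 * norm (g x)"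
    using borel_measurable_implies_sequence_metric[of g lborel 0] g by (auto simp: sq_integrable_def)
  define h where "h i x = indicator (ball 0 (real i)) x *\<^sub>R s i x" for i x
  have sb: "s i -` {y} \<in> sets borel" for i y
    using simple_functionD(2)[OF s(1), of i "{y}"] by simp
  have "L2_of (h i) \<in> S" for i
  proof -
    have fs: "finite (range (s i))" using simple_functionD(1)[OF s(1), of i] by simp
    have "h i = (\<lambda>x. \<Sum>y\<in>range (s i). indicator (s i -` {y} \<inter> ball 0 (real i)) x *\<^sub>R y)"
    proof
      fix x
      have "(\<Sum>y\<in>range (s i). indicator (s i -` {y} \<inter> ball 0 (real i)) x *\<^sub>R y)
          = (\<Sum>y\<in>range (s i). if y = s i x then indicator (ball 0 (real i)) x *\<^sub>R y else 0)"
        by (intro sum.cong) (auto simp: indicator_def)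
      also have "\<dots> = h i x" using fs by (simp add: h_def)
      finally show "h i x = (\<Sum>y\<in>range (s i). indicator (s i -` {y} \<inter> ball 0 (real i)) x *\<^sub>R y)" ..
    qed
    then have "L2_of (h i) = (\<Sum>y\<in>range (s i). L2_of (\<lambda>x. indicator (s i -` {y} \<inter> ball 0 (real i)) x *\<^sub>R y))"
      using int[OF sb] by (simp add: L2_of_sum)
    then show ?thesis using ind2[OF sb] by (auto intro: subspace_sum[OF S(2)])
  qed
  moreover have "(\<lambda>i. L2_of (h i)) \<longlonglongrightarrow> L2_of g"
  proof (rule tendsto_L2_of_dominated[OF _ g, where c=2])
    show "h i \<in> borel_measurable lborel" for i
    proof -
      have [measurable]: "s i \<in> borel_measurable borel" "ball (0::'b) (real i) \<in> sets borel"
        using borel_measurable_simple_function[OF s(1), of i] by auto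
      show ?thesis unfolding h_def[abs_def] by measurable
    qed
    show "AE x in lborel. (\<lambda>i. h i x) \<longlonglongrightarrow> g x"
    proof (rule AE_I2)
      fix x :: 'b
      have "\<forall>\<^sub>F i in sequentially. s i x = h i x"
        using eventually_gt_at_top[of "nat \<lceil>norm x\<rceil>"]
        by eventually_elim (auto simp: h_def indicator_def, linarith)
      then show "(\<lambda>i. h i x) \<longlonglongrightarrow> g x" using s(2)[of x] by (rule Lim_transform_eventually[rotated])
    qed
    show "AE x in lborel. norm (h i x) \<le> 2 * norm (g x)" for i
      using s(3) by (auto simp: h_def indicator_def)
  qed
  ultimately have "L2_of g \<in> S" by (rule closed_sequentially[OF S(1)])
  then show ?thesis by (simp add: g_def)
qed

lemma countable_dense_span:
  fixes G :: "'a::real_normed_vector set"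
  assumes "countable G"
  shows "\<exists>D. countable D \<and> closed (closure D) \<and> subspace (closure D) \<and> G \<subseteq> closure D"
proof -
  define ev :: "(rat \<times> 'a) list \<Rightarrow> 'a" where
    "ev l = sum_list (map (\<lambda>(q, d). of_rat q *\<^sub>R d) l)" for l
  define D where "D = ev ` lists (UNIV \<times> G)"
  have D0: "0 \<in> D" by (auto simp: D_def ev_def intro!: image_eqI[of _ _ "[]"])
  have Dadd: "x + y \<in> D" if xy: "x \<in> D" "y \<in> D" for x y
  proof -
    obtain l m where "l \<in> lists (UNIV \<times> G)" "m \<in> lists (UNIV \<times> G)" "x = ev l" "y = ev m"
      using xy by (auto simp: D_def)
    then show ?thesis unfolding D_def by (intro image_eqI[of _ _ "l @ m"]) (auto simp: ev_def)
  qed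
  have ev_scale: "ev (map (\<lambda>(p, d). (q * p, d)) l) = of_rat q *\<^sub>R ev l" for q l
    by (induction l) (auto simp: ev_def of_rat_mult scaleR_add_right)
  have Dscale: "of_rat q *\<^sub>R x \<in> D" if x: "x \<in> D" for x q
  proof -
    obtain l where l: "l \<in> lists (UNIV \<times> G)" "x = ev l"
      using x by (auto simp: D_def)
    have "map (\<lambda>(p, d). (q * p, d)) l \<in> lists (UNIV \<times> G)" using l(1) by (auto simp: in_lists_conv_set)
    then show ?thesis unfolding D_def using l by (metis ev_scale image_eqI)
  qed
  have "countable D" unfolding D_def using assms by (intro countable_image countable_lists) auto
  moreover have "G \<subseteq> closure D"
  proof
    fix d assume "d \<in> G"
    then have "d \<in> D" unfolding D_def by (intro image_eqI[of _ _ "[(1, d)]"]) (auto simp: ev_def)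
    then show "d \<in> closure D" using closure_subset by blast
  qed
  moreover have "subspace (closure D)"
    unfolding subspace_def
  proof (intro conjI ballI allI)
    show "0 \<in> closure D" using D0 closure_subset by blast
  next
    fix x y assume "x \<in> closure D" "y \<in> closure D"
    then obtain u v where uv: "\<And>n::nat. u n \<in> D" "u \<longlonglongrightarrow> x" "\<And>n. v n \<in> D" "v \<longlonglongrightarrow> y"
      unfolding closure_sequential by metis
    then show "x + y \<in> closure D"
      unfolding closure_sequential using Dadd
      by (intro exI[of _ "\<lambda>n. u n + v n"]) (auto intro: tendsto_add)
  next
    fix c :: real and x assume "x \<in> closure D"
    then obtain u where u: "\<And>n::nat. u n \<in> D" "u \<longlonglongrightarrow> x"
      unfolding closure_sequential by metis
    have "\<exists>q. \<bar>of_rat q - c\<bar> < 1 / real (Suc n)" for n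
    proof -
      have "0 < 1 / real (Suc n)" by simp
      then have "c - 1 / real (Suc n) < c + 1 / real (Suc n)" by linarith
      from of_rat_dense[OF this] obtain q where
        "c - 1 / real (Suc n) < of_rat q" "of_rat q < c + 1 / real (Suc n)" by blast
      then have "\<bar>of_rat q - c\<bar> < 1 / real (Suc n)" by linarith
      then show ?thesis by blast
    qed
    then obtain q where q: "\<And>n. \<bar>of_rat (q n) - c\<bar> < 1 / real (Suc n)" by metis
    have "(\<lambda>n. of_rat (q n) - c) \<longlonglongrightarrow> 0"
      by (rule Lim_null_comparison[OF _ lim_1_over_n[THEN LIMSEQ_Suc]])
        (use q in \<open>auto intro!: always_eventually less_imp_le\<close>)
    then have "(\<lambda>n. of_rat (q n)) \<longlonglongrightarrow> c" by (simp add: LIM_zero_iff)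
    then show "c *\<^sub>R x \<in> closure D"
      unfolding closure_sequential using u Dscale
      by (intro exI[of _ "\<lambda>n. of_rat (q n) *\<^sub>R u n"]) (auto intro: tendsto_scaleR)
  qed
  ultimately show ?thesis by (intro exI[of _ D]) simp
qed

instance L2 :: (euclidean_space, euclidean_space) second_countable_topology
proof
  obtain B :: "'a set set" where B: "countable B" "topological_basis B"
    using ex_countable_basis by blast
  define E where "E = Inter ` {b. finite b \<and> b \<subseteq> B}"
  have cE: "countable E" unfolding E_def using B(1)
    by (intro countable_image countable_Collect_finite_subset)
  have isE: "Int_stable E"
    unfolding E_def Int_stable_def
  proof safe
    fix X Y assume "finite X" "X \<subseteq> B" "finite Y" "Y \<subseteq> B"
    then show "\<Inter>X \<inter> \<Inter>Y \<in> Inter ` {b. finite b \<and> b \<subseteq> B}"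
      by (intro image_eqI[of _ _ "X \<union> Y"]) auto
  qed
  have "B \<subseteq> E" unfolding E_def by (auto intro!: image_eqI[of _ _ "{_}"])
  moreover have "E \<subseteq> sets borel"
  proof
    fix U assume "U \<in> E"
    then obtain b where "finite b" "b \<subseteq> B" "U = \<Inter>b" by (auto simp: E_def)
    then have "open U" using topological_basis_open[OF B(2)] by (auto intro: open_Inter)
    then show "U \<in> sets borel" by simp
  qed
  moreover have "sets borel = sigma_sets UNIV B"
    by (subst borel_eq_countable_basis[OF B]) simp
  ultimately have sE: "sets borel = sigma_sets UNIV E"
    by (metis sets.sigma_sets_subset sigma_sets_mono' space_borel subset_antisym)
  define G :: "('a, 'b) L2 set" where
    "G = (\<lambda>(U, n, b). L2_of (\<lambda>x. indicator (U \<inter> ball 0 (real n)) x *\<^sub>R b)) ` (insert UNIV E \<times> (UNIV :: nat set) \<times> Basis)"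
  have "countable G" unfolding G_def using cE by (intro countable_image countable_SIGMA) (auto intro: countable_finite)
  from countable_dense_span[OF this] obtain D where
    D: "countable D" "closed (closure D)" "subspace (closure D)" "G \<subseteq> closure D" by blast
  have dense: "f \<in> closure D" for f
  proof (rule L2_closed_contains_all[OF D(2,3) isE sE])
    fix U :: "'a set" and n :: nat and b :: 'b
    assume "U \<in> E" "b \<in> Basis"
    then have "L2_of (\<lambda>x. indicator (U \<inter> ball 0 (real n)) x *\<^sub>R b) \<in> G"
      unfolding G_def by (intro image_eqI[of _ _ "(U, n, b)"]) auto
    then show "L2_of (\<lambda>x. indicator (U \<inter> ball 0 (real n)) x *\<^sub>R b) \<in> closure D" using D(4) by blast
  next
    fix n :: nat and b :: 'b
    assume "b \<in> Basis"
    then have "L2_of (\<lambda>x. indicator (ball 0 (real n)) x *\<^sub>R b) \<in> G"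
      unfolding G_def by (intro image_eqI[of _ _ "(UNIV, n, b)"]) auto
    then show "L2_of (\<lambda>x. indicator (ball 0 (real n)) x *\<^sub>R b) \<in> closure D" using D(4) by blast
  qed
  define BB where "BB = (\<lambda>(d, n). ball d (1 / real (Suc n))) ` (D \<times> UNIV)"
  have "countable BB" unfolding BB_def using D(1) by (intro countable_image countable_SIGMA) auto
  moreover have "topological_basis BB"
  proof (rule topological_basisI)
    fix U assume "U \<in> BB" then show "open U" by (auto simp: BB_def)
  next
    fix U and x :: "('a, 'b) L2" assume "open U" "x \<in> U"
    then obtain e where e: "e > 0" "ball x e \<subseteq> U" using open_contains_ball by blast
    obtain n where n: "1 / real (Suc n) < e / 2" using nat_approx_posE[of "e / 2"] e(1) by auto
    obtain d where d: "d \<in> D" "dist d x < 1 / real (Suc n)"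
      using dense[of x] unfolding closure_approachable by (metis of_nat_0_less_iff zero_less_Suc zero_less_divide_1_iff)
    have "ball d (1 / real (Suc n)) \<subseteq> U"
    proof
      fix y assume "y \<in> ball d (1 / real (Suc n))"
      then have "dist x y < e" using d(2) n dist_triangle[of x y d] by (simp add: dist_commute)
      then show "y \<in> U" using e(2) by auto
    qed
    then show "\<exists>B'\<in>BB. x \<in> B' \<and> B' \<subseteq> U"
      using d unfolding BB_def by (intro bexI[of _ "ball d (1 / real (Suc n))"]) auto
  qed
  ultimately show "\<exists>B :: ('a, 'b) L2 set set. countable B \<and> open = generate_topology B"
    using topological_basis_imp_subbasis by blast
qed

section \<open>The spaces \<open>L\<^sup>2(A)\<close>\<close>

text \<open>\<open>L\<^sup>2(A)\<close> is represented by the classes on the whole space that vanish almost everywhere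
  outside \<open>A\<close>, and a function on \<open>A\<close> is embedded by extending it by \<open>0\<close>.
  Thus \<open>H = L\<^sup>2(0,T)\<close> is \<open>L2_on {0<..<T}\<close> and \<open>H\<^sub>\<box>\<close> is
  \<open>L2_on ({0<..<T} \<times> {0<..<T})\<close>, with the norms of the ambient types.\<close>

definition L2_on :: "'b::euclidean_space set \<Rightarrow> ('b, 'a::euclidean_space) L2 set" where
  "L2_on A = {f. AE x in lborel. x \<notin> A \<longrightarrow> L2_rep f x = 0}"

definition L2_restrict :: "'b::euclidean_space set \<Rightarrow> ('b \<Rightarrow> 'a::euclidean_space) \<Rightarrow> ('b, 'a) L2" where
  "L2_restrict A f = L2_of (\<lambda>x. indicator A x *\<^sub>R f x)"

text \<open>The section \<open>f(r,\<cdot>)\<close>; by Fubini it does not depend on the representative,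
  for almost every \<open>r\<close>.\<close>

definition L2_slice :: "('b::euclidean_space \<times> 'c::euclidean_space, 'a::euclidean_space) L2 \<Rightarrow> 'b \<Rightarrow> ('c, 'a) L2" where
  "L2_slice f r = L2_of (\<lambda>x. L2_rep f (r, x))"

type_synonym 'd Hspace = "(real, real ^ 'd) L2"
type_synonym 'd Hsquare = "(real \<times> real, real ^ 'd) L2"

section \<open>The drift\<close>

text \<open>A path in \<open>C([0,T];\<real>\<^sup>d)\<close> is a function on \<open>\<real>\<close> that is continuous on
  \<open>[0,T]\<close>. Its values outside \<open>[0,T]\<close> are irrelevant: the Lipschitz condition below
  makes \<open>B\<close> insensitive to them.\<close>

definition paths :: "real \<Rightarrow> (real \<Rightarrow> real ^ 'd) set" where
  "paths T = {w. continuous_on {0..T} w}"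

abbreviation path_class :: "real \<Rightarrow> (real \<Rightarrow> real ^ 'd) \<Rightarrow> 'd Hspace" where
  "path_class T w \<equiv> L2_restrict {0<..<T} w"

definition volterra_lipschitz :: "real \<Rightarrow> ((real \<Rightarrow> real ^ 'd) \<Rightarrow> 'd Hsquare) \<Rightarrow> bool" where
  "volterra_lipschitz T B \<longleftrightarrow>
    (\<forall>w\<in>paths T. B w \<in> L2_on ({0<..<T} \<times> {0<..<T})) \<and>
    (\<exists>C\<^sub>0>0.
      (\<forall>w\<in>paths T. norm (B w) \<le> C\<^sub>0 * (1 + norm (path_class T w))) \<and>
      (\<forall>w\<^sub>1\<in>paths T. \<forall>w\<^sub>2\<in>paths T.
        norm (B w\<^sub>1 - B w\<^sub>2) \<le> C\<^sub>0 * norm (path_class T w\<^sub>1 - path_class T w\<^sub>2))) \<and>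
    (\<forall>w\<in>paths T. \<forall>t. 0 < t \<and> t \<le> T \<longrightarrow>
      (AE r in lborel. r \<in> {0<..<t} \<longrightarrow>
        (AE \<xi> in lborel. \<xi> \<in> {0<..<r} \<longrightarrow> L2_rep (L2_slice (B w) r) \<xi> = 0))) \<and>
    (\<forall>w\<^sub>1\<in>paths T. \<forall>w\<^sub>2\<in>paths T. \<forall>t. 0 < t \<and> t \<le> T \<and> (\<forall>\<xi>\<in>{0<..<t}. w\<^sub>1 \<xi> = w\<^sub>2 \<xi>) \<longrightarrow>
      (AE r in lborel. r \<in> {0<..<t} \<longrightarrow> L2_slice (B w\<^sub>1) r = L2_slice (B w\<^sub>2) r))"

text \<open>The conditions determine the extension on \<open>H\<close>; outside \<open>H\<close> its values are arbitrary.\<close>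

definition drift_ext :: "real \<Rightarrow> ((real \<Rightarrow> real ^ 'd) \<Rightarrow> 'd Hsquare) \<Rightarrow> 'd Hspace \<Rightarrow> 'd Hsquare" where
  "drift_ext T B = (SOME G. continuous_on (L2_on {0<..<T}) G \<and>
    G ` L2_on {0<..<T} \<subseteq> L2_on ({0<..<T} \<times> {0<..<T}) \<and>
    (\<forall>w\<in>paths T. G (path_class T w) = B w))"

section \<open>Brownian motion and the Ito integral\<close>

definition usual_filtered_space :: "'w measure \<Rightarrow> (real \<Rightarrow> 'w measure) \<Rightarrow> real \<Rightarrow> bool" where
  "usual_filtered_space M F T \<longleftrightarrow>
    prob_space M \<and> complete_measure M \<and>
    (\<forall>t\<in>{0..T}. subalgebra M (F t)) \<and>
    (\<forall>s t. 0 \<le> s \<and> s \<le> t \<and> t \<le> T \<longrightarrow> sets (F s) \<subseteq> sets (F t)) \<and>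
    (\<forall>t. 0 \<le> t \<and> t < T \<longrightarrow> sets (F t) = (\<Inter>u\<in>{t<..T}. sets (F u))) \<and>
    null_sets M \<subseteq> sets (F 0)"

definition brownian_motion ::
    "'w measure \<Rightarrow> (real \<Rightarrow> 'w measure) \<Rightarrow> real \<Rightarrow> (real \<Rightarrow> 'w \<Rightarrow> real ^ 'd) \<Rightarrow> bool" where
  "brownian_motion M F T W \<longleftrightarrow>
    (\<forall>t\<in>{0..T}. W t \<in> borel_measurable (F t)) \<and>
    (AE \<omega> in M. W 0 \<omega> = 0) \<and>
    (AE \<omega> in M. continuous_on {0..T} (\<lambda>t. W t \<omega>)) \<and>
    (\<forall>s t. 0 \<le> s \<and> s < t \<and> t \<le> T \<longrightarrow>
      (\<forall>i. distributed M lborel (\<lambda>\<omega>. (W t \<omega> - W s \<omega>) $ i) (normal_density 0 (sqrt (t - s)))) \<and>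
      prob_space.indep_vars M (\<lambda>_. borel) (\<lambda>i \<omega>. (W t \<omega> - W s \<omega>) $ i) UNIV \<and>
      prob_space.indep_set M (sets (F s))
        {(\<lambda>\<omega>. W t \<omega> - W s \<omega>) -` A \<inter> space M | A. A \<in> sets borel})"

text \<open>An elementary process on \<open>[s,t]\<close> takes the value \<open>\<xi> i\<close>, bounded and
  \<open>F (\<tau> i)\<close>-measurable, on \<open>(\<tau> i, \<tau> (i+1)]\<close> for \<open>i < n\<close>.\<close>

definition elementary_process ::
    "'w measure \<Rightarrow> (real \<Rightarrow> 'w measure) \<Rightarrow> real \<Rightarrow> real \<Rightarrow> nat \<Rightarrow> (nat \<Rightarrow> real) \<Rightarrow>
      (nat \<Rightarrow> 'w \<Rightarrow> (real ^ 'd) \<Rightarrow>\<^sub>L 'h::{real_inner, second_countable_topology}) \<Rightarrow> bool" where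
  "elementary_process M F s t n \<tau> \<xi> \<longleftrightarrow>
    s \<le> \<tau> 0 \<and> (\<forall>i<n. \<tau> i \<le> \<tau> (Suc i)) \<and> \<tau> n \<le> t \<and>
    (\<forall>i<n. (\<forall>x. (\<lambda>\<omega>. \<xi> i \<omega> x) \<in> borel_measurable (F (\<tau> i))) \<and>
      (\<exists>C. \<forall>\<omega>\<in>space M. norm (\<xi> i \<omega>) \<le> C))"

definition step_process ::
    "nat \<Rightarrow> (nat \<Rightarrow> real) \<Rightarrow> (nat \<Rightarrow> 'w \<Rightarrow> (real ^ 'd) \<Rightarrow>\<^sub>L 'h::real_normed_vector) \<Rightarrow>
      real \<Rightarrow> 'w \<Rightarrow> (real ^ 'd) \<Rightarrow>\<^sub>L 'h" where
  "step_process n \<tau> \<xi> r \<omega> = (\<Sum>i<n. indicator {\<tau> i<..\<tau> (Suc i)} r *\<^sub>R \<xi> i \<omega>)"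

definition step_integral ::
    "(real \<Rightarrow> 'w \<Rightarrow> real ^ 'd) \<Rightarrow> nat \<Rightarrow> (nat \<Rightarrow> real) \<Rightarrow>
      (nat \<Rightarrow> 'w \<Rightarrow> (real ^ 'd) \<Rightarrow>\<^sub>L 'h::real_normed_vector) \<Rightarrow> 'w \<Rightarrow> 'h" where
  "step_integral W n \<tau> \<xi> \<omega> = (\<Sum>i<n. \<xi> i \<omega> (W (\<tau> (Suc i)) \<omega> - W (\<tau> i) \<omega>))"

definition hilbert_schmidt_norm :: "(real ^ 'd) \<Rightarrow>\<^sub>L 'h::real_normed_vector \<Rightarrow> real" where
  "hilbert_schmidt_norm A = sqrt (\<Sum>b\<in>Basis. (norm (A b))\<^sup>2)"

definition has_ito_integral ::
    "'w measure \<Rightarrow> (real \<Rightarrow> 'w measure) \<Rightarrow> (real \<Rightarrow> 'w \<Rightarrow> real ^ 'd) \<Rightarrow> real \<Rightarrow> real \<Rightarrow>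
      (real \<Rightarrow> 'w \<Rightarrow> (real ^ 'd) \<Rightarrow>\<^sub>L 'h::{real_inner, second_countable_topology}) \<Rightarrow> ('w \<Rightarrow> 'h) \<Rightarrow> bool" where
  "has_ito_integral M F W s t \<Phi> I \<longleftrightarrow>
    (\<forall>x. (\<lambda>(r, \<omega>). indicator {s..t} r *\<^sub>R \<Phi> r \<omega> x) \<in> borel_measurable (lborel \<Otimes>\<^sub>M M)) \<and>
    I \<in> borel_measurable M \<and> integrable M (\<lambda>\<omega>. (norm (I \<omega>))\<^sup>2) \<and>
    (\<exists>n \<tau> \<xi>. (\<forall>k. elementary_process M F s t (n k) (\<tau> k) (\<xi> k)) \<and>
      (\<lambda>k. \<integral>\<^sup>+\<omega>. (\<integral>\<^sup>+r\<in>{s..t}.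
        ennreal ((hilbert_schmidt_norm (step_process (n k) (\<tau> k) (\<xi> k) r \<omega> - \<Phi> r \<omega>))\<^sup>2) \<partial>lborel) \<partial>M)
        \<longlonglongrightarrow> 0 \<and>
      (\<lambda>k. \<integral>\<^sup>+\<omega>. ennreal ((norm (step_integral W (n k) (\<tau> k) (\<xi> k) \<omega> - I \<omega>))\<^sup>2) \<partial>M)
        \<longlonglongrightarrow> 0)"

text \<open>By the Ito isometry the integral is unique up to almost sure equality;
  a version is chosen.\<close>

definition ito_integral ::
    "'w measure \<Rightarrow> (real \<Rightarrow> 'w measure) \<Rightarrow> (real \<Rightarrow> 'w \<Rightarrow> real ^ 'd) \<Rightarrow> real \<Rightarrow> real \<Rightarrow>
      (real \<Rightarrow> 'w \<Rightarrow> (real ^ 'd) \<Rightarrow>\<^sub>L 'h::{real_inner, second_countable_topology}) \<Rightarrow> 'w \<Rightarrow> 'h" where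
  "ito_integral M F W s t \<Phi> = (SOME I. has_ito_integral M F W s t \<Phi> I)"

section \<open>The equation\<close>

definition fractional_kernel :: "real \<Rightarrow> real \<Rightarrow> real" where
  "fractional_kernel \<alpha> t = 1 / Gamma \<alpha> * t powr (\<alpha> - 1)"

lemma bounded_linear_L2_of_scaleR:
  fixes \<kappa> :: "'b::euclidean_space \<Rightarrow> real"
  assumes [measurable]: "\<kappa> \<in> borel_measurable lborel"
  shows "bounded_linear (\<lambda>x :: 'a::euclidean_space. L2_of (\<lambda>y. \<kappa> y *\<^sub>R x))"
proof (cases "integrable lborel (\<lambda>y. (\<kappa> y)\<^sup>2)")
  case True
  have n: "(norm (\<kappa> y *\<^sub>R x))\<^sup>2 = (norm x)\<^sup>2 * (\<kappa> y)\<^sup>2" for y and x :: 'a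
    by (simp add: power_mult_distrib)
  have i: "sq_integrable (\<lambda>y. \<kappa> y *\<^sub>R x)" for x :: 'a
    using True by (simp add: sq_integrable_def n del: norm_scaleR)
  show ?thesis
  proof (rule bounded_linear_intro[where K="sqrt (LINT y|lborel. (\<kappa> y)\<^sup>2)"])
    fix x z :: 'a and c :: real
    show "L2_of (\<lambda>y. \<kappa> y *\<^sub>R (x + z)) = L2_of (\<lambda>y. \<kappa> y *\<^sub>R x) + L2_of (\<lambda>y. \<kappa> y *\<^sub>R z)"
      by (simp add: L2_of_add i scaleR_add_right)
    show "L2_of (\<lambda>y. \<kappa> y *\<^sub>R (c *\<^sub>R x)) = c *\<^sub>R L2_of (\<lambda>y. \<kappa> y *\<^sub>R x)"
      by (simp add: L2_of_scaleR i mult.commute)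
    show "norm (L2_of (\<lambda>y. \<kappa> y *\<^sub>R x)) \<le> norm x * sqrt (LINT y|lborel. (\<kappa> y)\<^sup>2)"
      by (simp add: norm_L2_of i n real_sqrt_mult del: norm_scaleR)
  qed
next
  case False
  have "L2_of (\<lambda>y. \<kappa> y *\<^sub>R x) = 0" for x :: 'a
  proof (cases "x = 0")
    case False
    have "\<not> sq_integrable (\<lambda>y. \<kappa> y *\<^sub>R x)"
      using \<open>\<not> integrable lborel (\<lambda>y. (\<kappa> y)\<^sup>2)\<close> False
      by (simp add: sq_integrable_def power_mult_distrib)
    then show ?thesis by (simp add: L2_of_def)
  qed simp
  then show ?thesis by (simp add: bounded_linear_zero)
qed

lift_definition sigma_op :: "real \<Rightarrow> real \<Rightarrow> real \<Rightarrow> (real ^ 'd) \<Rightarrow>\<^sub>L 'd Hspace" is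
  "\<lambda>\<alpha> T t x. L2_restrict {0<..<T} (\<lambda>\<xi>. indicator {t<..} \<xi> *\<^sub>R fractional_kernel \<alpha> (\<xi> - t) *\<^sub>R x)"
proof -
  fix \<alpha> T t :: real
  have "bounded_linear (\<lambda>x :: real ^ 'd. L2_of (\<lambda>\<xi>.
    (indicator {0<..<T} \<xi> * indicator {t<..} \<xi> * fractional_kernel \<alpha> (\<xi> - t)) *\<^sub>R x))"
    by (rule bounded_linear_L2_of_scaleR) (simp add: fractional_kernel_def)
  then show "bounded_linear (\<lambda>x :: real ^ 'd. L2_restrict {0<..<T}
    (\<lambda>\<xi>. indicator {t<..} \<xi> *\<^sub>R fractional_kernel \<alpha> (\<xi> - t) *\<^sub>R x))"
    by (simp add: L2_restrict_def mult.assoc)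
qed

text \<open>Random variables are not identified when they agree almost surely. \<open>\<H>\<^sup>q\<close> is
  \<open>Lq_space M M T q\<close> and \<open>\<H>\<^sup>q\<^sub>t\<close> is \<open>Lq_space M (F t) T q\<close>.\<close>

definition Lq_space :: "'w measure \<Rightarrow> 'w measure \<Rightarrow> real \<Rightarrow> real \<Rightarrow> ('w \<Rightarrow> 'd::finite Hspace) set" where
  "Lq_space M N T q = {X. X \<in> borel_measurable N \<and> (\<forall>\<omega>\<in>space M. X \<omega> \<in> L2_on {0<..<T}) \<and>
    integrable M (\<lambda>\<omega>. norm (X \<omega>) powr q)}"

definition is_solution ::
    "'w measure \<Rightarrow> (real \<Rightarrow> 'w measure) \<Rightarrow> real \<Rightarrow> (real \<Rightarrow> 'w \<Rightarrow> real ^ 'd) \<Rightarrow> real \<Rightarrow>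
      ((real \<Rightarrow> real ^ 'd) \<Rightarrow> 'd Hsquare) \<Rightarrow> real \<Rightarrow> real \<Rightarrow> real \<Rightarrow> ('w \<Rightarrow> 'd Hspace) \<Rightarrow>
      ('w \<Rightarrow> 'd Hspace) \<Rightarrow> bool" where
  "is_solution M F T W \<alpha> B q s t \<phi> w \<longleftrightarrow>
    w \<in> Lq_space M M T q \<and>
    (AE \<omega> in M. w \<omega> = \<phi> \<omega> + (LINT r:{s..t}|lborel. L2_slice (drift_ext T B (w \<omega>)) r)
      + ito_integral M F W s t (\<lambda>r _. sigma_op \<alpha> T r) \<omega>)"

end

theory Submission
  imports Defs
begin

text \<open>The equation is solved path by path. With \<open>\<eta> = \<phi> + \<integral>\<sigma> dW\<close> it reads
  \<open>w = \<eta> + J (B w)\<close> in \<open>H\<close>, where \<open>J f\<close> integrates the slices \<open>f(r,\<cdot>)\<close> over \<open>[s,t]\<close>. Causality of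
  the drift survives the extension to \<open>H\<close> and localises the Lipschitz bound to every \<open>(0,\<tau>)\<close>; with
  the Volterra property this makes the map a contraction for the norm weighted by
  \<open>exp (- l \<xi>)\<close> with \<open>l\<close> large, so \<open>w\<close> is a Lipschitz function of \<open>\<eta>\<close>. This gives measurability,
  adaptedness and moments of \<open>w\<close> from those of \<open>\<eta>\<close>.

  For the stochastic integral, the isometry gives uniqueness and additivity, and it shows that
  \<open>\<integral>_u^t \<sigma> dW\<close> vanishes on \<open>(0,u)\<close>; the latter and causality yield the cocycle property.
  Moments of all orders follow from \<open>E cosh \<parallel>S + A Z\<parallel> \<le> E cosh \<parallel>S\<parallel> E cosh \<parallel>A Z\<parallel>\<close> for a symmetric \<open>Z\<close>
  independent of \<open>S\<close>, which bounds the elementary integrals uniformly.\<close>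

subsection \<open>Multiplication operators on \<open>L\<^sup>2\<close>\<close>

text \<open>The Lipschitz hypothesis is an \<open>L2\<close> bound on the square and controls no
  single slice. Causality therefore gives only cumulative estimates: the slices with r < \<tau> are
  bounded in \<open>L2\<close> by v - w on (0, \<tau>), for every \<tau>. Writing exp (- l r) as an
  average of indicators of r < \<tau> turns them into one weighted estimate on all of (0, T), so
  solutions need not be patched from short intervals; l = 4 C^2 makes the constant 1/2.

  \<open>drift_ext\<close> and \<open>ito_integral\<close> are chosen by \<open>SOME\<close>, so
  each needs a witness before anything is known of it. For the stochastic integral the witness rests
  on continuity of \<sigma> in operator norm: k is singular at 0, but k^2 is integrable there
  because \<alpha> > 1/2, and k decreases because \<alpha> < 1. The isometry controls second moments
  only, whereas every q >= 2 is required; as \<sigma> is deterministic, the mean of cosh of the norm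
  can be bounded, and it dominates all powers.

  Random variables are not identified up to null sets. Hence solutions are set to 0 on bad paths,
  and adaptedness of an arbitrary version uses that \<open>F 0\<close> contains the null
  sets.\<close>

lemma measurable_L2_rep [measurable]: "L2_rep f \<in> borel_measurable borel"
  using sq_integrable_measurable[OF sq_integrable_L2_rep[of f]] by simp

lemma nn_norm_L2_sq: "(\<integral>\<^sup>+x. ennreal ((norm (L2_rep f x))\<^sup>2) \<partial>lborel) = ennreal ((norm f)\<^sup>2)"
  using nn_integral_L2_of[OF sq_integrable_L2_rep[of f]] by simp

lemma L2_eqI: "(AE x in lborel. L2_rep f x = L2_rep g x) \<Longrightarrow> f = g"
  using L2_of_eq_iff[OF sq_integrable_L2_rep sq_integrable_L2_rep] by (metis L2_of_rep)

lemma L2_rep_zero: "AE x in lborel. L2_rep 0 x = 0"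
  using L2_rep_of[of "\<lambda>_. 0"] by simp

lemma L2_rep_add: "AE x in lborel. L2_rep (f + g) x = L2_rep f x + L2_rep g x"
  using L2_rep_of[OF sq_integrable_add[OF sq_integrable_L2_rep sq_integrable_L2_rep, of f g]]
  by (simp add: L2_of_add[symmetric] sq_integrable_L2_rep)

lemma L2_rep_diff: "AE x in lborel. L2_rep (f - g) x = L2_rep f x - L2_rep g x"
  using L2_rep_of[OF sq_integrable_diff[OF sq_integrable_L2_rep sq_integrable_L2_rep, of f g]]
  by (simp add: L2_of_diff[symmetric] sq_integrable_L2_rep)

lemma L2_rep_scaleR: "AE x in lborel. L2_rep (c *\<^sub>R f) x = c *\<^sub>R L2_rep f x"
  using L2_rep_of[OF sq_integrable_scaleR[OF sq_integrable_L2_rep, of c f]]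
  by (simp add: L2_of_scaleR[symmetric] sq_integrable_L2_rep)

definition L2_mult :: "('b::euclidean_space \<Rightarrow> real) \<Rightarrow> ('b, 'a::euclidean_space) L2 \<Rightarrow> ('b, 'a) L2" where
  "L2_mult g f = L2_of (\<lambda>x. g x *\<^sub>R L2_rep f x)"

text \<open>Multiplication by \<open>g\<close> is only meaningful for bounded measurable \<open>g\<close>;
  otherwise \<open>L2_mult g f\<close> may be the junk value \<open>0\<close>.\<close>

definition multiplier :: "real \<Rightarrow> ('b::euclidean_space \<Rightarrow> real) \<Rightarrow> bool" where
  "multiplier c g \<longleftrightarrow> g \<in> borel_measurable borel \<and> (\<forall>x. \<bar>g x\<bar> \<le> c)"

lemma multiplier_indicator: "A \<in> sets borel \<Longrightarrow> multiplier 1 (indicator A)"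
  by (auto simp: multiplier_def indicator_def)

lemma multiplier_measurable: "multiplier c g \<Longrightarrow> g \<in> borel_measurable borel"
  by (simp add: multiplier_def)

lemma multiplier_nonneg: "multiplier c g \<Longrightarrow> 0 \<le> c"
  by (metis abs_ge_zero multiplier_def order_trans)

lemma multiplier_times:
  assumes "multiplier c g" "multiplier d h"
  shows "multiplier (c * d) (\<lambda>x. g x * h x)"
  using assms multiplier_nonneg[OF assms(1)]
  by (auto simp: multiplier_def abs_mult intro!: mult_mono borel_measurable_times)

lemma sq_integrable_mult:
  assumes "multiplier c g" "sq_integrable f"
  shows "sq_integrable (\<lambda>x. g x *\<^sub>R f x)"
proof (rule sq_integrable_bound[OF assms(2), where c=c])
  show "(\<lambda>x. g x *\<^sub>R f x) \<in> borel_measurable lborel"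
    using assms by (auto simp: multiplier_def sq_integrable_def intro!: borel_measurable_scaleR)
  show "AE x in lborel. norm (g x *\<^sub>R f x) \<le> c * norm (f x)"
    using assms(1) by (auto simp: multiplier_def intro!: mult_right_mono)
qed

lemma L2_rep_mult:
  "multiplier c g \<Longrightarrow> AE x in lborel. L2_rep (L2_mult g f) x = g x *\<^sub>R L2_rep f x"
  unfolding L2_mult_def by (intro L2_rep_of sq_integrable_mult sq_integrable_L2_rep)

lemma L2_mult_of:
  assumes "multiplier c g" "sq_integrable f"
  shows "L2_mult g (L2_of f) = L2_of (\<lambda>x. g x *\<^sub>R f x)"
  unfolding L2_mult_def
  using L2_rep_of[OF assms(2)]
  by (subst L2_of_eq_iff) (auto intro: sq_integrable_mult[OF assms(1)] assms(2) sq_integrable_L2_rep)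

lemma norm_L2_mult:
  "multiplier c g \<Longrightarrow>
    ennreal ((norm (L2_mult g f))\<^sup>2) = (\<integral>\<^sup>+x. ennreal ((g x)\<^sup>2 * (norm (L2_rep f x))\<^sup>2) \<partial>lborel)"
  unfolding L2_mult_def
  by (subst nn_integral_L2_of[symmetric])
     (auto intro: sq_integrable_mult sq_integrable_L2_rep simp: power_mult_distrib)

text \<open>Asking for the comparison only where \<open>f\<close> does not vanish lets a weight that
  is 0 outside (0, T) be compared with the constant 1 on elements of \<open>H\<close>.\<close>

lemma norm_L2_mult_le:
  assumes "multiplier c g" "multiplier d h" "AE x in lborel. \<bar>g x\<bar> \<le> b * \<bar>h x\<bar> \<or> L2_rep f x = 0"
    and "0 \<le> b"
  shows "norm (L2_mult g f) \<le> b * norm (L2_mult h f)"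
proof -
  note [measurable] = multiplier_measurable[OF assms(1)] multiplier_measurable[OF assms(2)]
  have "ennreal ((norm (L2_mult g f))\<^sup>2) \<le> (\<integral>\<^sup>+x. ennreal (b\<^sup>2) * ennreal ((h x)\<^sup>2 * (norm (L2_rep f x))\<^sup>2) \<partial>lborel)"
    unfolding norm_L2_mult[OF assms(1)]
  proof (rule nn_integral_mono_AE)
    show "AE x in lborel. ennreal ((g x)\<^sup>2 * (norm (L2_rep f x))\<^sup>2)
        \<le> ennreal (b\<^sup>2) * ennreal ((h x)\<^sup>2 * (norm (L2_rep f x))\<^sup>2)"
      using assms(3)
    proof eventually_elim
      case (elim x)
      then show ?case
      proof
        assume "\<bar>g x\<bar> \<le> b * \<bar>h x\<bar>"
        from power_mono[OF this, of 2] have "(g x)\<^sup>2 \<le> b\<^sup>2 * (h x)\<^sup>2"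
          by (simp add: power_mult_distrib)
        then have "(g x)\<^sup>2 * (norm (L2_rep f x))\<^sup>2 \<le> b\<^sup>2 * (h x)\<^sup>2 * (norm (L2_rep f x))\<^sup>2"
          by (rule mult_right_mono) simp
        then show ?thesis by (simp add: ennreal_mult[symmetric] mult.assoc ennreal_leI)
      qed simp
    qed
  qed
  also have "\<dots> = ennreal (b\<^sup>2) * ennreal ((norm (L2_mult h f))\<^sup>2)"
    unfolding norm_L2_mult[OF assms(2)] by (rule nn_integral_cmult) measurable
  also have "\<dots> = ennreal ((b * norm (L2_mult h f))\<^sup>2)"
    by (simp add: power_mult_distrib ennreal_mult)
  finally have "(norm (L2_mult g f))\<^sup>2 \<le> (b * norm (L2_mult h f))\<^sup>2" by simp
  then show ?thesis by (rule power2_le_imp_le) (simp add: assms(4))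
qed

lemma L2_mult_one [simp]: "L2_mult (\<lambda>x. 1) f = f"
  by (simp add: L2_mult_def)

lemma multiplier_one: "multiplier 1 (\<lambda>x. 1)"
  by (simp add: multiplier_def)

lemma norm_L2_mult_bound: "multiplier c g \<Longrightarrow> norm (L2_mult g f) \<le> c * norm f"
  using norm_L2_mult_le[OF _ multiplier_one, of c g c f] multiplier_nonneg[of c g]
  by (auto simp: multiplier_def)

lemma bounded_linear_L2_mult:
  fixes g :: "'b::euclidean_space \<Rightarrow> real"
  assumes "multiplier c g"
  shows "bounded_linear (L2_mult g :: ('b, 'a::euclidean_space) L2 \<Rightarrow> _)"
proof (rule bounded_linear_intro)
  fix f h :: "('b, 'a) L2" and k :: real
  show "L2_mult g (f + h) = L2_mult g f + L2_mult g h"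
  proof (rule L2_eqI)
    show "AE x in lborel. L2_rep (L2_mult g (f + h)) x = L2_rep (L2_mult g f + L2_mult g h) x"
      using L2_rep_mult[OF assms, of "f + h"] L2_rep_mult[OF assms, of f] L2_rep_mult[OF assms, of h]
        L2_rep_add[of f h] L2_rep_add[of "L2_mult g f" "L2_mult g h"]
      by eventually_elim (simp add: scaleR_add_right)
  qed
  show "L2_mult g (k *\<^sub>R f) = k *\<^sub>R L2_mult g f"
  proof (rule L2_eqI)
    show "AE x in lborel. L2_rep (L2_mult g (k *\<^sub>R f)) x = L2_rep (k *\<^sub>R L2_mult g f) x"
      using L2_rep_mult[OF assms, of "k *\<^sub>R f"] L2_rep_mult[OF assms, of f]
        L2_rep_scaleR[of k f] L2_rep_scaleR[of k "L2_mult g f"]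
      by eventually_elim simp
  qed
  show "norm (L2_mult g f) \<le> norm f * c"
    using norm_L2_mult_bound[OF assms, of f] by (simp add: mult.commute)
qed

lemmas L2_mult_diff = linear_diff[OF bounded_linear.linear[OF bounded_linear_L2_mult]]
lemmas L2_mult_add = linear_add[OF bounded_linear.linear[OF bounded_linear_L2_mult]]

lemma L2_mult_mult:
  assumes "multiplier c g" "multiplier d h"
  shows "L2_mult g (L2_mult h f) = L2_mult (\<lambda>x. g x * h x) f"
proof (rule L2_eqI)
  show "AE x in lborel. L2_rep (L2_mult g (L2_mult h f)) x = L2_rep (L2_mult (\<lambda>x. g x * h x) f) x"
    using L2_rep_mult[OF assms(1), of "L2_mult h f"] L2_rep_mult[OF assms(2), of f]
      L2_rep_mult[OF multiplier_times[OF assms], of f]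
    by eventually_elim simp
qed

lemma L2_mult_cong:
  assumes "multiplier c g" "multiplier d h" "AE x in lborel. g x = h x \<or> L2_rep f x = 0"
  shows "L2_mult g f = L2_mult h f"
proof (rule L2_eqI)
  show "AE x in lborel. L2_rep (L2_mult g f) x = L2_rep (L2_mult h f) x"
    using L2_rep_mult[OF assms(1), of f] L2_rep_mult[OF assms(2), of f] assms(3)
    by eventually_elim auto
qed

abbreviation L2_cut :: "'b set \<Rightarrow> ('b::euclidean_space, 'a::euclidean_space) L2 \<Rightarrow> ('b, 'a) L2" where
  "L2_cut A \<equiv> L2_mult (indicator A)"

lemma L2_cut_eq_0_iff:
  assumes "A \<in> sets borel"
  shows "L2_cut A f = 0 \<longleftrightarrow> (AE x in lborel. x \<in> A \<longrightarrow> L2_rep f x = 0)"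
proof
  assume *: "L2_cut A f = 0"
  have "AE x in lborel. L2_rep (L2_cut A f) x = 0"
    unfolding * by (rule L2_rep_zero)
  then show "AE x in lborel. x \<in> A \<longrightarrow> L2_rep f x = 0"
    using L2_rep_mult[OF multiplier_indicator[OF assms], of f]
    by eventually_elim auto
next
  assume *: "AE x in lborel. x \<in> A \<longrightarrow> L2_rep f x = 0"
  show "L2_cut A f = 0"
  proof (rule L2_eqI)
    show "AE x in lborel. L2_rep (L2_cut A f) x = L2_rep 0 x"
      using L2_rep_mult[OF multiplier_indicator[OF assms], of f] L2_rep_zero *
      by eventually_elim (auto simp: indicator_def)
  qed
qed

text \<open>Presents \<open>L2_on A\<close> as the kernel of a bounded linear operator, from which
  closedness and the subspace property are read off.\<close>

lemma L2_on_iff: "A \<in> sets borel \<Longrightarrow> f \<in> L2_on A \<longleftrightarrow> L2_cut (- A) f = 0"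
  by (subst L2_cut_eq_0_iff) (auto simp: L2_on_def)

lemma closed_L2_on: "A \<in> sets borel \<Longrightarrow> closed (L2_on A :: ('b::euclidean_space, 'a::euclidean_space) L2 set)"
proof -
  assume A: "A \<in> sets borel"
  have "L2_on A = L2_cut (- A) -` {0 :: ('b, 'a) L2}" using A by (auto simp: L2_on_iff)
  moreover have "isCont (L2_cut (- A)) f" for f :: "('b, 'a) L2"
    by (intro linear_continuous_at bounded_linear_L2_mult[OF multiplier_indicator] borel_comp A)
  ultimately show ?thesis
    by (metis closed_singleton continuous_closed_vimage)
qed

lemma subspace_L2_on: "A \<in> sets borel \<Longrightarrow> subspace (L2_on A)"
proof -
  assume A: "A \<in> sets borel"
  have "linear (L2_cut (- A) :: ('a, 'b) L2 \<Rightarrow> _)"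
    using A by (intro bounded_linear.linear bounded_linear_L2_mult[OF multiplier_indicator]) auto
  from linear_subspace_vimage[OF this subspace_single_0]
  moreover have "L2_on A = L2_cut (- A) -` {0 :: ('a, 'b) L2}" using A by (auto simp: L2_on_iff)
  ultimately show ?thesis by simp
qed

lemma L2_cut_in_L2_on: "A \<in> sets borel \<Longrightarrow> L2_cut A f \<in> L2_on A"
  using L2_rep_mult[OF multiplier_indicator, of A f] by (auto simp: L2_on_def)

lemma L2_cut_id:
  assumes "A \<in> sets borel" "f \<in> L2_on A"
  shows "L2_cut A f = f"
proof -
  have "AE x in lborel. indicator A x = (1::real) \<or> L2_rep f x = 0"
    using assms(2) unfolding L2_on_def mem_Collect_eq by eventually_elim auto
  then show ?thesis
    using L2_mult_cong[OF multiplier_indicator multiplier_one, of A f] assms(1) by simp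
qed

lemma L2_cut_L2_cut:
  "A \<in> sets borel \<Longrightarrow> C \<in> sets borel \<Longrightarrow> L2_cut A (L2_cut C f) = L2_cut (A \<inter> C) f"
  by (subst L2_mult_mult[OF multiplier_indicator multiplier_indicator])
     (auto simp: indicator_inter_arith[abs_def])

text \<open>Cuts commute, so the cut by \<open>A\<close> maps the range of the cut by
  \<open>C\<close> into itself.\<close>

lemma L2_cut_in:
  assumes "A \<in> sets borel" "C \<in> sets borel" "f \<in> L2_on C"
  shows "L2_cut A f \<in> L2_on C"
proof -
  have "L2_cut A f = L2_cut C (L2_cut A f)"
    using L2_cut_L2_cut[OF assms(1,2), of f] L2_cut_L2_cut[OF assms(2,1), of f] L2_cut_id[OF assms(2,3)]
    by (simp add: Int_commute)
  then show ?thesis using L2_cut_in_L2_on[OF assms(2)] by metis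
qed

subsection \<open>Continuous paths are dense\<close>

lemma sq_integrable_path:
  assumes "w \<in> paths T"
  shows "sq_integrable (\<lambda>x. indicator {0<..<T} x *\<^sub>R w x)"
proof -
  have "bounded (w ` {0..T})"
    using compact_imp_bounded[OF compact_continuous_image[of "{0..T}" w]] assms
    by (simp add: paths_def)
  then obtain K where K: "\<And>x. x \<in> {0..T} \<Longrightarrow> norm (w x) \<le> K"
    unfolding bounded_iff by blast
  have "(\<lambda>x. indicator {0<..<T} x *\<^sub>R w x) \<in> borel_measurable borel"
    using assms by (intro borel_measurable_continuous_on_indicator)
      (auto simp: paths_def intro: continuous_on_subset)
  moreover have "emeasure lborel {0<..<T} < \<infinity>" by (cases "0 \<le> T") auto
  then have sq: "sq_integrable (\<lambda>x. indicator {0<..<T} x *\<^sub>R (1::real))"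
    by (intro sq_integrable_indicator) auto
  ultimately show ?thesis
    using K by (intro sq_integrable_bound[OF sq, where c=K]) (auto simp: indicator_def)
qed

lemma path_class_in: "path_class T w \<in> L2_on {0<..<T}" if "w \<in> paths T"
  using L2_rep_of[OF sq_integrable_path[OF that]] unfolding L2_restrict_def L2_on_def mem_Collect_eq
  by eventually_elim auto

text \<open>Density is proved through \<open>L2_closed_contains_all\<close>, which asks for a closed
  subspace; this supplies linearity before the closure is taken.\<close>

lemma subspace_path_class: "subspace (path_class T ` paths T :: 'd::finite Hspace set)"
proof (unfold subspace_def, intro conjI ballI allI)
  have "0 = path_class T (\<lambda>_. 0 :: real ^ 'd)" "(\<lambda>_. 0 :: real ^ 'd) \<in> paths T"
    by (auto simp: L2_restrict_def paths_def)
  then show "(0 :: 'd Hspace) \<in> path_class T ` paths T" by blast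
next
  fix x y :: "'d Hspace" assume "x \<in> path_class T ` paths T" "y \<in> path_class T ` paths T"
  then obtain v w where vw: "v \<in> paths T" "w \<in> paths T" "x = path_class T v" "y = path_class T w" by auto
  have "path_class T v + path_class T w = path_class T (\<lambda>t. v t + w t)"
    unfolding L2_restrict_def
    by (subst L2_of_add) (auto intro: sq_integrable_path vw simp: scaleR_add_right)
  moreover have "(\<lambda>t. v t + w t) \<in> paths T"
    using vw by (auto simp: paths_def intro: continuous_intros)
  ultimately show "x + y \<in> path_class T ` paths T" using vw by auto
next
  fix c and x :: "'d Hspace" assume "x \<in> path_class T ` paths T"
  then obtain v where v: "v \<in> paths T" "x = path_class T v" by auto
  have "c *\<^sub>R path_class T v = path_class T (\<lambda>t. c *\<^sub>R v t)"
    unfolding L2_restrict_def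
    by (subst L2_of_scaleR) (auto intro: sq_integrable_path v simp: mult.commute)
  moreover have "(\<lambda>t. c *\<^sub>R v t) \<in> paths T"
    using v by (auto simp: paths_def intro: continuous_intros)
  ultimately show "c *\<^sub>R x \<in> path_class T ` paths T" using v by auto
qed

lemma subspace_closure:
  fixes S :: "'a::real_normed_vector set"
  assumes "subspace S"
  shows "subspace (closure S)"
  unfolding subspace_def
proof (intro conjI ballI allI)
  show "0 \<in> closure S" using subspace_0[OF assms] closure_subset by blast
  fix x y assume "x \<in> closure S" "y \<in> closure S"
  then show "x + y \<in> closure S"
    unfolding closure_sequential
  proof (elim exE conjE)
    fix u v assume "\<forall>n. u n \<in> S" "u \<longlonglongrightarrow> x" "\<forall>n. v n \<in> S" "v \<longlonglongrightarrow> y"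
    then show "\<exists>u. (\<forall>n. u n \<in> S) \<and> u \<longlonglongrightarrow> x + y"
      by (intro exI[of _ "\<lambda>n. u n + v n"]) (auto intro: tendsto_add subspace_add[OF assms])
  qed
next
  fix c x assume "x \<in> closure S"
  then show "c *\<^sub>R x \<in> closure S"
    unfolding closure_sequential
  proof (elim exE conjE)
    fix u assume "\<forall>n. u n \<in> S" "u \<longlonglongrightarrow> x"
    then show "\<exists>u. (\<forall>n. u n \<in> S) \<and> u \<longlonglongrightarrow> c *\<^sub>R x"
      by (intro exI[of _ "\<lambda>n. c *\<^sub>R u n"]) (auto intro: tendsto_intros subspace_scale[OF assms])
  qed
qed

text \<open>The bumps are continuous and increase to the indicator of the open set. The whole space
  is excluded because \<open>infdist\<close> to the empty set is 0 by convention.\<close>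

lemma bump_tendsto_indicator:
  fixes V :: "'a::metric_space set"
  assumes "open V" "V \<noteq> UNIV"
  shows "(\<lambda>n. min 1 (real n * infdist x (- V))) \<longlonglongrightarrow> indicator V x"
proof (cases "x \<in> V")
  case True
  have "infdist x (- V) > 0"
    using assms True by (intro infdist_pos_not_in_closed) auto
  then obtain N where N: "1 < real N * infdist x (- V)" using reals_Archimedean3 by metis
  have "\<forall>\<^sub>F n in sequentially. indicator V x = min 1 (real n * infdist x (- V))"
    using eventually_ge_at_top[of N]
  proof eventually_elim
    case (elim n)
    then have "real N * infdist x (- V) \<le> real n * infdist x (- V)"
      by (intro mult_right_mono) (auto simp: infdist_nonneg)
    then show ?case using N True by simp
  qed
  then show ?thesis by (rule Lim_transform_eventually[OF tendsto_const])
next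
  case False
  then show ?thesis by simp
qed

text \<open>The bumps for the part of \<open>U\<close> inside (0, T) vanish outside (0, T). They are
  therefore continuous paths that agree with their own extension by 0, and they converge in
  \<open>L2\<close> under the bound by the indicator.\<close>

lemma indicator_in_closure_paths:
  assumes "open U" "bounded U"
  shows "L2_cut {0<..<T} (L2_of (\<lambda>x. indicator U x *\<^sub>R b)) \<in> closure (path_class T ` paths T)"
proof -
  define V where "V = {0<..<T} \<inter> U"
  have V: "open V" "bounded V" using assms by (auto simp: V_def)
  then have VU: "V \<noteq> UNIV" using not_bounded_UNIV by metis
  have fin: "emeasure lborel V < \<infinity>" "emeasure lborel U < \<infinity>"
    using emeasure_bounded_finite[OF V(2)] emeasure_bounded_finite[OF assms(2)] by auto
  define f where "f n x = min 1 (real n * infdist x (- V)) *\<^sub>R b" for n x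
  have fc: "continuous_on A (f n)" for n A
    unfolding f_def by (intro continuous_intros)
  then have fp: "f n \<in> paths T" for n by (simp add: paths_def)
  have eq: "indicator {0<..<T} x *\<^sub>R f n x = f n x" for x n
  proof -
    have "infdist x (- V) = 0" if "x \<notin> {0<..<T}"
      using that by (intro infdist_zero) (auto simp: V_def)
    then show ?thesis by (cases "x \<in> {0<..<T}") (simp_all add: f_def)
  qed
  have "(\<lambda>n. L2_of (f n)) \<longlonglongrightarrow> L2_of (\<lambda>x. indicator V x *\<^sub>R b)"
  proof (rule tendsto_L2_of_dominated[where c=1])
    show "f n \<in> borel_measurable lborel" for n
      using borel_measurable_continuous_onI[OF fc] by simp
    show "sq_integrable (\<lambda>x. indicator V x *\<^sub>R b)"
      using V fin by (intro sq_integrable_indicator) auto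
    show "AE x in lborel. (\<lambda>n. f n x) \<longlonglongrightarrow> indicator V x *\<^sub>R b"
      unfolding f_def by (intro AE_I2 tendsto_scaleR bump_tendsto_indicator V VU tendsto_const)
    show "AE x in lborel. norm (f n x) \<le> 1 * norm (indicator V x *\<^sub>R b)" for n
      by (auto simp: f_def indicator_def infdist_nonneg intro!: mult_left_le_one_le)
  qed
  moreover have "L2_of (f n) \<in> path_class T ` paths T" for n
    using fp by (auto simp: L2_restrict_def eq intro!: image_eqI[of _ _ "f n"])
  ultimately have "L2_of (\<lambda>x. indicator V x *\<^sub>R b) \<in> closure (path_class T ` paths T)"
    unfolding closure_sequential by (intro exI[of _ "\<lambda>n. L2_of (f n)"]) auto
  moreover have "L2_cut {0<..<T} (L2_of (\<lambda>x. indicator U x *\<^sub>R b)) = L2_of (\<lambda>x. indicator V x *\<^sub>R b)"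
    using assms fin by (subst L2_mult_of[OF multiplier_indicator])
      (auto intro: sq_integrable_indicator simp: V_def indicator_inter_arith)
  ultimately show ?thesis by simp
qed

lemma closure_path_class: "closure (path_class T ` paths T) = (L2_on {0<..<T} :: 'd::finite Hspace set)"
proof
  show "closure (path_class T ` paths T) \<subseteq> (L2_on {0<..<T} :: 'd Hspace set)"
    by (rule closure_minimal) (auto intro: path_class_in closed_L2_on)
  \<comment> \<open>\<open>L2_closed_contains_all\<close> speaks of the whole \<open>L2\<close>
    space over the real line, so the closure is pulled back along the cut to (0, T).\<close>
  define S :: "'d Hspace set" where "S = {f. L2_cut {0<..<T} f \<in> closure (path_class T ` paths T)}"
  have bl: "bounded_linear (L2_cut {0<..<T} :: 'd Hspace \<Rightarrow> _)"
    by (rule bounded_linear_L2_mult[OF multiplier_indicator]) simp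
  have "closed (L2_cut {0<..<T} -` closure (path_class T ` paths T :: 'd Hspace set))"
    by (rule continuous_closed_vimage) (auto intro: linear_continuous_at bl)
  then have S: "closed S" by (simp add: S_def vimage_def)
  have S': "subspace S"
    unfolding S_def using linear_subspace_vimage[OF bounded_linear.linear[OF bl]
      subspace_closure[OF subspace_path_class[of T]]] by (simp add: vimage_def)
  have "f \<in> S" for f
  proof (rule L2_closed_contains_all[OF S S', where E="Collect open"])
    show "Int_stable (Collect open)" by (auto simp: Int_stable_def)
    show "sets borel = sigma_sets UNIV (Collect open)" by (simp add: borel_def)
  qed (auto simp: S_def intro!: indicator_in_closure_paths)
  then show "L2_on {0<..<T} \<subseteq> closure (path_class T ` paths T :: 'd Hspace set)"
    by (auto simp: S_def) (metis L2_cut_id borel_open open_greaterThanLessThan)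
qed

subsection \<open>Slices\<close>

lemma AE_lborel_pair:
  fixes P :: "'a::euclidean_space \<times> 'b::euclidean_space \<Rightarrow> bool"
  assumes "AE z in lborel. P z"
  shows "AE r in lborel. AE \<xi> in lborel. P (r, \<xi>)"
  using lborel_pair.AE_pair[of P, unfolded lborel_prod, OF assms] .

text \<open>Null sections force a set to be null only if the set is measurable, whence the Borel
  predicate for the direction from sections to the product.\<close>

lemma AE_lborel_pair_iff:
  fixes P :: "'a::euclidean_space \<times> 'b::euclidean_space \<Rightarrow> bool"
  assumes "Measurable.pred borel P"
  shows "(AE z in lborel. P z) \<longleftrightarrow> (AE r in lborel. AE \<xi> in lborel. P (r, \<xi>))"
proof
  assume "AE r in lborel. AE \<xi> in lborel. P (r, \<xi>)"
  moreover have "{z \<in> space (lborel \<Otimes>\<^sub>M lborel). P z} \<in> sets (lborel \<Otimes>\<^sub>M lborel)"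
    unfolding lborel_prod using assms by (simp add: pred_def)
  ultimately have "AE z in lborel \<Otimes>\<^sub>M lborel. P z"
    using lborel_pair.AE_pair_measure[of P] by simp
  then show "AE z in lborel. P z" by (simp only: lborel_prod)
qed (rule AE_lborel_pair)

lemma measurable_L2_rep_slice [measurable]: "(\<lambda>x. L2_rep f (r, x)) \<in> borel_measurable borel"
  by (rule measurable_compose[OF _ measurable_L2_rep]) (simp add: borel_prod[symmetric])

lemma measurable_L2_rep_prod [measurable]:
  "L2_rep f \<in> borel_measurable (borel \<Otimes>\<^sub>M borel)"
  using measurable_L2_rep[of f] by (simp add: borel_prod)

lemma AE_sq_integrable_slice:
  "AE r in lborel. sq_integrable (\<lambda>x. L2_rep f (r, x))"
proof -
  have "integrable (lborel \<Otimes>\<^sub>M lborel) (\<lambda>z. (norm (L2_rep f z))\<^sup>2)"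
    using sq_integrable_L2_rep[of f] by (simp add: lborel_prod sq_integrable_def)
  from lborel_pair.AE_integrable_fst'[OF this]
  show ?thesis by eventually_elim (simp add: sq_integrable_def)
qed

lemma L2_rep_slice: "AE r in lborel. AE x in lborel. L2_rep (L2_slice f r) x = L2_rep f (r, x)"
  using AE_sq_integrable_slice[of f]
  by eventually_elim (unfold L2_slice_def, rule L2_rep_of)

lemma L2_slice_diff: "AE r in lborel. L2_slice (f - g) r = L2_slice f r - L2_slice g r"
  using AE_sq_integrable_slice[of f] AE_sq_integrable_slice[of g]
    AE_sq_integrable_slice[of "f - g"] AE_lborel_pair[OF L2_rep_diff[of f g]]
proof eventually_elim
  case (elim r)
  then show ?case unfolding L2_slice_def
    by (simp add: L2_of_diff L2_of_eq_iff sq_integrable_diff)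
qed

lemma L2_slice_cong: "(AE z in lborel. fst z \<in> A \<longrightarrow> L2_rep f z = L2_rep g z) \<Longrightarrow>
    AE r in lborel. r \<in> A \<longrightarrow> L2_slice f r = L2_slice g r"
proof -
  assume "AE z in lborel. fst z \<in> A \<longrightarrow> L2_rep f z = L2_rep g z"
  from AE_lborel_pair[OF this]
  show "AE r in lborel. r \<in> A \<longrightarrow> L2_slice f r = L2_slice g r"
    using AE_sq_integrable_slice[of f] AE_sq_integrable_slice[of g]
    by eventually_elim (auto simp: L2_slice_def L2_of_eq_iff)
qed

text \<open>Causality is assumed for slices as elements of \<open>L2\<close>, while cuts act on
  representatives over the square; this passes from the former to the latter.\<close>

lemma L2_rep_eq_of_slice_eq:
  assumes A: "A \<in> sets borel" and eq: "AE r in lborel. r \<in> A \<longrightarrow> L2_slice f r = L2_slice g r"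
  shows "AE z in lborel. fst z \<in> A \<longrightarrow> L2_rep f z = L2_rep g z"
proof -
  have "AE r in lborel. AE \<xi> in lborel. fst (r, \<xi>) \<in> A \<longrightarrow> L2_rep f (r, \<xi>) = L2_rep g (r, \<xi>)"
    using eq AE_sq_integrable_slice[of f] AE_sq_integrable_slice[of g]
    by eventually_elim (auto simp: L2_slice_def L2_of_eq_iff)
  moreover have "Measurable.pred borel (\<lambda>z. fst z \<in> A \<longrightarrow> L2_rep f z = L2_rep g z)"
  proof -
    have [measurable]: "fst \<in> borel_measurable (borel :: ('a \<times> 'b) measure)"
      by (intro borel_measurable_continuous_onI continuous_on_fst continuous_on_id)
    show ?thesis using A by measurable
  qed
  ultimately show ?thesis by (subst AE_lborel_pair_iff) auto
qed

lemma nn_integral_norm_slice: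
  fixes f :: "('b::euclidean_space \<times> 'c::euclidean_space, 'a::euclidean_space) L2"
  shows "(\<integral>\<^sup>+r. ennreal ((norm (L2_slice f r))\<^sup>2) \<partial>lborel) = ennreal ((norm f)\<^sup>2)"
proof -
  have m: "(\<lambda>z. ennreal ((norm (L2_rep f z))\<^sup>2)) \<in> borel_measurable (lborel \<Otimes>\<^sub>M lborel)"
    by (simp add: lborel_prod)
  have "(\<integral>\<^sup>+r. ennreal ((norm (L2_slice f r))\<^sup>2) \<partial>lborel)
      = (\<integral>\<^sup>+r. \<integral>\<^sup>+x. ennreal ((norm (L2_rep f (r, x)))\<^sup>2) \<partial>lborel \<partial>lborel)"
    by (rule nn_integral_cong_AE, use AE_sq_integrable_slice[of f] in eventually_elim)
       (simp add: L2_slice_def nn_integral_L2_of)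
  also have "\<dots> = (\<integral>\<^sup>+z. ennreal ((norm (L2_rep f z))\<^sup>2) \<partial>(lborel \<Otimes>\<^sub>M lborel))"
    by (rule lborel.nn_integral_fst[OF m])
  also have "\<dots> = ennreal ((norm f)\<^sup>2)" by (simp only: lborel_prod nn_norm_L2_sq)
  finally show ?thesis .
qed

text \<open>By separability every open set is a countable union of balls centred in a fixed dense
  set, and the preimage of a ball is a sublevel set of a distance. Measurability of maps into
  \<open>L2\<close> is thus reduced to real functions.\<close>

lemma borel_measurable_by_dist:
  fixes f :: "'w \<Rightarrow> 'a::{metric_space, second_countable_topology}"
  assumes "\<And>y. (\<lambda>x. dist (f x) y) \<in> borel_measurable M"
  shows "f \<in> borel_measurable M"
proof -
  obtain D :: "'a set" where D: "countable D" "\<And>X. open X \<Longrightarrow> X \<noteq> {} \<Longrightarrow> \<exists>d\<in>D. d \<in> X"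
    using countable_dense_setE by blast
  show ?thesis
  proof (rule borel_measurableI)
    fix S :: "'a set" assume S: "open S"
    define \<rho> where "\<rho> n = 1 / real (Suc n)" for n
    define J where "J = {(d, n) \<in> D \<times> (UNIV :: nat set). ball d (\<rho> n) \<subseteq> S}"
    have "S \<subseteq> (\<Union>j\<in>J. ball (fst j) (\<rho> (snd j)))"
    proof
      fix x assume "x \<in> S"
      then obtain e where e: "e > 0" "ball x e \<subseteq> S" using S open_contains_ball by blast
      obtain n where n: "\<rho> n < e / 2" using nat_approx_posE[of "e / 2"] e(1) by (auto simp: \<rho>_def)
      obtain d where d: "d \<in> D" "d \<in> ball x (\<rho> n)"
        using D(2)[of "ball x (\<rho> n)"] by (auto simp: \<rho>_def)
      have "ball d (\<rho> n) \<subseteq> S"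
      proof
        fix y assume "y \<in> ball d (\<rho> n)"
        then have "dist x y < e" using d(2) n dist_triangle[of x y d] by simp
        then show "y \<in> S" using e(2) by auto
      qed
      then show "x \<in> (\<Union>j\<in>J. ball (fst j) (\<rho> (snd j)))"
        using d by (intro UN_I[of "(d, n)"]) (auto simp: J_def dist_commute)
    qed
    then have S_eq: "S = (\<Union>j\<in>J. ball (fst j) (\<rho> (snd j)))" by (auto simp: J_def)
    have "f -` S \<inter> space M = (\<Union>j\<in>J. {x \<in> space M. dist (f x) (fst j) < \<rho> (snd j)})"
      by (subst S_eq, simp add: vimage_def dist_commute, blast)
    also have "\<dots> \<in> sets M"
    proof (rule sets.countable_UN'')
      show "countable J" using D(1) by (intro countable_subset[of J "D \<times> UNIV"]) (auto simp: J_def)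
      fix j assume "j \<in> J"
      have "{x \<in> space M. dist (f x) d < c} \<in> sets M" for d c
        using assms[of d] by measurable
      then show "{x \<in> space M. dist (f x) (fst j) < \<rho> (snd j)} \<in> sets M" .
    qed
    finally show "f -` S \<inter> space M \<in> sets M" .
  qed
qed

text \<open>The distance from the slice to a fixed \<open>h\<close> is the root of an integral over
  the second variable, measurable in \<open>r\<close> by Tonelli.\<close>

lemma measurable_L2_slice [measurable]:
  fixes f :: "('b::euclidean_space \<times> 'c::euclidean_space, 'a::euclidean_space) L2"
  shows "L2_slice f \<in> borel_measurable borel"
proof (rule borel_measurable_by_dist)
  fix h :: "('c, 'a) L2"
  define N where "N r = (\<integral>\<^sup>+x. ennreal ((norm (L2_rep f (r, x)))\<^sup>2) \<partial>lborel)" for r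
  define D where "D r = (\<integral>\<^sup>+x. ennreal ((norm (L2_rep f (r, x) - L2_rep h x))\<^sup>2) \<partial>lborel)" for r
  have [measurable]: "N \<in> borel_measurable borel" "D \<in> borel_measurable borel"
    unfolding N_def D_def by measurable
  have good: "sq_integrable (\<lambda>x. L2_rep f (r, x)) \<longleftrightarrow> N r < \<infinity>" for r
    by (auto simp: sq_integrable_def N_def integrable_iff_bounded)
  \<comment> \<open>A section that is not square-integrable is sent to 0 by \<open>L2_of\<close>,
    which produces the value \<open>norm h\<close> in the second case.\<close>
  have "dist (L2_slice f r) h = (if N r < \<infinity> then sqrt (enn2real (D r)) else norm h)" for r
  proof (cases "N r < \<infinity>")
    case True
    then have s: "sq_integrable (\<lambda>x. L2_rep f (r, x))" by (simp add: good)
    have "L2_slice f r - h = L2_of (\<lambda>x. L2_rep f (r, x) - L2_rep h x)"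
      unfolding L2_slice_def using L2_of_diff[OF s sq_integrable_L2_rep[of h]] by simp
    then have "D r = ennreal ((dist (L2_slice f r) h)\<^sup>2)"
      unfolding D_def dist_norm
      using nn_integral_L2_of[OF sq_integrable_diff[OF s sq_integrable_L2_rep[of h]]] by simp
    then show ?thesis using True by simp
  next
    case False
    then show ?thesis using good[of r] by (simp add: L2_slice_def L2_of_def dist_norm)
  qed
  then show "(\<lambda>r. dist (L2_slice f r) h) \<in> borel_measurable borel" by simp
qed

subsection \<open>The extended drift\<close>

text \<open>Names the Lipschitz constant hidden in \<open>volterra_lipschitz\<close>, on which the
  weight and all later constants depend. The Volterra condition is taken at t = T, which contains it
  for every smaller t.\<close>

locale volterra_drift =
  fixes T C :: real and B :: "(real \<Rightarrow> real ^ 'd) \<Rightarrow> 'd Hsquare"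
  assumes T_pos: "0 < T" and C_pos: "0 < C"
    and B_in: "w \<in> paths T \<Longrightarrow> B w \<in> L2_on ({0<..<T} \<times> {0<..<T})"
    and B_lipschitz: "w1 \<in> paths T \<Longrightarrow> w2 \<in> paths T \<Longrightarrow>
      norm (B w1 - B w2) \<le> C * norm (path_class T w1 - path_class T w2)"
    and B_volterra: "w \<in> paths T \<Longrightarrow> AE r in lborel. r \<in> {0<..<T} \<longrightarrow>
      (AE \<xi> in lborel. \<xi> \<in> {0<..<r} \<longrightarrow> L2_rep (L2_slice (B w) r) \<xi> = 0)"
    and B_causal: "w1 \<in> paths T \<Longrightarrow> w2 \<in> paths T \<Longrightarrow> 0 < t \<Longrightarrow> t \<le> T \<Longrightarrow>
      (\<And>\<xi>. \<xi> \<in> {0<..<t} \<Longrightarrow> w1 \<xi> = w2 \<xi>) \<Longrightarrow>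
      AE r in lborel. r \<in> {0<..<t} \<longrightarrow> L2_slice (B w1) r = L2_slice (B w2) r"
begin

abbreviation "H \<equiv> (L2_on {0<..<T} :: 'd Hspace set)"
abbreviation "Q \<equiv> (L2_on ({0<..<T} \<times> {0<..<T}) :: 'd Hsquare set)"
abbreviation "G \<equiv> drift_ext T B"

lemma square_borel: "{0<..<T} \<times> {0<..<T} \<in> sets borel"
  by (intro borel_open open_Times) auto

text \<open>Paths with the same class have the same image by the Lipschitz bound, so
  \<open>B\<close> descends to classes. A Lipschitz map on a dense subset of \<open>H\<close>
  extends to \<open>H\<close>, and closedness of the target space keeps the values in it. Without
  this witness the choice in \<open>drift_ext\<close> would carry no information.\<close>

lemma drift_ext_exists:
  "\<exists>G. continuous_on H G \<and> G ` H \<subseteq> Q \<and> (\<forall>w\<in>paths T. G (path_class T w) = B w)"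
proof -
  define f where "f c = B (SOME w. w \<in> paths T \<and> path_class T w = c)" for c
  have f: "f (path_class T w) = B w" if "w \<in> paths T" for w
  proof -
    define v where "v = (SOME v. v \<in> paths T \<and> path_class T v = path_class T w)"
    have "v \<in> paths T \<and> path_class T v = path_class T w"
      unfolding v_def by (rule someI[of _ w]) (use that in auto)
    then show ?thesis using B_lipschitz[of v w] that by (simp add: f_def v_def[symmetric])
  qed
  have "uniformly_continuous_on (path_class T ` paths T) f"
    unfolding uniformly_continuous_on_def
  proof (intro allI impI)
    fix e :: real assume e: "0 < e"
    show "\<exists>d>0. \<forall>x\<in>path_class T ` paths T. \<forall>x'\<in>path_class T ` paths T.
        dist x' x < d \<longrightarrow> dist (f x') (f x) < e"
    proof (intro exI[of _ "e / C"] conjI ballI impI)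
      show "0 < e / C" using e C_pos by simp
      fix x x' :: "'d Hspace"
      assume "x \<in> path_class T ` paths T" "x' \<in> path_class T ` paths T" and d: "dist x' x < e / C"
      then obtain v w where vw: "v \<in> paths T" "w \<in> paths T" "x = path_class T v" "x' = path_class T w" by auto
      have "dist (f x') (f x) \<le> C * dist x' x"
        using B_lipschitz[of w v] vw by (simp add: f dist_norm)
      also have "\<dots> < e" using d C_pos by (simp add: field_simps)
      finally show "dist (f x') (f x) < e" .
    qed
  qed
  then obtain g where g: "uniformly_continuous_on (closure (path_class T ` paths T)) g"
      "\<And>x. x \<in> path_class T ` paths T \<Longrightarrow> f x = g x"
    using uniformly_continuous_on_extension_on_closure by metis
  have c: "continuous_on H g"
    using uniformly_continuous_imp_continuous[OF g(1)] by (simp add: closure_path_class)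
  have gB: "g (path_class T w) = B w" if "w \<in> paths T" for w
    using g(2)[of "path_class T w"] f[OF that] that by auto
  have "closed Q" by (rule closed_L2_on[OF square_borel])
  moreover have "g ` path_class T ` paths T \<subseteq> Q"
  proof (intro image_subsetI)
    fix x :: "'d Hspace" assume "x \<in> path_class T ` paths T"
    then obtain w where "w \<in> paths T" "x = path_class T w" by blast
    then show "g x \<in> Q" using gB B_in by simp
  qed
  ultimately have "g ` H \<subseteq> Q"
    using image_closure_subset[of "path_class T ` paths T" g Q] c by (simp add: closure_path_class)
  with c gB show ?thesis by blast
qed

lemma drift_ext_props:
  "continuous_on H G" "w \<in> H \<Longrightarrow> G w \<in> Q" "v \<in> paths T \<Longrightarrow> G (path_class T v) = B v"
proof -
  have "continuous_on H G \<and> G ` H \<subseteq> Q \<and> (\<forall>w\<in>paths T. G (path_class T w) = B w)"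
    unfolding drift_ext_def by (rule someI_ex[OF drift_ext_exists])
  then show "continuous_on H G" "w \<in> H \<Longrightarrow> G w \<in> Q" "v \<in> paths T \<Longrightarrow> G (path_class T v) = B v"
    by auto
qed

lemma drift_tendsto:
  assumes "\<And>n::nat. u n \<in> H" "u \<longlonglongrightarrow> w" "w \<in> H"
  shows "(\<lambda>n. G (u n)) \<longlonglongrightarrow> G w"
  using continuous_on_tendsto_compose[OF drift_ext_props(1) assms(2,3)] assms(1) by simp

text \<open>The Lipschitz, causality and Volterra properties are hypotheses on paths; they reach
  \<open>H\<close> by passing to the limit along such a sequence.\<close>

lemma path_approx:
  assumes "w \<in> H"
  obtains u where "\<And>n::nat. u n \<in> paths T" "(\<lambda>n. path_class T (u n)) \<longlonglongrightarrow> w"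
    "(\<lambda>n. B (u n)) \<longlonglongrightarrow> G w"
proof -
  obtain x where x: "\<And>n::nat. x n \<in> path_class T ` paths T" "x \<longlonglongrightarrow> w"
    using assms unfolding closure_path_class[symmetric] closure_sequential by blast
  from x(1) have "\<forall>n. \<exists>u. u \<in> paths T \<and> x n = path_class T u" by auto
  then obtain u where u: "\<And>n. u n \<in> paths T" "\<And>n. x n = path_class T (u n)" by metis
  have "(\<lambda>n. G (x n)) \<longlonglongrightarrow> G w"
  proof (rule drift_tendsto[OF _ x(2) assms])
    show "x n \<in> H" for n using path_class_in[OF u(1)] by (simp add: u(2))
  qed
  moreover have "x = (\<lambda>n. path_class T (u n))" using u(2) by blast
  ultimately show ?thesis using that[of u] u(1) x(2) by (simp add: drift_ext_props(3))
qed

lemma drift_lipschitz: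
  assumes "v \<in> H" "w \<in> H"
  shows "norm (G v - G w) \<le> C * norm (v - w)"
proof -
  obtain x where x: "\<And>n::nat. x n \<in> paths T" "(\<lambda>n. path_class T (x n)) \<longlonglongrightarrow> v" "(\<lambda>n. B (x n)) \<longlonglongrightarrow> G v"
    using path_approx[OF assms(1)] by blast
  obtain y where y: "\<And>n::nat. y n \<in> paths T" "(\<lambda>n. path_class T (y n)) \<longlonglongrightarrow> w" "(\<lambda>n. B (y n)) \<longlonglongrightarrow> G w"
    using path_approx[OF assms(2)] by blast
  have "(\<lambda>n. norm (B (x n) - B (y n))) \<longlonglongrightarrow> norm (G v - G w)"
    by (intro tendsto_intros x y)
  moreover have "(\<lambda>n. C * norm (path_class T (x n) - path_class T (y n))) \<longlonglongrightarrow> C * norm (v - w)"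
    by (intro tendsto_intros x y)
  ultimately show ?thesis
    by (rule LIMSEQ_le) (use B_lipschitz x(1) y(1) in blast)
qed

section \<open>Causality and the Volterra property of the extended drift\<close>

definition past :: "real \<Rightarrow> (real \<times> real) set" where "past t = {..<t} \<times> UNIV"

lemma past_borel [measurable]: "past t \<in> sets borel"
  unfolding past_def by (intro borel_open open_Times) auto

text \<open>The hypothesis compares continuous paths, but the cut of a path at \<open>t\<close> is
  in general not continuous. It is the \<open>L2\<close> limit of the path times the ramps
  \<open>\<theta> n\<close>, and each ramp equals 1 up to t - 1/n. Causality is applied strictly
  before \<open>t\<close>, then n tends to infinity on a fixed strip, and finally the strips exhaust
  \<open>past t\<close>.\<close>

lemma path_cut_causal:
  assumes w: "w \<in> paths T" and t: "0 < t" "t \<le> T"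
  shows "L2_cut (past t) (G (path_class T w)) = L2_cut (past t) (G (L2_cut {..<t} (path_class T w)))"
proof -
  define \<theta> where "\<theta> n x = min 1 (real n * max 0 (t - x))" for n x
  define c where "c = path_class T w"
  have cut: "L2_cut {..<t} c \<in> H" unfolding c_def by (intro L2_cut_in path_class_in w) auto
  have p: "(\<lambda>x. \<theta> n x *\<^sub>R w x) \<in> paths T" for n
    using w unfolding paths_def \<theta>_def by (auto intro!: continuous_intros)
  have lim: "(\<lambda>n. path_class T (\<lambda>x. \<theta> n x *\<^sub>R w x)) \<longlonglongrightarrow> L2_cut {..<t} c"
  proof -
    have "(\<lambda>n. L2_of (\<lambda>x. indicator {0<..<T} x *\<^sub>R \<theta> n x *\<^sub>R w x))
        \<longlonglongrightarrow> L2_of (\<lambda>x. indicator {..<t} x *\<^sub>R indicator {0<..<T} x *\<^sub>R w x)"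
    proof (rule tendsto_L2_of_dominated[where c=1])
      show "(\<lambda>x. indicator {0<..<T} x *\<^sub>R \<theta> n x *\<^sub>R w x) \<in> borel_measurable lborel" for n
        by (rule sq_integrable_measurable[OF sq_integrable_path[OF p]])
      show "sq_integrable (\<lambda>x. indicator {..<t} x *\<^sub>R indicator {0<..<T} x *\<^sub>R w x)"
        by (rule sq_integrable_mult[OF multiplier_indicator sq_integrable_path[OF w]]) simp
      show "AE x in lborel. (\<lambda>n. indicator {0<..<T} x *\<^sub>R \<theta> n x *\<^sub>R w x)
          \<longlonglongrightarrow> indicator {..<t} x *\<^sub>R indicator {0<..<T} x *\<^sub>R w x"
      proof (rule AE_I2)
        fix x
        have "(\<lambda>n. \<theta> n x) \<longlonglongrightarrow> indicator {..<t} x"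
        proof (cases "x < t")
          case True
          obtain N where N: "1 < real N * (t - x)" using reals_Archimedean3[of "t - x"] True by auto
          have "\<forall>\<^sub>F n in sequentially. indicator {..<t} x = \<theta> n x"
            using eventually_ge_at_top[of N]
          proof eventually_elim
            case (elim n)
            then have "real N * (t - x) \<le> real n * (t - x)"
              using True by (intro mult_right_mono) auto
            then have "1 \<le> real n * (t - x)" using N by linarith
            then show ?case using True by (simp add: \<theta>_def min_def)
          qed
          then show ?thesis by (rule Lim_transform_eventually[OF tendsto_const])
        qed (simp add: \<theta>_def)
        then have "(\<lambda>n. \<theta> n x *\<^sub>R indicator {0<..<T} x *\<^sub>R w x)
          \<longlonglongrightarrow> indicator {..<t} x *\<^sub>R indicator {0<..<T} x *\<^sub>R w x"
          by (intro tendsto_intros)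
        then show "(\<lambda>n. indicator {0<..<T} x *\<^sub>R \<theta> n x *\<^sub>R w x)
          \<longlonglongrightarrow> indicator {..<t} x *\<^sub>R indicator {0<..<T} x *\<^sub>R w x"
          by (simp add: mult.commute)
      qed
      show "AE x in lborel. norm (indicator {0<..<T} x *\<^sub>R \<theta> n x *\<^sub>R w x)
          \<le> 1 * norm (indicator {..<t} x *\<^sub>R indicator {0<..<T} x *\<^sub>R w x)" for n
      proof (rule AE_I2)
        fix x
        have "\<bar>\<theta> n x\<bar> \<le> indicator {..<t} x" by (auto simp: \<theta>_def indicator_def)
        then show "norm (indicator {0<..<T} x *\<^sub>R \<theta> n x *\<^sub>R w x)
          \<le> 1 * norm (indicator {..<t} x *\<^sub>R indicator {0<..<T} x *\<^sub>R w x)"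
          by (cases "x \<in> {0<..<T}") (auto intro!: mult_right_mono)
      qed
    qed
    then show ?thesis
      unfolding c_def L2_restrict_def
      by (subst L2_mult_of[OF multiplier_indicator]) (auto intro: sq_integrable_path w)
  qed
  \<comment> \<open>The ramp is 1 where t - \<xi> >= 1/n, so the strip belonging to \<open>m\<close>
    serves all n > m. If t - 1 / Suc m <= 0 the strip is empty.\<close>
  have eq: "AE z in lborel. fst z \<in> {0<..<t - 1 / Suc m} \<longrightarrow>
      L2_rep (B w) z = L2_rep (B (\<lambda>x. \<theta> n x *\<^sub>R w x)) z" if "m < n" for m n
  proof (cases "0 < t - 1 / Suc m")
    case True
    have "w \<xi> = \<theta> n \<xi> *\<^sub>R w \<xi>" if "\<xi> \<in> {0<..<t - 1 / Suc m}" for \<xi>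
    proof -
      have "1 / Suc m \<le> t - \<xi>" using that by simp
      then have pos: "0 \<le> t - \<xi>" by (rule order_trans[rotated]) simp
      from \<open>1 / Suc m \<le> t - \<xi>\<close> have "1 \<le> real (Suc m) * (t - \<xi>)" by (simp add: field_simps)
      also have "\<dots> \<le> real n * (t - \<xi>)"
        using \<open>m < n\<close> pos by (intro mult_right_mono) auto
      finally have "\<theta> n \<xi> = 1" using pos by (simp add: \<theta>_def)
      then show ?thesis by simp
    qed
    then show ?thesis using True t
      by (intro L2_rep_eq_of_slice_eq B_causal w p) (auto intro: order_trans[of _ t])
  qed (auto simp: not_less)
  have Gin: "B w \<in> Q" "B (\<lambda>x. \<theta> n x *\<^sub>R w x) \<in> Q" for n using B_in w p by auto
  have "L2_cut (past (t - 1 / Suc m)) (B w) = L2_cut (past (t - 1 / Suc m)) (G (L2_cut {..<t} c))" for m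
  proof -
    have bl: "bounded_linear (L2_cut (past (t - 1 / Suc m)) :: 'd Hsquare \<Rightarrow> _)"
      by (intro bounded_linear_L2_mult[OF multiplier_indicator] past_borel)
    have "(\<lambda>n. G (path_class T (\<lambda>x. \<theta> n x *\<^sub>R w x))) \<longlonglongrightarrow> G (L2_cut {..<t} c)"
      by (intro drift_tendsto cut lim path_class_in p)
    then have "(\<lambda>n. L2_cut (past (t - 1 / Suc m)) (B (\<lambda>x. \<theta> n x *\<^sub>R w x)))
        \<longlonglongrightarrow> L2_cut (past (t - 1 / Suc m)) (G (L2_cut {..<t} c))"
      by (intro bounded_linear.tendsto[OF bl]) (simp add: drift_ext_props(3) p)
    have "\<forall>\<^sub>F n in sequentially. L2_cut (past (t - 1 / Suc m)) (B (\<lambda>x. \<theta> n x *\<^sub>R w x))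
        = L2_cut (past (t - 1 / Suc m)) (B w)"
      using eventually_gt_at_top[of m]
    proof eventually_elim
      case (elim n)
      show ?case
      proof (rule L2_eqI)
        show "AE z in lborel. L2_rep (L2_cut (past (t - 1 / Suc m)) (B (\<lambda>x. \<theta> n x *\<^sub>R w x))) z
          = L2_rep (L2_cut (past (t - 1 / Suc m)) (B w)) z"
          using eq[OF elim] Gin(1) Gin(2)[of n] unfolding L2_on_def mem_Collect_eq
            using L2_rep_mult[OF multiplier_indicator[OF past_borel[of "t - 1 / Suc m"]], of "B w"]
             L2_rep_mult[OF multiplier_indicator[OF past_borel[of "t - 1 / Suc m"]], of "B (\<lambda>x. \<theta> n x *\<^sub>R w x)"]
          by eventually_elim (auto simp: past_def indicator_def)
      qed
    qed
    from tendsto_eventually[OF this] show ?thesis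
      by (rule LIMSEQ_unique) fact
  qed
  then have "L2_cut (past (t - 1 / Suc m)) (B w - G (L2_cut {..<t} c)) = 0" for m
    by (subst L2_mult_diff[OF multiplier_indicator]) auto
  \<comment> \<open>Only countably many strips occur, so their exceptional sets can be united before
    passing to \<open>past t\<close>.\<close>
  then have "AE z in lborel. \<forall>m. z \<in> past (t - 1 / Suc m) \<longrightarrow> L2_rep (B w - G (L2_cut {..<t} c)) z = 0"
    unfolding AE_all_countable L2_cut_eq_0_iff[OF past_borel] by blast
  then have "AE z in lborel. z \<in> past t \<longrightarrow> L2_rep (B w - G (L2_cut {..<t} c)) z = 0"
  proof eventually_elim
    case (elim z)
    show ?case
    proof
      assume "z \<in> past t"
      then have "0 < t - fst z" by (auto simp: past_def)
      then obtain m where "1 / Suc m < t - fst z" using nat_approx_posE by metis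
      then have "z \<in> past (t - 1 / Suc m)" by (cases z) (auto simp: past_def)
      then show "L2_rep (B w - G (L2_cut {..<t} c)) z = 0" using elim by blast
    qed
  qed
  then have "L2_cut (past t) (B w - G (L2_cut {..<t} c)) = 0" by (simp add: L2_cut_eq_0_iff)
  then show ?thesis
    by (simp add: L2_mult_diff[OF multiplier_indicator] drift_ext_props(3) w c_def)
qed

text \<open>Both sides depend continuously on \<open>w\<close>, so the identity for paths extends by
  density.\<close>

lemma drift_causal:
  assumes w: "w \<in> H" and t: "0 < t" "t \<le> T"
  shows "L2_cut (past t) (G w) = L2_cut (past t) (G (L2_cut {..<t} w))"
proof -
  obtain x where x: "\<And>n::nat. x n \<in> paths T" "(\<lambda>n. path_class T (x n)) \<longlonglongrightarrow> w" "(\<lambda>n. B (x n)) \<longlonglongrightarrow> G w"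
    using path_approx[OF w] by blast
  have bl: "bounded_linear (L2_cut (past t) :: 'd Hsquare \<Rightarrow> _)"
    by (intro bounded_linear_L2_mult[OF multiplier_indicator] past_borel)
  have bl': "bounded_linear (L2_cut {..<t} :: 'd Hspace \<Rightarrow> _)"
    by (intro bounded_linear_L2_mult[OF multiplier_indicator]) auto
  have "(\<lambda>n. L2_cut {..<t} (path_class T (x n))) \<longlonglongrightarrow> L2_cut {..<t} w"
    by (intro bounded_linear.tendsto[OF bl'] x)
  then have "(\<lambda>n. G (L2_cut {..<t} (path_class T (x n)))) \<longlonglongrightarrow> G (L2_cut {..<t} w)"
    by (intro drift_tendsto L2_cut_in path_class_in x w) auto
  then have "(\<lambda>n. L2_cut (past t) (G (L2_cut {..<t} (path_class T (x n)))))
      \<longlonglongrightarrow> L2_cut (past t) (G (L2_cut {..<t} w))"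
    by (rule bounded_linear.tendsto[OF bl])
  moreover have "(\<lambda>n. L2_cut (past t) (B (x n))) \<longlonglongrightarrow> L2_cut (past t) (G w)"
    by (intro bounded_linear.tendsto[OF bl] x)
  moreover have "L2_cut (past t) (B (x n)) = L2_cut (past t) (G (L2_cut {..<t} (path_class T (x n))))" for n
    using path_cut_causal[OF x(1) t, of n] drift_ext_props(3)[OF x(1), of n] by simp
  ultimately show ?thesis using LIMSEQ_unique by simp
qed

text \<open>Causality replaces \<open>v\<close> and \<open>w\<close> by their cuts at
  \<open>t\<close>; the global Lipschitz bound for the cuts then sees only the difference before
  \<open>t\<close>.\<close>

lemma drift_causal_lipschitz:
  assumes "v \<in> H" "w \<in> H" "0 < t" "t \<le> T"
  shows "norm (L2_cut (past t) (G v - G w)) \<le> C * norm (L2_cut {..<t} (v - w))"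
proof -
  have i: "L2_cut {..<t} v \<in> H" "L2_cut {..<t} w \<in> H" using assms by (auto intro: L2_cut_in)
  have "L2_cut (past t) (G v - G w) = L2_cut (past t) (G (L2_cut {..<t} v) - G (L2_cut {..<t} w))"
    using drift_causal[of v t] drift_causal[of w t] assms
    by (simp add: L2_mult_diff[OF multiplier_indicator])
  then have "norm (L2_cut (past t) (G v - G w)) \<le> 1 * norm (G (L2_cut {..<t} v) - G (L2_cut {..<t} w))"
    by (simp only:) (rule norm_L2_mult_bound[OF multiplier_indicator[OF past_borel]])
  also have "\<dots> \<le> C * norm (L2_cut {..<t} v - L2_cut {..<t} w)"
    using drift_lipschitz[OF i] by simp
  finally show ?thesis by (simp add: L2_mult_diff[OF multiplier_indicator])
qed

text \<open>For a path the hypothesis says that \<open>B v\<close> vanishes on the region \<xi> < r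
  of the square. Vanishing on a fixed Borel set is a closed condition in \<open>L2\<close>, hence it
  survives the limit.\<close>

lemma drift_volterra:
  assumes "w \<in> H"
  shows "AE z in lborel. snd z < fst z \<longrightarrow> L2_rep (G w) z = 0"
proof -
  define U :: "(real \<times> real) set" where "U = {z. snd z < fst z}"
  have "open U" unfolding U_def by (intro open_Collect_less continuous_intros)
  then have U [measurable]: "U \<in> sets borel" by simp
  have path: "B v \<in> L2_on (- U)" if v: "v \<in> paths T" for v
  proof -
    have "AE r in lborel. AE \<xi> in lborel. (r, \<xi>) \<in> U \<longrightarrow> L2_rep (B v) (r, \<xi>) = 0"
      using B_volterra[OF v] L2_rep_slice[of "B v"]
        AE_lborel_pair[OF B_in[OF v, unfolded L2_on_def mem_Collect_eq]]
    proof eventually_elim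
      case (elim r)
      show ?case
      proof (cases "r \<in> {0<..<T}")
        case True
        have "AE \<xi> in lborel. \<xi> \<in> {0<..<r} \<longrightarrow> L2_rep (L2_slice (B v) r) \<xi> = 0"
          using elim(1) True by blast
        then show ?thesis using elim(2,3) AE_lborel_singleton[of 0]
        proof eventually_elim
          case (elim \<xi>)
          then show ?case by (auto simp: U_def)
        qed
      next
        case False
        show ?thesis using elim(3) by eventually_elim (use False in auto)
      qed
    qed
    then have "AE z in lborel. z \<in> U \<longrightarrow> L2_rep (B v) z = 0"
      by (subst AE_lborel_pair_iff) auto
    then show ?thesis by (simp add: L2_on_def)
  qed
  obtain x where x: "\<And>n::nat. x n \<in> paths T" "(\<lambda>n. B (x n)) \<longlonglongrightarrow> G w"
    using path_approx[OF assms] by metis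
  have "closed (L2_on (- U) :: 'd Hsquare set)" by (intro closed_L2_on) simp
  then have "G w \<in> L2_on (- U)" using path[OF x(1)] x(2) by (rule closed_sequentially)
  then show ?thesis by (simp add: L2_on_def U_def)
qed

end

lemma L2_on_mono: "A \<subseteq> B \<Longrightarrow> L2_on A \<subseteq> L2_on B"
  by (auto simp: L2_on_def elim!: eventually_mono)

subsection \<open>Integrals of slices\<close>

lemma inner_L2_rep: "f \<bullet> g = (LINT x|lborel. L2_rep f x \<bullet> L2_rep g x)"
  using inner_L2_of[OF sq_integrable_L2_rep sq_integrable_L2_rep, of f g] by simp

lemma inner_L2_mult:
  assumes "multiplier c g"
  shows "L2_mult g f \<bullet> h = f \<bullet> L2_mult g h"
  unfolding inner_L2_rep
  by (rule integral_cong_AE)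
     (use L2_rep_mult[OF assms, of f] L2_rep_mult[OF assms, of h] in \<open>auto elim: eventually_elim2\<close>)

lemma L2_slice_cut:
  fixes f :: "('a::euclidean_space \<times> 'b::euclidean_space, 'c::euclidean_space) L2"
  assumes "A \<in> sets borel"
  shows "AE r in lborel. L2_slice (L2_cut (A \<times> UNIV) f) r = indicator A r *\<^sub>R L2_slice f r"
proof -
  have "A \<times> UNIV \<in> sets (borel :: ('a \<times> 'b) measure)"
    unfolding borel_prod[symmetric] using assms by simp
  from AE_lborel_pair[OF L2_rep_mult[OF multiplier_indicator[OF this], of f]]
  show ?thesis
    using AE_sq_integrable_slice[of f] AE_sq_integrable_slice[of "L2_cut (A \<times> UNIV) f"]
  proof eventually_elim
    case (elim r)
    then show ?case
      unfolding L2_slice_def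
      by (simp add: L2_of_scaleR L2_of_eq_iff sq_integrable_scaleR indicator_times)
  qed
qed

lemma nn_integral_norm_slice_cut:
  assumes [measurable]: "A \<in> sets borel"
  shows "(\<integral>\<^sup>+r. indicator A r * ennreal ((norm (L2_slice f r))\<^sup>2) \<partial>lborel)
    = ennreal ((norm (L2_cut (A \<times> UNIV) f))\<^sup>2)"
  unfolding nn_integral_norm_slice[symmetric]
  by (rule nn_integral_cong_AE, use L2_slice_cut[OF assms, of f] in eventually_elim)
     (auto simp: indicator_def)

definition slice_int :: "real \<Rightarrow> real \<Rightarrow> (real \<times> 'c::euclidean_space, 'a::euclidean_space) L2 \<Rightarrow> ('c, 'a) L2" where
  "slice_int s t f = (LINT r:{s..t}|lborel. L2_slice f r)"

text \<open>On a bounded interval the bound a <= 1 + a^2 turns square integrability of the slice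
  norms into integrability.\<close>

lemma set_integrable_slice:
  fixes s t :: real
  shows "set_integrable lborel {s..t} (L2_slice f)"
  unfolding set_integrable_def
proof (rule integrableI_bounded)
  have "(\<integral>\<^sup>+r. ennreal (norm (indicator {s..t} r *\<^sub>R L2_slice f r)) \<partial>lborel)
      \<le> (\<integral>\<^sup>+r. indicator {s..t} r + ennreal ((norm (L2_slice f r))\<^sup>2) \<partial>lborel)"
  proof (rule nn_integral_mono)
    fix r
    have "norm (L2_slice f r) \<le> 1 + (norm (L2_slice f r))\<^sup>2"
      using sum_squares_bound[of 1 "norm (L2_slice f r)"] norm_ge_zero[of "L2_slice f r"]
      unfolding power_one mult_1_right by linarith
    then have "ennreal (norm (L2_slice f r)) \<le> 1 + ennreal ((norm (L2_slice f r))\<^sup>2)"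
      by (metis ennreal_1 ennreal_leI ennreal_plus zero_le_one zero_le_power2)
    then show "ennreal (norm (indicator {s..t} r *\<^sub>R L2_slice f r))
        \<le> indicator {s..t} r + ennreal ((norm (L2_slice f r))\<^sup>2)"
      by (simp add: indicator_def)
  qed
  also have "\<dots> = emeasure lborel {s..t} + ennreal ((norm f)\<^sup>2)"
    by (subst nn_integral_add) (simp_all add: nn_integral_norm_slice nn_integral_indicator measurable_lborel1)
  also have "\<dots> < \<infinity>" by (cases "s \<le> t") auto
  finally show "(\<integral>\<^sup>+r. ennreal (norm (indicator {s..t} r *\<^sub>R L2_slice f r)) \<partial>lborel) < \<infinity>" .
qed simp

lemma slice_int_diff: "slice_int s t (f - g) = slice_int s t f - slice_int s t g"
  unfolding slice_int_def
  by (subst set_integral_diff(2)[OF set_integrable_slice set_integrable_slice, symmetric])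
     (auto intro!: set_lebesgue_integral_cong_AE[OF _ _ _ eventually_mono[OF L2_slice_diff[of f g]]])

lemma slice_int_cong:
  assumes "AE r in lborel. r \<in> {s..t} \<longrightarrow> L2_slice f r = L2_slice g r"
  shows "slice_int s t f = slice_int s t g"
  unfolding slice_int_def
  by (rule set_lebesgue_integral_cong_AE[OF _ _ _ assms]) simp_all

lemma slice_int_split:
  assumes "s \<le> u" "u \<le> t"
  shows "slice_int s t f = slice_int s u f + slice_int u t f"
proof -
  have "(LINT r:{s..u} \<union> {u..t}|lborel. L2_slice f r)
      = (LINT r:{s..u}|lborel. L2_slice f r) + (LINT r:{u..t}|lborel. L2_slice f r)"
    by (intro set_integral_Un_AE set_integrable_slice)
       (use AE_lborel_singleton[of u] in \<open>auto elim!: eventually_mono\<close>)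
  then show ?thesis using assms by (simp add: slice_int_def ivl_disj_un_two_touch)
qed

text \<open>The cut by the complement of \<open>A\<close> is bounded and linear, so it may be moved
  under the Bochner integral, where it gives 0.\<close>

lemma slice_int_mem:
  assumes A: "A \<in> sets borel" and in_A: "AE r in lborel. r \<in> {s..t} \<longrightarrow> L2_slice f r \<in> L2_on A"
  shows "slice_int s t f \<in> L2_on A"
proof -
  have bl: "bounded_linear (L2_cut (- A) :: ('a, 'b) L2 \<Rightarrow> _)"
    using A by (intro bounded_linear_L2_mult[OF multiplier_indicator] borel_comp)
  have "L2_cut (- A) (slice_int s t f) = (LINT r|lborel. L2_cut (- A) (indicator {s..t} r *\<^sub>R L2_slice f r))"
    unfolding slice_int_def set_lebesgue_integral_def
    using integral_bounded_linear[OF bl set_integrable_slice[unfolded set_integrable_def], of s t f] by simp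
  also have "\<dots> = 0"
  proof (rule integral_eq_zero_AE, use in_A in eventually_elim)
    case (elim r)
    then show ?case
      using linear_0[OF bounded_linear.linear[OF bl]] A by (auto simp: indicator_def L2_on_iff)
  qed
  finally show ?thesis using A by (simp add: L2_on_iff)
qed

subsection \<open>Exponentially weighted norms\<close>

lemma nn_integral_exp_tail:
  fixes a l :: real
  assumes "0 < l"
  shows "(\<integral>\<^sup>+\<tau>. ennreal (l * exp (- l * \<tau>)) * indicator {a<..} \<tau> \<partial>lborel) = ennreal (exp (- l * a))"
proof -
  have "(\<integral>\<^sup>+\<tau>. ennreal (l * exp (- l * \<tau>)) * indicator {a<..} \<tau> \<partial>lborel)
      = (\<integral>\<^sup>+\<tau>. ennreal (l * exp (- l * \<tau>)) * indicator {a..} \<tau> \<partial>lborel)"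
    by (rule nn_integral_cong_AE, use AE_lborel_singleton[of a] in eventually_elim)
       (auto simp: indicator_def)
  also have "\<dots> = ennreal (0 - (- exp (- l * a)))"
  proof (rule nn_integral_FTC_atLeast[where F="\<lambda>x. - exp (- l * x)"])
    have "((\<lambda>x. exp (- (l * x))) \<longlongrightarrow> 0) at_top"
      using assms by (intro filterlim_compose[OF exp_at_bot] filterlim_compose[OF filterlim_uminus_at_bot_at_top]
        filterlim_tendsto_pos_mult_at_top[OF tendsto_const _ filterlim_ident])
    then show "((\<lambda>x. - exp (- l * x)) \<longlongrightarrow> 0) at_top"
      using tendsto_minus by fastforce
  qed (use assms in \<open>auto intro!: derivative_eq_intros\<close>)
  finally show ?thesis by simp
qed

text \<open>Layer-cake representation \<open>exp (- l x) = \<integral> l exp (- l \<tau>) 1(x < \<tau>) d\<tau>\<close>.\<close>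

lemma nn_integral_exp_weight:
  fixes u :: "real \<Rightarrow> ennreal"
  assumes [measurable]: "u \<in> borel_measurable borel" and l: "0 < l"
  shows "(\<integral>\<^sup>+x. ennreal (exp (- l * x)) * u x \<partial>lborel)
    = (\<integral>\<^sup>+\<tau>. ennreal (l * exp (- l * \<tau>)) * (\<integral>\<^sup>+x. indicator {..<\<tau>} x * u x \<partial>lborel) \<partial>lborel)"
proof -
  have "(\<integral>\<^sup>+x. ennreal (exp (- l * x)) * u x \<partial>lborel)
      = (\<integral>\<^sup>+x. (\<integral>\<^sup>+\<tau>. ennreal (l * exp (- l * \<tau>)) * (if x < \<tau> then u x else 0) \<partial>lborel) \<partial>lborel)"
  proof (rule nn_integral_cong)
    fix x :: real
    have "ennreal (exp (- l * x)) * u x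
        = (\<integral>\<^sup>+\<tau>. ennreal (l * exp (- l * \<tau>)) * indicator {x<..} \<tau> * u x \<partial>lborel)"
      by (subst nn_integral_multc) (simp_all only: nn_integral_exp_tail[OF l], measurable)
    then show "ennreal (exp (- l * x)) * u x
        = (\<integral>\<^sup>+\<tau>. ennreal (l * exp (- l * \<tau>)) * (if x < \<tau> then u x else 0) \<partial>lborel)"
      by (simp add: indicator_def of_bool_def if_distrib if_distribR cong: if_cong)
  qed
  also have "\<dots> = (\<integral>\<^sup>+\<tau>. (\<integral>\<^sup>+x. ennreal (l * exp (- l * \<tau>)) * (if x < \<tau> then u x else 0) \<partial>lborel) \<partial>lborel)"
    by (rule lborel_pair.Fubini'[symmetric]) measurable
  also have "\<dots> = (\<integral>\<^sup>+\<tau>. ennreal (l * exp (- l * \<tau>)) * (\<integral>\<^sup>+x. indicator {..<\<tau>} x * u x \<partial>lborel) \<partial>lborel)"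
    by (intro nn_integral_cong, subst nn_integral_cmult[symmetric])
       (auto intro!: nn_integral_cong simp: indicator_def)
  finally show ?thesis .
qed

text \<open>Causality provides inequalities between integrals over x < \<tau> for every \<tau>;
  averaging them against the density l exp (- l \<tau>) gives the weighted inequality with the same
  constant.\<close>

lemma nn_integral_exp_weight_mono:
  fixes u v :: "real \<Rightarrow> ennreal"
  assumes [measurable]: "u \<in> borel_measurable borel" "v \<in> borel_measurable borel" and l: "0 < l"
    and le: "\<And>\<tau>. (\<integral>\<^sup>+x. indicator {..<\<tau>} x * u x \<partial>lborel) \<le> c * (\<integral>\<^sup>+x. indicator {..<\<tau>} x * v x \<partial>lborel)"
  shows "(\<integral>\<^sup>+x. ennreal (exp (- l * x)) * u x \<partial>lborel) \<le> c * (\<integral>\<^sup>+x. ennreal (exp (- l * x)) * v x \<partial>lborel)"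
proof -
  have "(\<integral>\<^sup>+x. ennreal (exp (- l * x)) * u x \<partial>lborel)
      \<le> (\<integral>\<^sup>+\<tau>. c * (ennreal (l * exp (- l * \<tau>)) * (\<integral>\<^sup>+x. indicator {..<\<tau>} x * v x \<partial>lborel)) \<partial>lborel)"
    unfolding nn_integral_exp_weight[OF assms(1) l]
    by (intro nn_integral_mono order_trans[OF mult_left_mono[OF le]]) (auto simp: ac_simps)
  also have "\<dots> = c * (\<integral>\<^sup>+\<tau>. ennreal (l * exp (- l * \<tau>)) * (\<integral>\<^sup>+x. indicator {..<\<tau>} x * v x \<partial>lborel) \<partial>lborel)"
  proof (rule nn_integral_cmult)
    have "(\<lambda>\<tau>. \<integral>\<^sup>+x. (if x < \<tau> then v x else 0) \<partial>lborel) \<in> borel_measurable lborel"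
      by measurable
    moreover have "(\<integral>\<^sup>+x. (if x < \<tau> then v x else 0) \<partial>lborel) = (\<integral>\<^sup>+x. indicator {..<\<tau>} x * v x \<partial>lborel)" for \<tau>
      by (intro nn_integral_cong) (auto simp: indicator_def)
    ultimately show "(\<lambda>\<tau>. ennreal (l * exp (- l * \<tau>)) * (\<integral>\<^sup>+x. indicator {..<\<tau>} x * v x \<partial>lborel)) \<in> borel_measurable lborel"
      by simp
  qed
  also have "\<dots> = c * (\<integral>\<^sup>+x. ennreal (exp (- l * x)) * v x \<partial>lborel)"
    unfolding nn_integral_exp_weight[OF assms(2) l] ..
  finally show ?thesis .
qed

text \<open>The exponent is halved because norms square the multiplier. The indicator keeps the
  weight bounded by 1, as the exponential alone is unbounded on the negative axis.\<close>

definition exp_weight :: "real \<Rightarrow> real \<Rightarrow> real \<Rightarrow> real" where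
  "exp_weight T l \<xi> = indicator {0<..<T} \<xi> * exp (- l * \<xi> / 2)"

lemma multiplier_exp_weight: "0 \<le> l \<Longrightarrow> multiplier 1 (exp_weight T l)"
  by (auto simp: multiplier_def exp_weight_def[abs_def] indicator_def)

lemma measurable_exp_weight [measurable]: "exp_weight T l \<in> borel_measurable borel"
  by (simp add: exp_weight_def[abs_def])

text \<open>On (0, T) the weight is at least exp (- l T / 2), and \<open>f\<close> vanishes
  elsewhere.\<close>

lemma norm_le_exp_weight:
  assumes "0 \<le> l" "f \<in> L2_on {0<..<T}"
  shows "norm f \<le> exp (l * T / 2) * norm (L2_mult (exp_weight T l) f)"
proof -
  have "norm (L2_mult (\<lambda>x. 1) f) \<le> exp (l * T / 2) * norm (L2_mult (exp_weight T l) f)"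
  proof (rule norm_L2_mult_le[OF multiplier_one multiplier_exp_weight[OF assms(1)]])
    show "AE x in lborel. \<bar>1\<bar> \<le> exp (l * T / 2) * \<bar>exp_weight T l x\<bar> \<or> L2_rep f x = 0"
      using assms(2) unfolding L2_on_def mem_Collect_eq
    proof eventually_elim
      case (elim x)
      have "1 \<le> exp (l * T / 2) * exp (- l * x / 2)" if "x < T"
        using that mult_left_mono[of x T l] assms(1) by (simp add: exp_add[symmetric] field_simps)
      then show ?case using elim by (auto simp: exp_weight_def)
    qed
  qed simp
  then show ?thesis by simp
qed

text \<open>The gain \<open>1 / l\<close> comes from testing against the weighted integral itself, where the weight
  lets the triangle \<open>r \<le> \<xi>\<close> contribute only \<open>\<integral> exp (l (r - \<xi>)) dr \<le> 1 / l\<close>.\<close>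

lemma exp_weight_slice_int:
  fixes f :: "(real \<times> real, 'a::euclidean_space) L2"
  assumes l: "0 < l" and s: "0 \<le> s"
    and volterra: "AE z in lborel. snd z < fst z \<longrightarrow> L2_rep f z = 0"
  shows "ennreal ((norm (L2_mult (exp_weight T l) (slice_int s t f)))\<^sup>2)
    \<le> ennreal (1 / l) * (\<integral>\<^sup>+r. ennreal (exp (- l * r)) * ennreal ((norm (L2_slice f r))\<^sup>2) \<partial>lborel)"
    (is "_ \<le> _ * ?A")
proof -
  note mg = multiplier_exp_weight[OF less_imp_le[OF l], of T]
  define X where "X = L2_mult (exp_weight T l) (slice_int s t f)"
  \<comment> \<open>By the Volterra property the slice at \<open>r\<close> lives on \<xi> >= r, so
    the weight may be cut there; this is where the triangle enters.\<close>
  define g where "g r \<xi> = exp_weight T l \<xi> * indicator {r..} \<xi>" for r \<xi>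
  have gm: "multiplier 1 (g r)" for r
    using multiplier_times[OF mg multiplier_indicator[of "{r..}"]] by (simp add: g_def[abs_def])
  have bl: "bounded_linear (\<lambda>h. L2_mult (exp_weight T l) h \<bullet> X)"
    by (rule bounded_linear_compose[OF bounded_linear_inner_left bounded_linear_L2_mult[OF mg]])
  \<comment> \<open>\<open>X\<close> is the weighted integral, so pairing it with itself moves one
    factor under the integral in \<open>r\<close>.\<close>
  have "(norm X)\<^sup>2 = (LINT r|lborel. L2_mult (exp_weight T l) (indicator {s..t} r *\<^sub>R L2_slice f r) \<bullet> X)"
    using integral_bounded_linear[OF bl set_integrable_slice[unfolded set_integrable_def], of s t f]
    by (simp add: X_def power2_norm_eq_inner slice_int_def set_lebesgue_integral_def)
  then have "ennreal ((norm X)\<^sup>2) = ennreal (norm (LINT r|lborel. L2_mult (exp_weight T l) (indicator {s..t} r *\<^sub>R L2_slice f r) \<bullet> X))"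
    by (metis norm_ge_zero abs_of_nonneg real_norm_def zero_le_power2)
  also have "\<dots> \<le> (\<integral>\<^sup>+r. ennreal (norm (L2_mult (exp_weight T l) (indicator {s..t} r *\<^sub>R L2_slice f r) \<bullet> X)) \<partial>lborel)"
    using integrable_bounded_linear[OF bl set_integrable_slice[unfolded set_integrable_def], of s t f]
    by (rule integral_norm_bound_ennreal)
  also have "\<dots> \<le> (\<integral>\<^sup>+r. ennreal (1 / (2 * l)) * (ennreal (exp (- l * r)) * ennreal ((norm (L2_slice f r))\<^sup>2))
      + ennreal (l / 2) * (\<integral>\<^sup>+\<xi>. indicator {0..} r * ennreal (exp (l * r)) * ennreal ((g r \<xi>)\<^sup>2 * (norm (L2_rep X \<xi>))\<^sup>2) \<partial>lborel) \<partial>lborel)"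
  proof (rule nn_integral_mono_AE, use AE_lborel_pair[OF volterra] L2_rep_slice[of f] in eventually_elim)
    case (elim r)
    have "L2_mult (exp_weight T l) (L2_slice f r) = L2_mult (g r) (L2_slice f r)"
      by (rule L2_mult_cong[OF mg gm], use elim in eventually_elim) (auto simp: g_def indicator_def)
    then have "norm (L2_mult (exp_weight T l) (L2_slice f r) \<bullet> X) = \<bar>L2_slice f r \<bullet> L2_mult (g r) X\<bar>"
      by (simp add: inner_L2_mult[OF gm])
    also have "\<dots> \<le> norm (L2_slice f r) * norm (L2_mult (g r) X)" by (rule Cauchy_Schwarz_ineq2)
    \<comment> \<open>Young's inequality with weight exp (l r) and parameter l, chosen so that the
      second term integrates to at most half of the square of \<open>norm X\<close>.\<close>
    also have "\<dots> \<le> 1 / (2 * l) * (exp (- l * r) * (norm (L2_slice f r))\<^sup>2)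
        + l / 2 * (exp (l * r) * (norm (L2_mult (g r) X))\<^sup>2)"
    proof -
      have "2 * (exp (- l * r / 2) * norm (L2_slice f r) / sqrt l) * (sqrt l * exp (l * r / 2) * norm (L2_mult (g r) X))
          \<le> (exp (- l * r / 2) * norm (L2_slice f r) / sqrt l)\<^sup>2 + (sqrt l * exp (l * r / 2) * norm (L2_mult (g r) X))\<^sup>2"
        by (rule sum_squares_bound)
      moreover have "(exp (- l * r / 2))\<^sup>2 = exp (- l * r)" "(exp (l * r / 2))\<^sup>2 = exp (l * r)"
        "exp (- l * r / 2) * exp (l * r / 2) = 1"
        by (simp_all add: power2_eq_square exp_add[symmetric])
      ultimately show ?thesis using l
        by (simp add: power_mult_distrib power_divide field_simps)
    qed
    finally have *: "norm (L2_mult (exp_weight T l) (L2_slice f r) \<bullet> X)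
        \<le> 1 / (2 * l) * (exp (- l * r) * (norm (L2_slice f r))\<^sup>2)
          + l / 2 * (exp (l * r) * (norm (L2_mult (g r) X))\<^sup>2)" .
    have "(\<integral>\<^sup>+\<xi>. ennreal (exp (l * r)) * ennreal ((g r \<xi>)\<^sup>2 * (norm (L2_rep X \<xi>))\<^sup>2) \<partial>lborel)
        = ennreal (exp (l * r)) * ennreal ((norm (L2_mult (g r) X))\<^sup>2)"
    proof -
      have [measurable]: "g r \<in> borel_measurable borel" by (rule multiplier_measurable[OF gm])
      show ?thesis unfolding norm_L2_mult[OF gm] by (rule nn_integral_cmult) measurable
    qed
    moreover have "ennreal (norm (L2_mult (exp_weight T l) (L2_slice f r) \<bullet> X))
        \<le> ennreal (1 / (2 * l)) * (ennreal (exp (- l * r)) * ennreal ((norm (L2_slice f r))\<^sup>2))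
          + ennreal (l / 2) * (ennreal (exp (l * r)) * ennreal ((norm (L2_mult (g r) X))\<^sup>2))"
      using ennreal_leI[OF *] l by (simp add: ennreal_mult[symmetric] ennreal_plus[symmetric] del: ennreal_plus)
    moreover have "L2_mult (exp_weight T l) (indicator {s..t} r *\<^sub>R L2_slice f r) \<bullet> X
        = indicator {s..t} r * (L2_mult (exp_weight T l) (L2_slice f r) \<bullet> X)"
      using linear_scale[OF bounded_linear.linear[OF bl]] by simp
    ultimately show ?case using s by (auto simp: indicator_def)
  qed
  also have "\<dots> = ennreal (1 / (2 * l)) * ?A
      + ennreal (l / 2) * (\<integral>\<^sup>+r. \<integral>\<^sup>+\<xi>. indicator {0..} r * ennreal (exp (l * r)) * ennreal ((g r \<xi>)\<^sup>2 * (norm (L2_rep X \<xi>))\<^sup>2) \<partial>lborel \<partial>lborel)"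
    unfolding g_def indicator_def atLeast_iff by (subst nn_integral_add) (auto simp: nn_integral_cmult)
  also have "(\<integral>\<^sup>+r. \<integral>\<^sup>+\<xi>. indicator {0..} r * ennreal (exp (l * r)) * ennreal ((g r \<xi>)\<^sup>2 * (norm (L2_rep X \<xi>))\<^sup>2) \<partial>lborel \<partial>lborel)
      = (\<integral>\<^sup>+\<xi>. \<integral>\<^sup>+r. indicator {0..} r * ennreal (exp (l * r)) * ennreal ((g r \<xi>)\<^sup>2 * (norm (L2_rep X \<xi>))\<^sup>2) \<partial>lborel \<partial>lborel)"
    unfolding g_def indicator_def atLeast_iff by (rule lborel_pair.Fubini'[symmetric]) measurable
  also have "\<dots> \<le> (\<integral>\<^sup>+\<xi>. ennreal (1 / l) * ennreal ((norm (L2_rep X \<xi>))\<^sup>2) \<partial>lborel)"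
  proof (rule nn_integral_mono)
    fix \<xi> :: real
    show "(\<integral>\<^sup>+r. indicator {0..} r * ennreal (exp (l * r)) * ennreal ((g r \<xi>)\<^sup>2 * (norm (L2_rep X \<xi>))\<^sup>2) \<partial>lborel)
        \<le> ennreal (1 / l) * ennreal ((norm (L2_rep X \<xi>))\<^sup>2)"
    proof (cases "0 < \<xi>")
      case True
      have "(\<integral>\<^sup>+r. indicator {0..} r * ennreal (exp (l * r)) * ennreal ((g r \<xi>)\<^sup>2 * (norm (L2_rep X \<xi>))\<^sup>2) \<partial>lborel)
          \<le> (\<integral>\<^sup>+r. ennreal (exp (l * r)) * indicator {0..\<xi>} r * ennreal (exp (- l * \<xi>) * (norm (L2_rep X \<xi>))\<^sup>2) \<partial>lborel)"
      proof (intro nn_integral_mono)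
        fix r :: real
        have "(exp (- l * \<xi> / 2))\<^sup>2 = exp (- l * \<xi>)" by (simp add: power2_eq_square exp_add[symmetric])
        then have "(g r \<xi>)\<^sup>2 \<le> indicator {..\<xi>} r * exp (- l * \<xi>)"
          by (auto simp: g_def exp_weight_def power_mult_distrib indicator_def)
        then have "(g r \<xi>)\<^sup>2 * (norm (L2_rep X \<xi>))\<^sup>2 \<le> indicator {..\<xi>} r * exp (- l * \<xi>) * (norm (L2_rep X \<xi>))\<^sup>2"
          by (rule mult_right_mono) simp
        then show "indicator {0..} r * ennreal (exp (l * r)) * ennreal ((g r \<xi>)\<^sup>2 * (norm (L2_rep X \<xi>))\<^sup>2)
          \<le> ennreal (exp (l * r)) * indicator {0..\<xi>} r * ennreal (exp (- l * \<xi>) * (norm (L2_rep X \<xi>))\<^sup>2)"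
        proof (cases "r \<le> \<xi>")
          case False
          then show ?thesis by (simp add: g_def)
        qed (auto simp: indicator_def intro!: mult_left_mono ennreal_leI)
      qed
      also have "\<dots> = (\<integral>\<^sup>+r. ennreal (exp (l * r)) * indicator {0..\<xi>} r \<partial>lborel) * ennreal (exp (- l * \<xi>) * (norm (L2_rep X \<xi>))\<^sup>2)"
        by (rule nn_integral_multc) measurable
      also have "(\<integral>\<^sup>+r. ennreal (exp (l * r)) * indicator {0..\<xi>} r \<partial>lborel) = ennreal (exp (l * \<xi>) / l - exp (l * 0) / l)"
        using True l by (intro nn_integral_FTC_Icc[where F="\<lambda>r. exp (l * r) / l"])
          (auto intro!: derivative_eq_intros)
      also have "\<dots> \<le> ennreal (exp (l * \<xi>) / l)" using l by (intro ennreal_leI) simp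
      also have "ennreal (exp (l * \<xi>) / l) * ennreal (exp (- l * \<xi>) * (norm (L2_rep X \<xi>))\<^sup>2)
          = ennreal (1 / l) * ennreal ((norm (L2_rep X \<xi>))\<^sup>2)"
        using l by (simp add: ennreal_mult[symmetric] exp_minus field_simps)
      finally show ?thesis by (simp add: mult_right_mono)
    next
      case False
      then show ?thesis by (simp add: g_def exp_weight_def)
    qed
  qed
  also have "\<dots> = ennreal (1 / l) * ennreal ((norm X)\<^sup>2)"
    by (subst nn_integral_cmult) (simp_all add: nn_norm_L2_sq)
  finally have "ennreal ((norm X)\<^sup>2) \<le> ennreal (1 / (2 * l)) * ?A + ennreal (l / 2) * (ennreal (1 / l) * ennreal ((norm X)\<^sup>2))"
    by (simp add: add_left_mono mult_left_mono)
  also have "ennreal (l / 2) * (ennreal (1 / l) * ennreal ((norm X)\<^sup>2)) = ennreal ((norm X)\<^sup>2 / 2)"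
    using l by (simp add: ennreal_mult[symmetric])
  finally have le: "ennreal ((norm X)\<^sup>2) \<le> ennreal (1 / (2 * l)) * ?A + ennreal ((norm X)\<^sup>2 / 2)" .
  \<comment> \<open>The half of the left-hand side is absorbed when the integral on the right is
    finite; if it is infinite, the bound is trivial.\<close>
  show ?thesis
  proof (cases ?A)
    case (real a)
    then have "(norm X)\<^sup>2 \<le> 1 / (2 * l) * a + (norm X)\<^sup>2 / 2"
      using le l by (simp add: ennreal_mult[symmetric] ennreal_plus[symmetric] del: ennreal_plus)
    then have "(norm X)\<^sup>2 \<le> 1 / l * a" using l by (simp add: field_simps)
    then show ?thesis unfolding real(2) X_def[symmetric] using l real(1)
      by (simp add: ennreal_mult[symmetric])
  next
    case top
    then show ?thesis using l by (simp add: ennreal_mult_top)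
  qed
qed

subsection \<open>The deterministic equation\<close>

text \<open>Finitely many halvings in \<open>N\<close> beat the comparison constant, so an iterate
  of \<open>F\<close> contracts for \<open>dist\<close> and Banach's theorem applies to it. Its
  unique fixed point is also fixed by \<open>F\<close>, because \<open>F\<close> commutes with its
  iterates, and every fixed point of \<open>F\<close> is one of the iterate. \<open>N\<close> need
  not satisfy a triangle inequality.\<close>

lemma fixpoint_equivalent_distance:
  fixes F :: "'a::complete_space \<Rightarrow> 'a"
  assumes S: "closed S" "S \<noteq> {}" "F ` S \<subseteq> S"
    and N0: "\<And>x y. x \<in> S \<Longrightarrow> y \<in> S \<Longrightarrow> (0::real) \<le> N x y"
    and N: "\<And>x y. x \<in> S \<Longrightarrow> y \<in> S \<Longrightarrow> N x y \<le> dist x y"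
      "\<And>x y. x \<in> S \<Longrightarrow> y \<in> S \<Longrightarrow> dist x y \<le> c * N x y"
    and contr: "\<And>x y. x \<in> S \<Longrightarrow> y \<in> S \<Longrightarrow> N (F x) (F y) \<le> 1 / 2 * N x y"
  shows "\<exists>!x\<in>S. F x = x"
proof -
  define c' where "c' = max 1 c"
  \<comment> \<open>Chosen so that the comparison constant times (1/2)^n is below 1/2.\<close>
  obtain n where n: "c' < 2 ^ n * (1 / 2)"
  proof -
    obtain n where "2 * c' < 2 ^ n" using real_arch_pow[of 2 "2 * c'"] by auto
    then show ?thesis using that[of n] by simp
  qed
  have it: "(F ^^ m) x \<in> S" if "x \<in> S" for m x
    using that S(3) by (induction m) auto
  have Nit: "N ((F ^^ m) x) ((F ^^ m) y) \<le> (1 / 2) ^ m * N x y" if "x \<in> S" "y \<in> S" for m x y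
  proof (induction m)
    case (Suc m)
    have "N ((F ^^ Suc m) x) ((F ^^ Suc m) y) \<le> 1 / 2 * N ((F ^^ m) x) ((F ^^ m) y)"
      using contr[OF it it, OF that] by simp
    then show ?case using Suc by simp
  qed simp
  have "\<exists>!x\<in>S. (F ^^ n) x = x"
  proof (rule Banach_fix[OF complete_eq_closed[THEN iffD2, OF S(1)] S(2), where c="1/2"])
    show "(F ^^ n) ` S \<subseteq> S" using it by blast
    fix x y assume xy: "x \<in> S" "y \<in> S"
    have c: "dist x' y' \<le> c' * N x' y'" if "x' \<in> S" "y' \<in> S" for x' y'
      using N(2)[OF that] mult_right_mono[OF max.cobounded2 N0[OF that], of c 1]
      by (simp add: c'_def)
    have "dist ((F ^^ n) x) ((F ^^ n) y) \<le> c' * N ((F ^^ n) x) ((F ^^ n) y)"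
      using c[OF it it] xy by blast
    also have "\<dots> \<le> c' * ((1 / 2) ^ n * N x y)"
      using Nit[OF xy] by (intro mult_left_mono) (auto simp: c'_def)
    also have "\<dots> \<le> c' * ((1 / 2) ^ n * dist x y)"
      using N(1)[OF xy] by (intro mult_left_mono) (auto simp: c'_def)
    also have "\<dots> \<le> 1 / 2 * dist x y"
      using n mult_right_mono[of c' "2 ^ n * (1 / 2)" "dist x y / 2 ^ n"] by (simp add: field_simps)
    finally show "dist ((F ^^ n) x) ((F ^^ n) y) \<le> 1 / 2 * dist x y" .
  qed simp_all
  then obtain x where x: "x \<in> S" "(F ^^ n) x = x" "\<And>y. y \<in> S \<Longrightarrow> (F ^^ n) y = y \<Longrightarrow> y = x" by blast
  have "(F ^^ n) (F x) = F x" using x(2) by (metis funpow_swap1)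
  then have "F x = x" using x S(3) by blast
  moreover have "y = x" if "y \<in> S" "F y = y" for y
  proof -
    have "(F ^^ m) y = y" for m using that(2) by (induction m) auto
    then show ?thesis using x(3) that(1) by blast
  qed
  ultimately show ?thesis using x(1) by blast
qed

section \<open>The contraction estimate and the deterministic solution map\<close>

context volterra_drift
begin

text \<open>The weighted square of the integrated drift picks up the factor C^2 /
  \<open>rate\<close>, which this choice makes 1/4; the norm then contracts by 1/2.\<close>

definition rate :: real where "rate = 4 * C\<^sup>2"

lemma rate_pos: "0 < rate"
  using C_pos by (simp add: rate_def)

abbreviation wnorm :: "'d Hspace \<Rightarrow> real" where
  "wnorm f \<equiv> norm (L2_mult (exp_weight T rate) f)"

text \<open>The average over \<tau> runs over the whole line, so the localised bound is needed for
  every real \<open>t\<close>. Before 0 the strip misses the square, and beyond \<open>T\<close> the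
  cut is the identity on \<open>H\<close>.\<close>

lemma drift_past_le:
  assumes v: "v \<in> H" and w: "w \<in> H"
  shows "norm (L2_cut (past t) (G v - G w)) \<le> C * norm (L2_cut {..<t} (v - w))"
proof -
  have vw: "v - w \<in> H" "G v - G w \<in> Q"
    using v w drift_ext_props(2) by (auto intro!: subspace_diff[OF subspace_L2_on] square_borel)
  consider "t \<le> 0" | "0 < t" "t \<le> T" | "T < t" by linarith
  then show ?thesis
  proof cases
    case 1
    have "L2_cut (past t) (G v - G w) = 0"
      unfolding L2_cut_eq_0_iff[OF past_borel]
      using vw(2) unfolding L2_on_def mem_Collect_eq
      by eventually_elim (use 1 in \<open>auto simp: past_def\<close>)
    then show ?thesis using C_pos by simp
  next
    case 2
    then show ?thesis using drift_causal_lipschitz[OF v w] by simp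
  next
    case 3
    have "L2_cut {..<t} (v - w) = L2_mult (\<lambda>x. 1) (v - w)"
      by (rule L2_mult_cong[OF multiplier_indicator multiplier_one])
         (use vw(1) 3 in \<open>auto simp: L2_on_def indicator_def elim!: eventually_mono\<close>)
    moreover have "norm (L2_cut (past t) (G v - G w)) \<le> 1 * norm (G v - G w)"
      by (rule norm_L2_mult_bound[OF multiplier_indicator[OF past_borel]])
    ultimately show ?thesis using drift_lipschitz[OF v w] by simp
  qed
qed

text \<open>Two estimates are chained: the Volterra property gains 1 / \<open>rate\<close> when the
  slices are integrated, and the cumulative Lipschitz bound costs C^2 for the weighted norm of the
  slices.\<close>

lemma slice_int_drift_contraction:
  assumes v: "v \<in> H" and w: "w \<in> H" and s: "0 \<le> s"
  shows "wnorm (slice_int s t (G v) - slice_int s t (G w)) \<le> 1 / 2 * wnorm (v - w)"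
proof -
  define D where "D = G v - G w"
  have "AE z in lborel. snd z < fst z \<longrightarrow> L2_rep D z = 0"
    using drift_volterra[OF v] drift_volterra[OF w] L2_rep_diff[of "G v" "G w"]
    unfolding D_def by eventually_elim auto
  from exp_weight_slice_int[OF rate_pos s this, of T t]
  have "ennreal ((wnorm (slice_int s t D))\<^sup>2)
    \<le> ennreal (1 / rate) * (\<integral>\<^sup>+r. ennreal (exp (- rate * r)) * ennreal ((norm (L2_slice D r))\<^sup>2) \<partial>lborel)" .
  also have "(\<integral>\<^sup>+r. ennreal (exp (- rate * r)) * ennreal ((norm (L2_slice D r))\<^sup>2) \<partial>lborel)
      \<le> ennreal (C\<^sup>2) * (\<integral>\<^sup>+x. ennreal (exp (- rate * x)) * ennreal ((norm (L2_rep (v - w) x))\<^sup>2) \<partial>lborel)"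
  proof (rule nn_integral_exp_weight_mono[OF _ _ rate_pos])
    fix t
    have "(\<integral>\<^sup>+x. indicator {..<t} x * ennreal ((norm (L2_slice D x))\<^sup>2) \<partial>lborel)
        = ennreal ((norm (L2_cut (past t) D))\<^sup>2)"
      unfolding past_def by (rule nn_integral_norm_slice_cut) simp
    also have "\<dots> \<le> ennreal ((C * norm (L2_cut {..<t} (v - w)))\<^sup>2)"
      unfolding D_def by (intro ennreal_leI power_mono drift_past_le v w) simp
    also have "\<dots> = ennreal (C\<^sup>2) * ennreal ((norm (L2_cut {..<t} (v - w)))\<^sup>2)"
      by (simp add: power_mult_distrib ennreal_mult)
    also have "ennreal ((norm (L2_cut {..<t} (v - w)))\<^sup>2)
        = (\<integral>\<^sup>+x. indicator {..<t} x * ennreal ((norm (L2_rep (v - w) x))\<^sup>2) \<partial>lborel)"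
      by (subst norm_L2_mult[OF multiplier_indicator]) (auto intro!: nn_integral_cong simp: indicator_def)
    finally show "(\<integral>\<^sup>+x. indicator {..<t} x * ennreal ((norm (L2_slice D x))\<^sup>2) \<partial>lborel)
      \<le> ennreal (C\<^sup>2) * (\<integral>\<^sup>+x. indicator {..<t} x * ennreal ((norm (L2_rep (v - w) x))\<^sup>2) \<partial>lborel)" .
  qed measurable
  also have "(\<integral>\<^sup>+x. ennreal (exp (- rate * x)) * ennreal ((norm (L2_rep (v - w) x))\<^sup>2) \<partial>lborel)
      = ennreal ((wnorm (v - w))\<^sup>2)"
  proof -
    have "v - w \<in> H" using v w by (intro subspace_diff[OF subspace_L2_on]) auto
    then have "AE x in lborel. x \<notin> {0<..<T} \<longrightarrow> L2_rep (v - w) x = 0" by (simp add: L2_on_def)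
    moreover have "(exp (- rate * x / 2))\<^sup>2 = exp (- rate * x)" for x
      by (simp add: power2_eq_square exp_add[symmetric])
    ultimately show ?thesis
      unfolding norm_L2_mult[OF multiplier_exp_weight[OF less_imp_le[OF rate_pos]]]
      by (intro nn_integral_cong_AE, elim eventually_mono)
         (auto simp: exp_weight_def power_mult_distrib indicator_def ennreal_mult)
  qed
  also have "ennreal (1 / rate) * (ennreal (C\<^sup>2) * ennreal ((wnorm (v - w))\<^sup>2))
      = ennreal ((1 / 2 * wnorm (v - w))\<^sup>2)"
    using C_pos by (simp add: ennreal_mult[symmetric] rate_def power_mult_distrib power2_eq_square)
  finally have "(wnorm (slice_int s t D))\<^sup>2 \<le> (1 / 2 * wnorm (v - w))\<^sup>2"
    by (simp add: mult_left_mono)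
  then have "wnorm (slice_int s t D) \<le> 1 / 2 * wnorm (v - w)" by (rule power2_le_imp_le) simp
  then show ?thesis by (simp add: D_def slice_int_diff)
qed

lemma slice_drift_mem:
  assumes "w \<in> H"
  shows "AE r in lborel. L2_slice (G w) r \<in> L2_on ({0<..<T} \<inter> {r..})"
  using AE_lborel_pair[OF drift_ext_props(2)[OF assms, unfolded L2_on_def mem_Collect_eq]]
    AE_lborel_pair[OF drift_volterra[OF assms]] L2_rep_slice[of "G w"]
proof eventually_elim
  case (elim r)
  show ?case
    unfolding L2_on_def mem_Collect_eq using elim by eventually_elim auto
qed

text \<open>Slices at times r >= s live on \<xi> >= r. For the cocycle property this means that
  drift integrated from \<open>u\<close> onwards leaves a solution unchanged before
  \<open>u\<close>.\<close>

lemma slice_int_drift_mem: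
  assumes "w \<in> H"
  shows "slice_int s t (G w) \<in> L2_on ({0<..<T} \<inter> {s..})"
proof (rule slice_int_mem)
  show "AE r in lborel. r \<in> {s..t} \<longrightarrow> L2_slice (G w) r \<in> L2_on ({0<..<T} \<inter> {s..})"
    using slice_drift_mem[OF assms]
  proof eventually_elim
    case (elim r)
    show ?case
    proof
      assume "r \<in> {s..t}"
      with elim show "L2_slice (G w) r \<in> L2_on ({0<..<T} \<inter> {s..})"
        by (auto simp: L2_on_def elim!: eventually_mono)
    qed
  qed
qed simp

lemma slice_int_drift_in_H: "w \<in> H \<Longrightarrow> slice_int s t (G w) \<in> H"
  using slice_int_drift_mem[of w s t] L2_on_mono[of "{0<..<T} \<inter> {s..}" "{0<..<T}"] by blast

lemma H_add: "v \<in> H \<Longrightarrow> w \<in> H \<Longrightarrow> v + w \<in> H"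
  by (intro subspace_add[OF subspace_L2_on]) auto

lemma H_diff: "v \<in> H \<Longrightarrow> w \<in> H \<Longrightarrow> v - w \<in> H"
  by (intro subspace_diff[OF subspace_L2_on]) auto

lemma wnorm_diff: "wnorm (v - w) \<le> wnorm (v - u) + wnorm (u - w)"
  using norm_triangle_ineq[of "L2_mult (exp_weight T rate) (v - u)" "L2_mult (exp_weight T rate) (u - w)"]
  by (simp add: L2_mult_add[OF multiplier_exp_weight, symmetric] less_imp_le[OF rate_pos])

lemma wnorm_le: "wnorm v \<le> norm v"
  using norm_L2_mult_bound[OF multiplier_exp_weight[OF less_imp_le[OF rate_pos]], of T v] by simp

lemma deterministic_solution_unique:
  assumes "\<eta> \<in> H" "0 \<le> s"
  shows "\<exists>!w\<in>H. \<eta> + slice_int s t (G w) = w"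
proof (rule fixpoint_equivalent_distance)
  show "closed H" by (rule closed_L2_on) simp
  show "H \<noteq> {}" using assms by blast
  show "(\<lambda>w. \<eta> + slice_int s t (G w)) ` H \<subseteq> H"
    using assms by (auto intro: H_add slice_int_drift_in_H)
  fix x y assume "x \<in> H" "y \<in> H"
  then show "0 \<le> wnorm (x - y)" "wnorm (x - y) \<le> dist x y"
    "dist x y \<le> exp (rate * T / 2) * wnorm (x - y)"
    "wnorm ((\<eta> + slice_int s t (G x)) - (\<eta> + slice_int s t (G y))) \<le> 1 / 2 * wnorm (x - y)"
    using wnorm_le[of "x - y"] norm_le_exp_weight[of rate "x - y" T] rate_pos
      slice_int_drift_contraction[of x y s t] assms
    by (auto simp: dist_norm H_diff)
qed

definition sol :: "real \<Rightarrow> real \<Rightarrow> 'd Hspace \<Rightarrow> 'd Hspace" where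
  "sol s t \<eta> = (THE w. w \<in> H \<and> \<eta> + slice_int s t (G w) = w)"

lemma sol:
  assumes "\<eta> \<in> H" "0 \<le> s"
  shows "sol s t \<eta> \<in> H" "\<eta> + slice_int s t (G (sol s t \<eta>)) = sol s t \<eta>"
    "w \<in> H \<Longrightarrow> \<eta> + slice_int s t (G w) = w \<Longrightarrow> w = sol s t \<eta>"
proof -
  have ex1: "\<exists>!w. w \<in> H \<and> \<eta> + slice_int s t (G w) = w"
    using deterministic_solution_unique[OF assms] by blast
  from theI'[OF this] show "sol s t \<eta> \<in> H" "\<eta> + slice_int s t (G (sol s t \<eta>)) = sol s t \<eta>"
    unfolding sol_def by auto
  then show "w \<in> H \<Longrightarrow> \<eta> + slice_int s t (G w) = w \<Longrightarrow> w = sol s t \<eta>" using ex1 by blast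
qed

text \<open>In the difference of the two equations the drift contributes at most half of the
  weighted distance, which is absorbed; this gives the factor 2. The exponential comes from
  returning to the unweighted norm.\<close>

lemma sol_lipschitz:
  assumes "\<eta> \<in> H" "\<zeta> \<in> H" "0 \<le> s"
  shows "norm (sol s t \<eta> - sol s t \<zeta>) \<le> 2 * exp (rate * T / 2) * norm (\<eta> - \<zeta>)"
proof -
  define v w where "v = sol s t \<eta>" and "w = sol s t \<zeta>"
  have vw: "v \<in> H" "w \<in> H" "\<eta> + slice_int s t (G v) = v" "\<zeta> + slice_int s t (G w) = w"
    unfolding v_def w_def using sol assms by auto
  have "v - w = (\<eta> - \<zeta>) - (slice_int s t (G w) - slice_int s t (G v))"
    by (subst (1) vw(3)[symmetric], subst (1) vw(4)[symmetric]) simp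
  then have "wnorm (v - w) \<le> wnorm ((\<eta> - \<zeta>) - 0) + wnorm (0 - (slice_int s t (G w) - slice_int s t (G v)))"
    by (simp only:) (rule wnorm_diff)
  also have "\<dots> = wnorm (\<eta> - \<zeta>) + wnorm (slice_int s t (G v) - slice_int s t (G w))" by simp
  also have "\<dots> \<le> norm (\<eta> - \<zeta>) + 1 / 2 * wnorm (v - w)"
    using slice_int_drift_contraction[OF vw(1,2) assms(3)] wnorm_le by (intro add_mono)
  finally have "wnorm (v - w) \<le> 2 * norm (\<eta> - \<zeta>)" by simp
  moreover have "norm (v - w) \<le> exp (rate * T / 2) * wnorm (v - w)"
    using norm_le_exp_weight[of rate "v - w" T] rate_pos H_diff[OF vw(1,2)] by simp
  ultimately have "norm (v - w) \<le> exp (rate * T / 2) * (2 * norm (\<eta> - \<zeta>))"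
    by (meson exp_ge_zero mult_left_mono order_trans)
  then show ?thesis by (simp add: v_def w_def mult_ac)
qed

text \<open>Used for each \<omega>, it bounds powers of the solution by powers of the initial value
  and of the stochastic integral.\<close>

lemma sol_growth: "\<exists>K\<ge>0. \<forall>\<eta>\<in>H. norm (sol s t \<eta>) \<le> K * (1 + norm \<eta>)" if "0 \<le> s"
proof -
  have 0: "0 \<in> H" by (intro subspace_0[OF subspace_L2_on]) auto
  define K where "K = norm (sol s t 0) + 2 * exp (rate * T / 2)"
  have "norm (sol s t \<eta>) \<le> K * (1 + norm \<eta>)" if "\<eta> \<in> H" for \<eta>
  proof -
    have "norm (sol s t \<eta>) \<le> norm (sol s t 0) + norm (sol s t \<eta> - sol s t 0)"
      using norm_triangle_ineq[of "sol s t 0" "sol s t \<eta> - sol s t 0"] by simp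
    also have "\<dots> \<le> norm (sol s t 0) + 2 * exp (rate * T / 2) * norm \<eta>"
      using sol_lipschitz[OF that 0 \<open>0 \<le> s\<close>] by simp
    also have "\<dots> \<le> K * (1 + norm \<eta>)"
      unfolding K_def by (simp add: algebra_simps)
    finally show ?thesis .
  qed
  then show ?thesis by (intro exI[of _ K]) (simp add: K_def)
qed

text \<open>\<open>sol\<close> is specified on \<open>H\<close> only, and the stochastic integral
  lies in \<open>H\<close> only almost surely. Lipschitz on the closed set \<open>H\<close> and 0
  elsewhere, the cut-off map is Borel on the whole space and can be composed with any measurable
  input.\<close>

lemma measurable_sol_cut:
  assumes "0 \<le> s"
  shows "(\<lambda>\<eta>. indicator H \<eta> *\<^sub>R sol s t \<eta>) \<in> borel_measurable borel"
proof (rule borel_measurable_continuous_on_indicator)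
  show "H \<in> sets borel" by (rule borel_closed, rule closed_L2_on) simp
  have "(2 * exp (rate * T / 2))-lipschitz_on H (sol s t)"
    using sol_lipschitz[OF _ _ assms] by (auto simp: lipschitz_on_def dist_norm)
  then show "continuous_on H (sol s t)" by (rule lipschitz_on_continuous_on)
qed

text \<open>Restarting at time \<open>u\<close>: the part of the drift before \<open>u\<close> only sees the solution before \<open>u\<close>,
  which is not changed after \<open>u\<close>.\<close>

lemma sol_cocycle:
  assumes su: "0 \<le> s" "s \<le> u" "u \<le> t" "t \<le> T"
    and \<phi>: "\<phi> \<in> H" and I1: "I1 \<in> H" and I2: "I2 \<in> H" "L2_cut {..<u} I2 = 0"
    and wu: "wu \<in> H" "\<phi> + slice_int s u (G wu) + I1 = wu"
    and v: "v \<in> H" "wu + slice_int u t (G v) + I2 = v"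
  shows "v = \<phi> + slice_int s t (G v) + (I1 + I2)"
proof -
  have "slice_int s u (G wu) = slice_int s u (G v)"
  proof (cases "0 < u")
    case True
    \<comment> \<open>Neither the drift after \<open>u\<close> nor \<open>I2\<close> is seen before
      \<open>u\<close>, so \<open>wu\<close> and \<open>v\<close> agree there and causality
      identifies their drifts.\<close>
    have "L2_cut {..<u} (slice_int u t (G v)) = 0"
      using slice_int_drift_mem[OF v(1), of u t]
      by (auto simp: L2_cut_eq_0_iff L2_on_def elim!: eventually_mono)
    then have "L2_cut {..<u} wu = L2_cut {..<u} v"
      by (subst v(2)[symmetric]) (simp add: L2_mult_add[OF multiplier_indicator] I2(2))
    then have eq: "L2_cut (past u) (G wu) = L2_cut (past u) (G v)"
      using drift_causal[OF wu(1), of u] drift_causal[OF v(1), of u] True su by simp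
    have "AE z in lborel. fst z \<in> {..<u} \<longrightarrow> L2_rep (G wu) z = L2_rep (G v) z"
      using L2_rep_mult[OF multiplier_indicator[OF past_borel], of u "G wu"]
        L2_rep_mult[OF multiplier_indicator[OF past_borel], of u "G v"] unfolding eq
      by eventually_elim (auto simp: past_def mem_Times_iff indicator_def)
    from L2_slice_cong[OF this] AE_lborel_singleton[of u]
    have "AE r in lborel. r \<in> {s..u} \<longrightarrow> L2_slice (G wu) r = L2_slice (G v) r"
      by eventually_elim auto
    then show ?thesis by (rule slice_int_cong)
  next
    \<comment> \<open>Causality is available for positive times only; here s = u = 0 and the
      interval is a null set.\<close>
    case False
    then have su_eq: "s = u" using su by simp
    have "AE r in lborel. r \<in> {s..u} \<longrightarrow> L2_slice (G wu) r = L2_slice (G v) r"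
      using AE_lborel_singleton[of u] by eventually_elim (simp add: su_eq)
    then show ?thesis by (rule slice_int_cong)
  qed
  then have "v = \<phi> + slice_int s u (G v) + I1 + slice_int u t (G v) + I2"
    using wu(2) v(2) by simp
  then show ?thesis using slice_int_split[OF su(2,3), of "G v"] by (simp add: ac_simps)
qed

end

subsection \<open>The hyperbolic cosine of a norm\<close>

text \<open>The equal sums give u - V = U - v and u, v <= U. After factoring out this common
  difference, the remaining geometric sums compare term by term.\<close>

lemma power_sum_majorization:
  fixes u v U V :: real
  assumes "u + v = U + V" "0 \<le> V" "V \<le> u" "V \<le> v"
  shows "u ^ k + v ^ k \<le> U ^ k + V ^ k"
proof -
  have "u ^ k - V ^ k = (u - V) * (\<Sum>i<k. V ^ (k - Suc i) * u ^ i)"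
    by (rule power_diff_sumr2)
  also have "\<dots> \<le> (u - V) * (\<Sum>i<k. v ^ (k - Suc i) * U ^ i)"
    using assms by (intro mult_left_mono sum_mono mult_mono power_mono) auto
  also have "\<dots> = U ^ k - v ^ k"
  proof -
    have "u - V = U - v" using assms(1) by simp
    then show ?thesis using power_diff_sumr2[of U k v] by simp
  qed
  finally show ?thesis by simp
qed

text \<open>cosh is a power series in the square of its argument with nonnegative coefficients, so
  the comparison of powers sums up. The hypotheses concern squares because \<open>Q\<close> may be
  negative.\<close>

lemma cosh_majorization:
  fixes p q P Q :: real
  assumes "p\<^sup>2 + q\<^sup>2 = P\<^sup>2 + Q\<^sup>2" "Q\<^sup>2 \<le> p\<^sup>2" "Q\<^sup>2 \<le> q\<^sup>2"
  shows "cosh p + cosh q \<le> cosh P + cosh Q"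
proof (rule sums_le[OF _ sums_add[OF cosh_converges cosh_converges] sums_add[OF cosh_converges cosh_converges]])
  fix n
  show "(if even n then p ^ n /\<^sub>R fact n else 0) + (if even n then q ^ n /\<^sub>R fact n else 0)
      \<le> (if even n then P ^ n /\<^sub>R fact n else 0) + (if even n then Q ^ n /\<^sub>R fact n else 0)"
  proof (cases "even n")
    case True
    then obtain k where n: "n = 2 * k" by (rule evenE)
    have "p ^ n + q ^ n \<le> P ^ n + Q ^ n"
      using power_sum_majorization[of "p\<^sup>2" "q\<^sup>2" "P\<^sup>2" "Q\<^sup>2" k] assms by (simp add: n power_mult)
    then have "inverse (fact n) * (p ^ n + q ^ n) \<le> inverse (fact n) * (P ^ n + Q ^ n)"
      by (rule mult_left_mono) simp
    then show ?thesis using True by (simp only: distrib_left if_True real_scaleR_def)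
  qed simp
qed

text \<open>The function \<open>cosh \<circ> norm\<close> replaces exponential moments in directions: for symmetric
  increments it is submultiplicative in any inner product space.\<close>

lemma cosh_norm_parallelogram:
  fixes x y :: "'a::real_inner"
  shows "cosh (norm (x + y)) + cosh (norm (x - y)) \<le> 2 * (cosh (norm x) * cosh (norm y))"
proof -
  have "(norm x - norm y)\<^sup>2 \<le> (norm (x - y))\<^sup>2"
    using norm_triangle_ineq3[of x y] by (rule power2_le_iff_abs_le[THEN iffD2, rotated]) simp
  moreover have "(norm x - norm y)\<^sup>2 \<le> (norm (x + y))\<^sup>2"
    using norm_triangle_ineq3[of x "- y"] by (intro power2_le_iff_abs_le[THEN iffD2]) simp_all
  \<comment> \<open>By the parallelogram law the squares have equal sums, and by the two bounds
    above the smallest one is that of \<open>norm x - norm y\<close>.\<close>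
  moreover have "(norm (x + y))\<^sup>2 + (norm (x - y))\<^sup>2 = (norm x + norm y)\<^sup>2 + (norm x - norm y)\<^sup>2"
    by (simp add: power2_norm_eq_inner inner_add inner_diff power2_sum power2_diff inner_commute)
  ultimately have "cosh (norm (x + y)) + cosh (norm (x - y)) \<le> cosh (norm x + norm y) + cosh (norm x - norm y)"
    by (intro cosh_majorization)
  also have "\<dots> = 2 * (cosh (norm x) * cosh (norm y))" by (simp add: cosh_add cosh_diff)
  finally show ?thesis .
qed

text \<open>From (1 + x/n)^n <= exp x one gets x^n <= n^n exp x, and exp x <= 2 cosh x. The summand
  1 covers x < 1, where lowering the exponent does not decrease the power.\<close>

lemma powr_le_cosh:
  assumes "0 < (q::real)"
  shows "\<exists>K\<ge>0. \<forall>x\<ge>0. x powr q \<le> K * cosh x"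
proof -
  obtain n where n: "q \<le> real n" using real_arch_simple by blast
  then have n0: "n > 0" using assms by (cases n) auto
  have "x powr q \<le> (1 + 2 * real n ^ n) * cosh x" if x: "0 \<le> x" for x
  proof -
    have "x ^ n / real n ^ n = (x / real n) ^ n" by (simp add: power_divide)
    also have "\<dots> \<le> (1 + x / real n) ^ n" using x by (intro power_mono) auto
    also have "\<dots> \<le> exp x" using exp_ge_one_plus_x_over_n_power_n[of n x] n0 x by simp
    finally have "x ^ n \<le> real n ^ n * exp x" using n0 by (simp add: field_simps)
    also have "\<dots> \<le> real n ^ n * (2 * cosh x)" by (intro mult_left_mono) (auto simp: cosh_def)
    finally have p: "x ^ n \<le> 2 * real n ^ n * cosh x" by (simp add: mult_ac)
    have "x powr q \<le> 1 + x ^ n"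
    proof (cases "1 \<le> x")
      case True
      then have "x powr q \<le> x powr real n" using n by (intro powr_mono)
      then show ?thesis using True by (simp add: powr_realpow)
    next
      case False
      then have "x powr q \<le> 1" using x assms by (simp add: powr_le1)
      moreover have "0 \<le> x ^ n" using x by simp
      ultimately show ?thesis by linarith
    qed
    also have "\<dots> \<le> cosh x + 2 * real n ^ n * cosh x" using p by (intro add_mono cosh_real_ge_1)
    finally show ?thesis by (simp add: algebra_simps)
  qed
  then show ?thesis by (intro exI[of _ "1 + 2 * real n ^ n"]) auto
qed

lemma convex_on_cosh: "convex_on UNIV (cosh :: real \<Rightarrow> real)"
  by (rule f''_ge0_imp_convex[where f'=sinh and f''=cosh]) (auto intro!: derivative_eq_intros)

text \<open>Completing the square turns the integrand into a shifted normal density times the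
  asserted constant.\<close>

lemma nn_integral_normal_density_exp:
  assumes s: "0 < \<sigma>"
  shows "(\<integral>\<^sup>+x. ennreal (normal_density 0 \<sigma> x) * ennreal (exp (c * x)) \<partial>lborel) = ennreal (exp (c\<^sup>2 * \<sigma>\<^sup>2 / 2))"
proof -
  have "normal_density 0 \<sigma> x * exp (c * x) = exp (c\<^sup>2 * \<sigma>\<^sup>2 / 2) * normal_density (c * \<sigma>\<^sup>2) \<sigma> x" for x
  proof -
    have "- (x\<^sup>2 / (2 * \<sigma>\<^sup>2)) + c * x = c\<^sup>2 * \<sigma>\<^sup>2 / 2 + - ((x - c * \<sigma>\<^sup>2)\<^sup>2 / (2 * \<sigma>\<^sup>2))"
      using s by (simp add: field_simps power2_eq_square)
    then have "exp (- (x\<^sup>2 / (2 * \<sigma>\<^sup>2))) * exp (c * x) = exp (c\<^sup>2 * \<sigma>\<^sup>2 / 2) * exp (- ((x - c * \<sigma>\<^sup>2)\<^sup>2 / (2 * \<sigma>\<^sup>2)))"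
      by (simp only: exp_add[symmetric])
    then show ?thesis by (simp add: normal_density_def mult_ac)
  qed
  then have "(\<integral>\<^sup>+x. ennreal (normal_density 0 \<sigma> x) * ennreal (exp (c * x)) \<partial>lborel)
      = (\<integral>\<^sup>+x. ennreal (exp (c\<^sup>2 * \<sigma>\<^sup>2 / 2)) * ennreal (normal_density (c * \<sigma>\<^sup>2) \<sigma> x) \<partial>lborel)"
    by (simp add: ennreal_mult[symmetric])
  also have "\<dots> = ennreal (exp (c\<^sup>2 * \<sigma>\<^sup>2 / 2)) * (\<integral>\<^sup>+x. ennreal (normal_density (c * \<sigma>\<^sup>2) \<sigma> x) \<partial>lborel)"
    by (rule nn_integral_cmult) measurable
  also have "(\<integral>\<^sup>+x. ennreal (normal_density (c * \<sigma>\<^sup>2) \<sigma> x) \<partial>lborel) = 1"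
    using s by (subst nn_integral_eq_integral) auto
  finally show ?thesis by simp
qed

subsection \<open>Increments of Brownian motion\<close>

locale brownian = prob_space M
  for M :: "'w measure" and F :: "real \<Rightarrow> 'w measure" and T :: real and W :: "real \<Rightarrow> 'w \<Rightarrow> real ^ 'd" +
  assumes usual: "usual_filtered_space M F T"
    and brownian: "brownian_motion M F T W"
begin

lemma subalgebra_F: "0 \<le> t \<Longrightarrow> t \<le> T \<Longrightarrow> subalgebra M (F t)"
  using usual by (auto simp: usual_filtered_space_def)

lemma F_mono: "0 \<le> s \<Longrightarrow> s \<le> t \<Longrightarrow> t \<le> T \<Longrightarrow> subalgebra (F t) (F s)"
  using usual subalgebra_F[of s] subalgebra_F[of t]
  by (auto simp: usual_filtered_space_def subalgebra_def)

lemmas measurable_F_mono = measurable_from_subalg[OF F_mono]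
lemmas measurable_F_M = measurable_from_subalg[OF subalgebra_F]

definition inc :: "real \<Rightarrow> real \<Rightarrow> 'w \<Rightarrow> real ^ 'd" where "inc a b \<omega> = W b \<omega> - W a \<omega>"

lemma inc_self [simp]: "inc a a = (\<lambda>\<omega>. 0)"
  by (simp add: inc_def fun_eq_iff)

lemma measurable_W: "0 \<le> t \<Longrightarrow> t \<le> T \<Longrightarrow> W t \<in> borel_measurable (F t)"
  using brownian by (auto simp: brownian_motion_def)

lemma measurable_inc: "0 \<le> a \<Longrightarrow> a \<le> b \<Longrightarrow> b \<le> T \<Longrightarrow> inc a b \<in> borel_measurable (F b)"
  unfolding inc_def[abs_def]
  by (intro borel_measurable_diff measurable_W measurable_F_mono[of a b]) auto

lemma measurable_inc_M: "0 \<le> a \<Longrightarrow> a \<le> b \<Longrightarrow> b \<le> T \<Longrightarrow> inc a b \<in> borel_measurable M"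
  by (rule measurable_F_M[OF _ _ measurable_inc]) auto

lemma inc_distributed:
  assumes "0 \<le> a" "a < b" "b \<le> T" "c \<in> Basis"
  shows "distributed M lborel (\<lambda>\<omega>. inc a b \<omega> \<bullet> c) (normal_density 0 (sqrt (b - a)))"
proof -
  obtain i where "c = axis i 1" using assms(4) by (auto simp: Basis_vec_def)
  then show ?thesis using brownian assms by (simp add: brownian_motion_def inc_def inner_axis)
qed

lemma inc_components_indep:
  assumes "0 \<le> a" "a < b" "b \<le> T" "c \<in> Basis" "d \<in> Basis" "c \<noteq> d"
  shows "indep_var borel (\<lambda>\<omega>. inc a b \<omega> \<bullet> c) borel (\<lambda>\<omega>. inc a b \<omega> \<bullet> d)"
proof -
  obtain i j where ij: "c = axis i 1" "d = axis j 1" using assms(4,5) by (auto simp: Basis_vec_def)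
  have "indep_vars (\<lambda>_. borel) (\<lambda>i \<omega>. inc a b \<omega> $ i) UNIV"
    using brownian assms by (simp add: brownian_motion_def inc_def)
  moreover have "i \<noteq> j" using ij assms(6) by auto
  ultimately have "indep_var (Pi\<^sub>M {i} (\<lambda>_. borel)) (\<lambda>\<omega>. restrict (\<lambda>i. inc a b \<omega> $ i) {i})
      (Pi\<^sub>M {j} (\<lambda>_. borel)) (\<lambda>\<omega>. restrict (\<lambda>i. inc a b \<omega> $ i) {j})"
    by (intro indep_var_restrict[where I=UNIV]) auto
  from indep_var_compose[OF this, of "\<lambda>f. f i" borel "\<lambda>f. f j" borel]
  have "indep_var borel (\<lambda>\<omega>. inc a b \<omega> $ i) borel (\<lambda>\<omega>. inc a b \<omega> $ j)"
    by (simp add: o_def)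
  then show ?thesis by (simp add: ij inner_axis)
qed

lemma prob_Int_inc:
  assumes ab: "0 \<le> a" "a < b" "b \<le> T" and "A \<in> sets (F a)" "C \<in> sets borel"
  shows "prob (A \<inter> (inc a b -` C \<inter> space M)) = prob A * prob (inc a b -` C \<inter> space M)"
proof -
  have "indep_set (sets (F a)) {inc a b -` A \<inter> space M | A. A \<in> sets borel}"
    using brownian ab by (simp add: brownian_motion_def inc_def[abs_def])
  then show ?thesis using assms(4,5) unfolding indep_sets2_eq by blast
qed

text \<open>\<open>brownian_motion\<close> expresses independence of the past through families of
  events; moments of products need it for real random variables.\<close>

lemma indep_inc:
  fixes X :: "'w \<Rightarrow> real"
  assumes ab: "0 \<le> a" "a < b" "b \<le> T" and X: "X \<in> borel_measurable (F a)"
    and f: "f \<in> borel_measurable borel"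
  shows "indep_var borel X borel (\<lambda>\<omega>. f (inc a b \<omega>))"
proof -
  have sp: "space (F a) = space M" and sub: "sets (F a) \<subseteq> sets M"
    using subalgebra_F[of a] ab by (auto simp: subalgebra_def)
  have XM: "X \<in> borel_measurable M" using measurable_F_M[OF _ _ X] ab by simp
  have iM: "inc a b \<in> borel_measurable M" using measurable_inc_M ab by simp
  have fM: "(\<lambda>\<omega>. f (inc a b \<omega>)) \<in> borel_measurable M" using measurable_compose[OF iM f] .
  have 1: "sigma_sets (space M) {X -` A \<inter> space M | A. A \<in> sets borel} \<subseteq> sets (F a)"
    using X sets.sigma_sets_subset[of "{X -` A \<inter> space M | A. A \<in> sets borel}" "F a"]
    by (auto simp: sp[symmetric] intro: measurable_sets)
  have "sigma_sets (space M) {(\<lambda>\<omega>. f (inc a b \<omega>)) -` A \<inter> space M | A. A \<in> sets borel}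
      \<subseteq> sets (vimage_algebra (space M) (inc a b) borel)"
  proof (rule sets.sigma_sets_subset[of _ "vimage_algebra (space M) (inc a b) borel", unfolded space_vimage_algebra])
    show "{(\<lambda>\<omega>. f (inc a b \<omega>)) -` A \<inter> space M | A. A \<in> sets borel}
        \<subseteq> sets (vimage_algebra (space M) (inc a b) borel)"
    proof safe
      fix A :: "real set" assume "A \<in> sets borel"
      then have "f -` A \<in> sets borel" using measurable_sets[OF f] by simp
      moreover have "(\<lambda>\<omega>. f (inc a b \<omega>)) -` A \<inter> space M = inc a b -` (f -` A) \<inter> space M" by auto
      ultimately show "(\<lambda>\<omega>. f (inc a b \<omega>)) -` A \<inter> space M \<in> sets (vimage_algebra (space M) (inc a b) borel)"
        by (subst sets_vimage_algebra2) auto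
    qed
  qed
  \<comment> \<open>Every event generated by \<open>f\<close> of the increment is the preimage of a
    Borel set under the increment itself, to which the hypothesis applies.\<close>
  then have 2: "\<exists>C\<in>sets borel. D = inc a b -` C \<inter> space M"
    if "D \<in> sigma_sets (space M) {(\<lambda>\<omega>. f (inc a b \<omega>)) -` A \<inter> space M | A. A \<in> sets borel}" for D
    using that by (subst (asm) sets_vimage_algebra2) auto
  have 3: "prob (A \<inter> D) = prob A * prob D"
    if "A \<in> sigma_sets (space M) {X -` A \<inter> space M | A. A \<in> sets borel}"
      "D \<in> sigma_sets (space M) {(\<lambda>\<omega>. f (inc a b \<omega>)) -` A \<inter> space M | A. A \<in> sets borel}" for A D
    using 2[OF that(2)] prob_Int_inc[OF ab, of A] 1 that(1) by blast
  have 4: "sigma_sets (space M) {(\<lambda>\<omega>. f (inc a b \<omega>)) -` A \<inter> space M | A. A \<in> sets borel} \<subseteq> sets M"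
    using 2 measurable_sets[OF iM] by blast
  show ?thesis
    unfolding indep_var_eq indep_sets2_eq using XM fM 1 sub 3 4 by blast
qed

text \<open>Here \<open>X\<close> may take values in any measurable space, in particular in the
  Hilbert space of partial sums; the product form makes Fubini available there.\<close>

lemma joint_distr_inc:
  assumes ab: "0 \<le> a" "a < b" "b \<le> T" and X: "X \<in> measurable (F a) N"
  shows "distr M N X \<Otimes>\<^sub>M distr M borel (inc a b) = distr M (N \<Otimes>\<^sub>M borel) (\<lambda>\<omega>. (X \<omega>, inc a b \<omega>))"
proof -
  have sp: "space (F a) = space M" and sub: "sets (F a) \<subseteq> sets M"
    using subalgebra_F[of a] ab by (auto simp: subalgebra_def)
  have XM [measurable]: "X \<in> measurable M N" using measurable_F_M[OF _ _ X] ab by simp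
  have iM [measurable]: "inc a b \<in> borel_measurable M" using measurable_inc_M ab by simp
  interpret \<mu>: prob_space "distr M N X" by (rule prob_space_distr) measurable
  interpret \<nu>: prob_space "distr M borel (inc a b)" by (rule prob_space_distr) measurable
  show ?thesis
  proof (rule pair_measure_eqI)
    show "sigma_finite_measure (distr M N X)" "sigma_finite_measure (distr M borel (inc a b))" by unfold_locales
    show "sets (distr M N X \<Otimes>\<^sub>M distr M borel (inc a b)) = sets (distr M (N \<Otimes>\<^sub>M borel) (\<lambda>\<omega>. (X \<omega>, inc a b \<omega>)))"
      by (simp cong: sets_pair_measure_cong)
    fix A B assume AB: "A \<in> sets (distr M N X)" "B \<in> sets (distr M borel (inc a b))"
    then have [measurable]: "A \<in> sets N" "B \<in> sets borel" by auto
    have "(\<lambda>\<omega>. (X \<omega>, inc a b \<omega>)) -` (A \<times> B) \<inter> space M = (X -` A \<inter> space M) \<inter> (inc a b -` B \<inter> space M)" by auto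
    moreover have "prob ((X -` A \<inter> space M) \<inter> (inc a b -` B \<inter> space M)) = prob (X -` A \<inter> space M) * prob (inc a b -` B \<inter> space M)"
      using measurable_sets[OF X, of A] AB by (intro prob_Int_inc ab) (auto simp: sp)
    ultimately show "emeasure (distr M N X) A * emeasure (distr M borel (inc a b)) B
        = emeasure (distr M (N \<Otimes>\<^sub>M borel) (\<lambda>\<omega>. (X \<omega>, inc a b \<omega>))) (A \<times> B)"
      by (simp add: emeasure_distr emeasure_eq_measure ennreal_mult)
  qed
qed

section \<open>Moments, products and symmetry of increments\<close>

lemma inc_moments:
  assumes ab: "0 \<le> a" "a < b" "b \<le> T" "c \<in> Basis"
  shows "integrable M (\<lambda>\<omega>. inc a b \<omega> \<bullet> c)" "expectation (\<lambda>\<omega>. inc a b \<omega> \<bullet> c) = 0"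
    "integrable M (\<lambda>\<omega>. (inc a b \<omega> \<bullet> c)\<^sup>2)" "expectation (\<lambda>\<omega>. (inc a b \<omega> \<bullet> c)\<^sup>2) = b - a"
proof -
  note D = inc_distributed[OF ab]
  have s: "0 < sqrt (b - a)" using ab by simp
  have "integrable lborel (\<lambda>x. normal_density 0 (sqrt (b - a)) x * x)"
    using integrable_normal_moment_nz_1[OF s, of 0] .
  then show "integrable M (\<lambda>\<omega>. inc a b \<omega> \<bullet> c)"
    by (subst (asm) distributed_integrable[OF D]) auto
  have "integrable lborel (\<lambda>x. normal_density 0 (sqrt (b - a)) x * x\<^sup>2)"
    using integrable_normal_moment[OF s, of 0 2] by simp
  then show "integrable M (\<lambda>\<omega>. (inc a b \<omega> \<bullet> c)\<^sup>2)"
    by (subst (asm) distributed_integrable[OF D]) auto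
  show "expectation (\<lambda>\<omega>. inc a b \<omega> \<bullet> c) = 0" by (rule normal_distributed_expectation[OF s D])
  have "expectation (\<lambda>\<omega>. (inc a b \<omega> \<bullet> c)\<^sup>2) = (LINT x|lborel. normal_density 0 (sqrt (b - a)) x * x\<^sup>2)"
    by (rule distributed_integral[OF D, symmetric]) auto
  also have "\<dots> = b - a"
    using integral_normal_moment_even[OF s, of 0 1] ab by simp
  finally show "expectation (\<lambda>\<omega>. (inc a b \<omega> \<bullet> c)\<^sup>2) = b - a" .
qed

lemma expect_times_inc:
  assumes ab: "0 \<le> a" "a \<le> b" "b \<le> T" "c \<in> Basis"
    and X: "X \<in> borel_measurable (F a)" "integrable M X"
  shows "has_bochner_integral M (\<lambda>\<omega>. X \<omega> * (inc a b \<omega> \<bullet> c)) (0::real)"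
proof (cases "a = b")
  case False
  then have ab': "a < b" using ab by simp
  have ind: "indep_var borel X borel (\<lambda>\<omega>. inc a b \<omega> \<bullet> c)"
    by (rule indep_inc[OF ab(1) ab' ab(3) X(1)]) simp
  note m = inc_moments[OF ab(1) ab' ab(3,4)]
  show ?thesis
    unfolding has_bochner_integral_iff
    using indep_var_integrable[OF ind X(2) m(1)] indep_var_lebesgue_integral[OF ind X(2) m(1)] m(2)
    by simp
qed (simp add: has_bochner_integral_zero)

lemma expect_times_inc_inc:
  assumes ab: "0 \<le> a" "a \<le> b" "b \<le> T" "c \<in> Basis" "d \<in> Basis"
    and X: "X \<in> borel_measurable (F a)" "integrable M X"
  shows "has_bochner_integral M (\<lambda>\<omega>. X \<omega> * ((inc a b \<omega> \<bullet> c) * (inc a b \<omega> \<bullet> d)))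
    (if c = d then (b - a) * expectation X else (0::real))"
proof (cases "a = b")
  case False
  then have ab': "a < b" using ab by simp
  define Z where "Z \<omega> = (inc a b \<omega> \<bullet> c) * (inc a b \<omega> \<bullet> d)" for \<omega>
  have ind: "indep_var borel X borel Z"
    unfolding Z_def[abs_def] by (rule indep_inc[OF ab(1) ab' ab(3) X(1)]) simp
  note mc = inc_moments[OF ab(1) ab' ab(3,4)] and md = inc_moments[OF ab(1) ab' ab(3,5)]
  have Z: "integrable M Z \<and> expectation Z = (if c = d then b - a else 0)"
  proof (cases "c = d")
    case True
    then show ?thesis using mc(3,4) by (simp add: Z_def[abs_def] power2_eq_square)
  next
    case False
    note i = inc_components_indep[OF ab(1) ab' ab(3,4,5) False]
    show ?thesis
      using indep_var_integrable[OF i mc(1) md(1)] indep_var_lebesgue_integral[OF i mc(1) md(1)] False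
      by (simp add: Z_def[abs_def] mc(2))
  qed
  show ?thesis
    unfolding has_bochner_integral_iff Z_def[symmetric]
    using indep_var_integrable[OF ind X(2)] indep_var_lebesgue_integral[OF ind X(2)] Z by simp
qed (simp add: has_bochner_integral_zero)

text \<open>Each component is a centred normal variable, hence symmetric. Independence makes the
  joint law the product of the marginals, so the law of the vector is symmetric as well.\<close>

lemma distr_inc_symmetric:
  assumes ab: "0 \<le> a" "a < b" "b \<le> T"
  shows "distr M borel (\<lambda>\<omega>. - inc a b \<omega>) = distr M borel (inc a b)"
proof -
  have iM [measurable]: "inc a b \<in> borel_measurable M" using measurable_inc_M ab by simp
  have comp [measurable]: "(\<lambda>\<omega>. inc a b \<omega> $ i) \<in> borel_measurable M" for i
  proof -
    have "(\<lambda>\<omega>. inc a b \<omega> \<bullet> axis i 1) \<in> borel_measurable M" by measurable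
    then show ?thesis by (simp add: inner_axis)
  qed
  have dist: "distributed M lborel (\<lambda>\<omega>. inc a b \<omega> $ i) (normal_density 0 (sqrt (b - a)))" for i
    using inc_distributed[OF ab, of "axis i 1"] by (simp add: inner_axis axis_in_Basis_iff)
  have sym: "distr M borel (\<lambda>\<omega>. - inc a b \<omega> $ i) = distr M borel (\<lambda>\<omega>. inc a b \<omega> $ i)" for i
  proof -
    have "distributed M lborel (\<lambda>\<omega>. 0 + (- 1) * (inc a b \<omega> $ i)) (normal_density (0 + (- 1) * 0) (\<bar>- 1\<bar> * sqrt (b - a)))"
      using ab by (intro normal_density_affine[OF dist]) auto
    then have "distributed M lborel (\<lambda>\<omega>. - inc a b \<omega> $ i) (normal_density 0 (sqrt (b - a)))" by simp
    then show ?thesis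
      using dist[of i] by (simp add: distributed_def cong: distr_cong)
  qed
  have ind: "indep_vars (\<lambda>_. borel) (\<lambda>i \<omega>. inc a b \<omega> $ i) UNIV"
    using brownian ab by (simp add: brownian_motion_def inc_def)
  have ind': "indep_vars (\<lambda>_. borel) (\<lambda>i \<omega>. - inc a b \<omega> $ i) UNIV"
    using indep_vars_compose2[OF ind, of "\<lambda>_ x. - x" "\<lambda>_. borel"] by simp
  have PiM: "distr M (Pi\<^sub>M UNIV (\<lambda>_. borel)) (\<lambda>\<omega>. \<lambda>i\<in>UNIV. - inc a b \<omega> $ i)
      = distr M (Pi\<^sub>M UNIV (\<lambda>_. borel)) (\<lambda>\<omega>. \<lambda>i\<in>UNIV. inc a b \<omega> $ i)"
    using ind ind'
    by (subst (asm) (1 2) indep_vars_iff_distr_eq_PiM) (auto simp: sym)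
  \<comment> \<open>Independence describes a law on functions from the index type to the reals;
    \<open>V\<close> carries it to vectors.\<close>
  define V :: "('d \<Rightarrow> real) \<Rightarrow> real ^ 'd" where "V f = (\<chi> i. f i)" for f
  have V [measurable]: "V \<in> borel_measurable (Pi\<^sub>M UNIV (\<lambda>_. borel))"
  proof -
    have "(\<lambda>f. V f \<bullet> c) \<in> borel_measurable (Pi\<^sub>M UNIV (\<lambda>_. borel))" if "c \<in> Basis" for c
      using that by (auto simp: Basis_vec_def V_def inner_axis)
    then show ?thesis by (subst borel_measurable_euclidean_space) blast
  qed
  have "distr (distr M (Pi\<^sub>M UNIV (\<lambda>_. borel)) (\<lambda>\<omega>. \<lambda>i\<in>UNIV. - inc a b \<omega> $ i)) borel V
      = distr (distr M (Pi\<^sub>M UNIV (\<lambda>_. borel)) (\<lambda>\<omega>. \<lambda>i\<in>UNIV. inc a b \<omega> $ i)) borel V"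
    by (simp only: PiM)
  moreover have "(\<lambda>\<omega>. \<lambda>i\<in>UNIV. - inc a b \<omega> $ i) \<in> measurable M (Pi\<^sub>M UNIV (\<lambda>_. borel))"
    "(\<lambda>\<omega>. \<lambda>i\<in>UNIV. inc a b \<omega> $ i) \<in> measurable M (Pi\<^sub>M UNIV (\<lambda>_. borel))"
    by (auto intro!: measurable_restrict)
  moreover have "V (\<lambda>i\<in>UNIV. - inc a b \<omega> $ i) = - inc a b \<omega>" "V (\<lambda>i\<in>UNIV. inc a b \<omega> $ i) = inc a b \<omega>" for \<omega>
    by (auto simp: V_def vec_eq_iff)
  ultimately show ?thesis by (simp add: distr_distr o_def)
qed

text \<open>Convexity of cosh with weights 1/d separates the coordinates, so only the
  one-dimensional moment generating functions enter. The compensating factor d in \<open>h\<close>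
  is the source of d^2 / 2 in the exponent.\<close>

lemma inc_cosh_moment:
  fixes A :: "(real ^ 'd) \<Rightarrow>\<^sub>L 'h::real_inner"
  assumes ab: "0 \<le> a" "a < b" "b \<le> T"
  shows "(\<integral>\<^sup>+\<omega>. ennreal (cosh (norm (A (inc a b \<omega>)))) \<partial>M)
    \<le> ennreal (exp ((real CARD('d))\<^sup>2 / 2 * ((b - a) * (hilbert_schmidt_norm A)\<^sup>2)))"
proof -
  define d where "d = real CARD('d)"
  have d: "d > 0" "d = real (card (Basis :: (real ^ 'd) set))" by (simp_all add: d_def)
  define h where "h c = d * norm (A c)" for c
  have [measurable]: "inc a b \<in> borel_measurable M" using measurable_inc_M ab by simp
  have mgf: "(\<integral>\<^sup>+\<omega>. ennreal (exp (l * (inc a b \<omega> \<bullet> c))) \<partial>M) = ennreal (exp (l\<^sup>2 * (b - a) / 2))"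
    if "c \<in> Basis" for l c
    using distributed_nn_integral[OF inc_distributed[OF ab that], of "\<lambda>x. ennreal (exp (l * x))"]
      nn_integral_normal_density_exp[of "sqrt (b - a)" l] ab by simp
  have bound: "cosh (norm (A z)) \<le> (\<Sum>c\<in>Basis. 1 / (2 * d) * (exp (h c * (z \<bullet> c)) + exp (- h c * (z \<bullet> c))))" for z
  proof -
    have "A z = (\<Sum>c\<in>Basis. (z \<bullet> c) *\<^sub>R A c)"
      by (subst euclidean_representation[of z, symmetric]) (simp add: blinfun.sum_right blinfun.scaleR_right)
    then have "norm (A z) \<le> (\<Sum>c\<in>Basis. \<bar>z \<bullet> c\<bar> * norm (A c))"
      by (simp add: order_trans[OF norm_sum])
    then have "cosh (norm (A z)) \<le> cosh (\<Sum>c\<in>Basis. \<bar>z \<bullet> c\<bar> * norm (A c))"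
      by (subst cosh_real_nonneg_le_iff) (auto intro: sum_nonneg)
    also have "\<dots> = cosh (\<Sum>c\<in>(Basis :: (real ^ 'd) set). (1 / d) *\<^sub>R (\<bar>z \<bullet> c\<bar> * h c))"
      using d by (simp add: h_def)
    also have "\<dots> \<le> (\<Sum>c\<in>(Basis :: (real ^ 'd) set). (1 / d) * cosh (\<bar>z \<bullet> c\<bar> * h c))"
      using d by (intro convex_on_sum[OF _ _ convex_on_cosh]) auto
    also have "\<dots> = (\<Sum>c\<in>Basis. 1 / (2 * d) * (exp (h c * (z \<bullet> c)) + exp (- h c * (z \<bullet> c))))"
    proof (intro sum.cong refl)
      fix c :: "real ^ 'd"
      have "cosh (\<bar>z \<bullet> c\<bar> * h c) = cosh (h c * (z \<bullet> c))"
        by (cases "0 \<le> z \<bullet> c") (simp_all add: mult.commute)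
      then show "1 / d * cosh (\<bar>z \<bullet> c\<bar> * h c) = 1 / (2 * d) * (exp (h c * (z \<bullet> c)) + exp (- h c * (z \<bullet> c)))"
        using d by (simp add: cosh_def field_simps)
    qed
    finally show ?thesis .
  qed
  have "(\<integral>\<^sup>+\<omega>. ennreal (cosh (norm (A (inc a b \<omega>)))) \<partial>M)
      \<le> (\<integral>\<^sup>+\<omega>. (\<Sum>c\<in>Basis. ennreal (1 / (2 * d)) * (ennreal (exp (h c * (inc a b \<omega> \<bullet> c))) + ennreal (exp (- h c * (inc a b \<omega> \<bullet> c))))) \<partial>M)"
  proof (rule nn_integral_mono)
    fix \<omega>
    show "ennreal (cosh (norm (A (inc a b \<omega>))))
        \<le> (\<Sum>c\<in>Basis. ennreal (1 / (2 * d)) * (ennreal (exp (h c * (inc a b \<omega> \<bullet> c))) + ennreal (exp (- h c * (inc a b \<omega> \<bullet> c)))))"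
    proof -
      have "ennreal (1 / (2 * d)) * (ennreal (exp u) + ennreal (exp v)) = ennreal (1 / (2 * d) * (exp u + exp v))" for u v
        using d by (subst ennreal_mult) simp_all
      then have "(\<Sum>c\<in>Basis. ennreal (1 / (2 * d)) * (ennreal (exp (h c * (inc a b \<omega> \<bullet> c))) + ennreal (exp (- h c * (inc a b \<omega> \<bullet> c)))))
          = ennreal (\<Sum>c\<in>Basis. 1 / (2 * d) * (exp (h c * (inc a b \<omega> \<bullet> c)) + exp (- h c * (inc a b \<omega> \<bullet> c))))"
        using d by (subst sum_ennreal[symmetric]) simp_all
      then show ?thesis using ennreal_leI[OF bound[of "inc a b \<omega>"]] by (simp only:)
    qed
  qed
  also have "\<dots> = (\<Sum>c\<in>Basis. ennreal (1 / (2 * d)) *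
      ((\<integral>\<^sup>+\<omega>. ennreal (exp (h c * (inc a b \<omega> \<bullet> c))) \<partial>M) + (\<integral>\<^sup>+\<omega>. ennreal (exp (- h c * (inc a b \<omega> \<bullet> c))) \<partial>M)))"
    by (subst nn_integral_sum) (auto simp: nn_integral_cmult nn_integral_add)
  also have "\<dots> = (\<Sum>c\<in>(Basis :: (real ^ 'd) set). ennreal (1 / d * exp ((h c)\<^sup>2 * (b - a) / 2)))"
  proof (intro sum.cong refl)
    fix c :: "real ^ 'd" assume c: "c \<in> Basis"
    show "ennreal (1 / (2 * d)) * ((\<integral>\<^sup>+\<omega>. ennreal (exp (h c * (inc a b \<omega> \<bullet> c))) \<partial>M)
        + (\<integral>\<^sup>+\<omega>. ennreal (exp (- h c * (inc a b \<omega> \<bullet> c))) \<partial>M)) = ennreal (1 / d * exp ((h c)\<^sup>2 * (b - a) / 2))"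
      unfolding mgf[OF c] power2_minus using d(1)
      by (simp add: ennreal_mult[symmetric] ennreal_plus[symmetric] field_simps del: ennreal_plus)
  qed
  also have "\<dots> \<le> (\<Sum>c\<in>(Basis :: (real ^ 'd) set). ennreal (1 / d * exp (d\<^sup>2 / 2 * ((b - a) * (hilbert_schmidt_norm A)\<^sup>2))))"
  proof (intro sum_mono ennreal_leI mult_left_mono)
    fix c :: "real ^ 'd" assume c: "c \<in> Basis"
    have "(norm (A c))\<^sup>2 \<le> (hilbert_schmidt_norm A)\<^sup>2"
      using member_le_sum[OF c, of "\<lambda>c. (norm (A c))\<^sup>2"] by (simp add: hilbert_schmidt_norm_def sum_nonneg)
    then have "d\<^sup>2 * (b - a) / 2 * (norm (A c))\<^sup>2 \<le> d\<^sup>2 * (b - a) / 2 * (hilbert_schmidt_norm A)\<^sup>2"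
      using ab by (intro mult_left_mono) auto
    then show "exp ((h c)\<^sup>2 * (b - a) / 2) \<le> exp (d\<^sup>2 / 2 * ((b - a) * (hilbert_schmidt_norm A)\<^sup>2))"
      by (simp add: h_def power_mult_distrib mult_ac)
  qed (use d in auto)
  also have "\<dots> = ennreal (exp (d\<^sup>2 / 2 * ((b - a) * (hilbert_schmidt_norm A)\<^sup>2)))"
    using d by (subst sum_ennreal) simp_all
  finally show ?thesis by (simp add: d_def)
qed

text \<open>Under the product law the past value is a constant \<open>x\<close>, and
  \<open>cosh_norm_parallelogram\<close> applies for fixed \<open>x\<close>. The exponent is
  additive, so the estimate can be iterated along a partition.\<close>

lemma cosh_norm_step:
  fixes A :: "(real ^ 'd) \<Rightarrow>\<^sub>L 'h::{real_inner, second_countable_topology}"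
  assumes ab: "0 \<le> a" "a \<le> b" "b \<le> T" and S: "S \<in> borel_measurable (F a)"
  shows "(\<integral>\<^sup>+\<omega>. ennreal (cosh (norm (S \<omega> + A (inc a b \<omega>)))) \<partial>M)
    \<le> (\<integral>\<^sup>+\<omega>. ennreal (cosh (norm (S \<omega>))) \<partial>M)
      * ennreal (exp ((real CARD('d))\<^sup>2 / 2 * ((b - a) * (hilbert_schmidt_norm A)\<^sup>2)))"
proof (cases "a = b")
  case False
  then have ab': "a < b" using ab by simp
  define \<mu> \<nu> where "\<mu> = distr M borel S" and "\<nu> = distr M borel (inc a b)"
  have Sm [measurable]: "S \<in> borel_measurable M" using measurable_F_M[OF _ _ S] ab by simp
  have im [measurable]: "inc a b \<in> borel_measurable M" using measurable_inc_M ab by simp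
  interpret \<mu>: prob_space \<mu> unfolding \<mu>_def by (rule prob_space_distr) measurable
  interpret \<nu>: prob_space \<nu> unfolding \<nu>_def by (rule prob_space_distr) measurable
  have sets [measurable_cong]: "sets \<mu> = sets borel" "sets \<nu> = sets borel" by (simp_all add: \<mu>_def \<nu>_def)
  have Am [measurable]: "blinfun_apply A \<in> borel_measurable borel"
    by (intro borel_measurable_continuous_onI linear_continuous_on blinfun.bounded_linear_right)
  have cm [measurable]: "(cosh :: real \<Rightarrow> real) \<in> borel_measurable borel"
    by (intro borel_measurable_continuous_onI continuous_intros)
  have sym: "(\<integral>\<^sup>+z. g z \<partial>\<nu>) = (\<integral>\<^sup>+z. g (- z) \<partial>\<nu>)" if [measurable]: "g \<in> borel_measurable borel" for g
  proof -
    have "(\<integral>\<^sup>+z. g z \<partial>\<nu>) = (\<integral>\<^sup>+z. g z \<partial>distr M borel (\<lambda>\<omega>. - inc a b \<omega>))"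
      unfolding \<nu>_def distr_inc_symmetric[OF ab(1) ab' ab(3)] ..
    then show ?thesis by (simp add: \<nu>_def nn_integral_distr)
  qed
  have joint: "\<mu> \<Otimes>\<^sub>M \<nu> = distr M (borel \<Otimes>\<^sub>M borel) (\<lambda>\<omega>. (S \<omega>, inc a b \<omega>))"
    unfolding \<mu>_def \<nu>_def by (rule joint_distr_inc[OF ab(1) ab' ab(3) S])
  have "(\<integral>\<^sup>+\<omega>. ennreal (cosh (norm (S \<omega> + A (inc a b \<omega>)))) \<partial>M)
      = (\<integral>\<^sup>+p. ennreal (cosh (norm (fst p + A (snd p)))) \<partial>(\<mu> \<Otimes>\<^sub>M \<nu>))"
  proof -
    have [measurable]: "(\<lambda>p. ennreal (cosh (norm (fst p + A (snd p))))) \<in> borel_measurable (borel \<Otimes>\<^sub>M borel)"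
      by measurable
    show ?thesis unfolding joint by (subst nn_integral_distr) simp_all
  qed
  also have "\<dots> = (\<integral>\<^sup>+x. \<integral>\<^sup>+z. ennreal (cosh (norm (x + A z))) \<partial>\<nu> \<partial>\<mu>)"
  proof -
    have "(\<lambda>p. ennreal (cosh (norm (fst p + A (snd p))))) \<in> borel_measurable (\<mu> \<Otimes>\<^sub>M \<nu>)" by measurable
    from \<nu>.nn_integral_fst[OF this] show ?thesis by simp
  qed
  also have "\<dots> \<le> (\<integral>\<^sup>+x. ennreal (cosh (norm x)) * (\<integral>\<^sup>+z. ennreal (cosh (norm (A z))) \<partial>\<nu>) \<partial>\<mu>)"
  proof (rule nn_integral_mono)
    fix x :: 'h
    \<comment> \<open>By symmetry the integral may be added to its reflection, which pairs x + A z
      with x - A z.\<close>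
    have "2 * (\<integral>\<^sup>+z. ennreal (cosh (norm (x + A z))) \<partial>\<nu>)
        = (\<integral>\<^sup>+z. ennreal (cosh (norm (x + A z))) \<partial>\<nu>) + (\<integral>\<^sup>+z. ennreal (cosh (norm (x + A (- z)))) \<partial>\<nu>)"
      using sym[of "\<lambda>z. ennreal (cosh (norm (x + A z)))"] by (simp add: mult_2)
    also have "\<dots> = (\<integral>\<^sup>+z. ennreal (cosh (norm (x + A z)) + cosh (norm (x - A z))) \<partial>\<nu>)"
      by (subst nn_integral_add[symmetric]) (auto simp: blinfun.minus_right intro!: nn_integral_cong)
    also have "\<dots> \<le> (\<integral>\<^sup>+z. ennreal (2 * cosh (norm x)) * ennreal (cosh (norm (A z))) \<partial>\<nu>)"
    proof (intro nn_integral_mono)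
      fix z
      show "ennreal (cosh (norm (x + A z)) + cosh (norm (x - A z)))
          \<le> ennreal (2 * cosh (norm x)) * ennreal (cosh (norm (A z)))"
        using ennreal_leI[OF cosh_norm_parallelogram[of x "A z"]]
        by (subst ennreal_mult[symmetric]) (simp_all only: mult.assoc, simp_all)
    qed
    also have "\<dots> = 2 * (ennreal (cosh (norm x)) * (\<integral>\<^sup>+z. ennreal (cosh (norm (A z))) \<partial>\<nu>))"
      by (subst nn_integral_cmult) (auto simp: ennreal_mult mult.assoc)
    finally show "(\<integral>\<^sup>+z. ennreal (cosh (norm (x + A z))) \<partial>\<nu>)
        \<le> ennreal (cosh (norm x)) * (\<integral>\<^sup>+z. ennreal (cosh (norm (A z))) \<partial>\<nu>)"
      by (subst (asm) ennreal_mult_le_mult_iff) auto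
  qed
  also have "\<dots> = (\<integral>\<^sup>+\<omega>. ennreal (cosh (norm (S \<omega>))) \<partial>M) * (\<integral>\<^sup>+\<omega>. ennreal (cosh (norm (A (inc a b \<omega>)))) \<partial>M)"
    by (subst nn_integral_multc) (auto simp: \<mu>_def \<nu>_def nn_integral_distr)
  also have "\<dots> \<le> (\<integral>\<^sup>+\<omega>. ennreal (cosh (norm (S \<omega>))) \<partial>M)
      * ennreal (exp ((real CARD('d))\<^sup>2 / 2 * ((b - a) * (hilbert_schmidt_norm A)\<^sup>2)))"
    by (intro mult_left_mono inc_cosh_moment ab ab') auto
  finally show ?thesis .
qed simp

text \<open>Only evaluations of the random operator are assumed measurable; expansion in the basis
  reduces a random argument to finitely many fixed ones.\<close>

lemma measurable_blinfun_inc: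
  fixes A :: "'w \<Rightarrow> (real ^ 'd) \<Rightarrow>\<^sub>L 'h::{real_inner, second_countable_topology}"
  assumes "\<And>x. (\<lambda>\<omega>. A \<omega> x) \<in> borel_measurable N" "Z \<in> borel_measurable N"
  shows "(\<lambda>\<omega>. A \<omega> (Z \<omega>)) \<in> borel_measurable N"
proof -
  have "A \<omega> (Z \<omega>) = (\<Sum>c\<in>Basis. (Z \<omega> \<bullet> c) *\<^sub>R A \<omega> c)" for \<omega>
    by (subst euclidean_representation[of "Z \<omega>", symmetric])
       (simp add: blinfun.sum_right blinfun.scaleR_right del: euclidean_representation)
  then show ?thesis using assms by simp
qed

text \<open>The bound depends on the partition only through a Riemann sum of squared Hilbert-Schmidt
  norms. Measurability of the partial sum and nonnegativity of its last time are carried along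
  because the next step of the induction requires them.\<close>

lemma step_cosh_moment:
  fixes A :: "nat \<Rightarrow> (real ^ 'd) \<Rightarrow>\<^sub>L 'h::{real_inner, second_countable_topology}"
  assumes "0 \<le> \<tau> 0" "\<And>i. i < n \<Longrightarrow> \<tau> i \<le> \<tau> (Suc i)" "\<tau> n \<le> T"
  shows "(\<integral>\<^sup>+\<omega>. ennreal (cosh (norm (\<Sum>i<n. A i (inc (\<tau> i) (\<tau> (Suc i)) \<omega>)))) \<partial>M)
    \<le> ennreal (exp ((real CARD('d))\<^sup>2 / 2 * (\<Sum>i<n. (\<tau> (Suc i) - \<tau> i) * (hilbert_schmidt_norm (A i))\<^sup>2)))
    \<and> (\<lambda>\<omega>. \<Sum>i<n. A i (inc (\<tau> i) (\<tau> (Suc i)) \<omega>)) \<in> borel_measurable (F (\<tau> n))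
    \<and> 0 \<le> \<tau> n"
  using assms
proof (induction n)
  case 0
  then show ?case by (simp add: emeasure_space_1)
next
  case (Suc n)
  have le: "\<tau> n \<le> \<tau> (Suc n)" using Suc.prems by simp
  define S where "S \<omega> = (\<Sum>i<n. A i (inc (\<tau> i) (\<tau> (Suc i)) \<omega>))" for \<omega>
  have IH: "(\<integral>\<^sup>+\<omega>. ennreal (cosh (norm (S \<omega>))) \<partial>M)
      \<le> ennreal (exp ((real CARD('d))\<^sup>2 / 2 * (\<Sum>i<n. (\<tau> (Suc i) - \<tau> i) * (hilbert_schmidt_norm (A i))\<^sup>2)))"
    "S \<in> borel_measurable (F (\<tau> n))" "0 \<le> \<tau> n"
    using Suc.IH Suc.prems le unfolding S_def[abs_def] by auto
  have "(\<integral>\<^sup>+\<omega>. ennreal (cosh (norm (S \<omega> + A n (inc (\<tau> n) (\<tau> (Suc n)) \<omega>)))) \<partial>M)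
      \<le> (\<integral>\<^sup>+\<omega>. ennreal (cosh (norm (S \<omega>))) \<partial>M)
        * ennreal (exp ((real CARD('d))\<^sup>2 / 2 * ((\<tau> (Suc n) - \<tau> n) * (hilbert_schmidt_norm (A n))\<^sup>2)))"
    using IH Suc.prems le by (intro cosh_norm_step) auto
  also have "\<dots> \<le> ennreal (exp ((real CARD('d))\<^sup>2 / 2 * (\<Sum>i<n. (\<tau> (Suc i) - \<tau> i) * (hilbert_schmidt_norm (A i))\<^sup>2)))
        * ennreal (exp ((real CARD('d))\<^sup>2 / 2 * ((\<tau> (Suc n) - \<tau> n) * (hilbert_schmidt_norm (A n))\<^sup>2)))"
    by (intro mult_right_mono IH) auto
  also have "\<dots> = ennreal (exp ((real CARD('d))\<^sup>2 / 2 * (\<Sum>i<Suc n. (\<tau> (Suc i) - \<tau> i) * (hilbert_schmidt_norm (A i))\<^sup>2)))"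
    by (simp add: ennreal_mult[symmetric] exp_add[symmetric] distrib_left)
  finally have 1: "(\<integral>\<^sup>+\<omega>. ennreal (cosh (norm (S \<omega> + A n (inc (\<tau> n) (\<tau> (Suc n)) \<omega>)))) \<partial>M)
      \<le> ennreal (exp ((real CARD('d))\<^sup>2 / 2 * (\<Sum>i<Suc n. (\<tau> (Suc i) - \<tau> i) * (hilbert_schmidt_norm (A i))\<^sup>2)))" .
  have 2: "(\<lambda>\<omega>. S \<omega> + A n (inc (\<tau> n) (\<tau> (Suc n)) \<omega>)) \<in> borel_measurable (F (\<tau> (Suc n)))"
  proof (rule borel_measurable_add)
    show "S \<in> borel_measurable (F (\<tau> (Suc n)))"
      using IH(2,3) le Suc.prems by (intro measurable_F_mono[of "\<tau> n" "\<tau> (Suc n)"]) auto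
    show "(\<lambda>\<omega>. A n (inc (\<tau> n) (\<tau> (Suc n)) \<omega>)) \<in> borel_measurable (F (\<tau> (Suc n)))"
    proof (rule measurable_blinfun_inc)
      show "inc (\<tau> n) (\<tau> (Suc n)) \<in> borel_measurable (F (\<tau> (Suc n)))"
        using IH(3) le Suc.prems by (intro measurable_inc) auto
    qed simp
  qed
  have eq: "(\<Sum>i<Suc n. A i (inc (\<tau> i) (\<tau> (Suc i)) \<omega>)) = S \<omega> + A n (inc (\<tau> n) (\<tau> (Suc n)) \<omega>)" for \<omega>
    by (simp add: S_def)
  have "0 \<le> \<tau> (Suc n)" using IH(3) le by (rule order_trans)
  with 1 2 show ?case unfolding eq by blast
qed

end

subsection \<open>The Ito isometry\<close>

definition hs_inner :: "((real ^ 'd) \<Rightarrow>\<^sub>L 'h::real_inner) \<Rightarrow> ((real ^ 'd) \<Rightarrow>\<^sub>L 'h) \<Rightarrow> real" where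
  "hs_inner A B = (\<Sum>c\<in>Basis. A c \<bullet> B c)"

lemma hs_inner_add_right: "hs_inner A (B + C) = hs_inner A B + hs_inner A C"
  by (simp add: hs_inner_def plus_blinfun.rep_eq inner_add_right sum.distrib)

lemma hs_inner_scaleR_right: "hs_inner A (k *\<^sub>R B) = k * hs_inner A B"
  by (simp add: hs_inner_def scaleR_blinfun.rep_eq sum_distrib_left)

lemma hs_inner_commute: "hs_inner A B = hs_inner B A"
  by (simp add: hs_inner_def inner_commute)

lemma hs_inner_scaleR_left: "hs_inner (k *\<^sub>R A) B = k * hs_inner A B"
  by (simp add: hs_inner_commute[of _ B] hs_inner_scaleR_right)

lemma hs_inner_zero_right [simp]: "hs_inner A 0 = 0"
  by (simp add: hs_inner_def zero_blinfun.rep_eq)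

lemma hilbert_schmidt_norm_sq: "(hilbert_schmidt_norm A)\<^sup>2 = (\<Sum>c\<in>Basis. (norm (A c))\<^sup>2)"
  by (simp add: hilbert_schmidt_norm_def sum_nonneg)

lemma hs_inner_self: "hs_inner A A = (hilbert_schmidt_norm A)\<^sup>2"
  by (simp add: hs_inner_def hilbert_schmidt_norm_sq power2_norm_eq_inner)

lemma hilbert_schmidt_norm_diff_sq:
  fixes A B :: "(real ^ 'd) \<Rightarrow>\<^sub>L 'h::real_inner"
  shows "(hilbert_schmidt_norm (A - B))\<^sup>2 \<le> 2 * (hilbert_schmidt_norm (A - C))\<^sup>2 + 2 * (hilbert_schmidt_norm (B - C))\<^sup>2"
proof -
  have "(norm ((A - B) c))\<^sup>2 \<le> 2 * (norm ((A - C) c))\<^sup>2 + 2 * (norm ((B - C) c))\<^sup>2" for c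
    using norm_add_sq[of "(A - C) c" "- ((B - C) c)"]
    by (simp add: minus_blinfun.rep_eq norm_minus_commute)
  then show ?thesis
    unfolding hilbert_schmidt_norm_sq sum_distrib_left sum.distrib[symmetric] by (rule sum_mono)
qed

lemma hilbert_schmidt_norm_le:
  fixes A :: "(real ^ 'd) \<Rightarrow>\<^sub>L 'h::real_inner"
  shows "(hilbert_schmidt_norm A)\<^sup>2 \<le> real CARD('d) * (norm A)\<^sup>2"
proof -
  have "(hilbert_schmidt_norm A)\<^sup>2 \<le> (\<Sum>c\<in>(Basis :: (real ^ 'd) set). (norm A)\<^sup>2)"
    unfolding hilbert_schmidt_norm_sq
  proof (intro sum_mono power_mono)
    fix c :: "real ^ 'd" assume "c \<in> Basis"
    then show "norm (A c) \<le> norm A" using norm_blinfun[of A c] by simp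
  qed simp
  then show ?thesis by simp
qed

lemma blinfun_inner_expand:
  fixes A B :: "(real ^ 'd) \<Rightarrow>\<^sub>L 'h::real_inner"
  shows "A u \<bullet> B v = (\<Sum>c\<in>Basis. \<Sum>d\<in>Basis. (A c \<bullet> B d) * ((u \<bullet> c) * (v \<bullet> d)))"
proof -
  have "A u = (\<Sum>c\<in>Basis. (u \<bullet> c) *\<^sub>R A c)" "B v = (\<Sum>d\<in>Basis. (v \<bullet> d) *\<^sub>R B d)"
    by (subst euclidean_representation[of u, symmetric] euclidean_representation[of v, symmetric],
        simp add: blinfun.sum_right blinfun.scaleR_right del: euclidean_representation)+
  then show ?thesis by (simp add: inner_sum_left inner_sum_right mult_ac sum_distrib_left) (rule sum.swap)
qed

section \<open>Covariances of increments with adapted coefficients, and the isometry\<close>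

context brownian
begin

text \<open>The requirement that \<open>elementary_process\<close> places on a single coefficient,
  taken at time \<open>a\<close>.\<close>

definition coef :: "real \<Rightarrow> ('w \<Rightarrow> (real ^ 'd) \<Rightarrow>\<^sub>L 'h::{real_inner, second_countable_topology}) \<Rightarrow> bool" where
  "coef a \<xi> \<longleftrightarrow> (\<forall>x. (\<lambda>\<omega>. \<xi> \<omega> x) \<in> borel_measurable (F a)) \<and> (\<exists>K. \<forall>\<omega>\<in>space M. norm (\<xi> \<omega>) \<le> K)"

lemma coef_mono: "coef a \<xi> \<Longrightarrow> 0 \<le> a \<Longrightarrow> a \<le> c \<Longrightarrow> c \<le> T \<Longrightarrow> coef c \<xi>"
  unfolding coef_def by (blast intro: measurable_F_mono)

lemma coef_inner:
  assumes "coef a \<xi>" "coef a \<zeta>" "0 \<le> a" "a \<le> T"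
  shows "(\<lambda>\<omega>. \<xi> \<omega> x \<bullet> \<zeta> \<omega> y) \<in> borel_measurable (F a)"
    "\<exists>K. \<forall>\<omega>\<in>space M. \<bar>\<xi> \<omega> x \<bullet> \<zeta> \<omega> y\<bar> \<le> K" "integrable M (\<lambda>\<omega>. \<xi> \<omega> x \<bullet> \<zeta> \<omega> y)"
proof -
  show m: "(\<lambda>\<omega>. \<xi> \<omega> x \<bullet> \<zeta> \<omega> y) \<in> borel_measurable (F a)"
    using assms(1,2) unfolding coef_def by (intro borel_measurable_inner) auto
  obtain K L where KL: "\<And>\<omega>. \<omega> \<in> space M \<Longrightarrow> norm (\<xi> \<omega>) \<le> K" "\<And>\<omega>. \<omega> \<in> space M \<Longrightarrow> norm (\<zeta> \<omega>) \<le> L"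
    using assms(1,2) unfolding coef_def by blast
  have b: "\<bar>\<xi> \<omega> x \<bullet> \<zeta> \<omega> y\<bar> \<le> (K * norm x) * (L * norm y)" if "\<omega> \<in> space M" for \<omega>
  proof -
    have "norm (\<xi> \<omega> x) \<le> K * norm x" "norm (\<zeta> \<omega> y) \<le> L * norm y"
      using norm_blinfun[of "\<xi> \<omega>" x] norm_blinfun[of "\<zeta> \<omega>" y]
        mult_right_mono[OF KL(1)[OF that], of "norm x"] mult_right_mono[OF KL(2)[OF that], of "norm y"]
      by auto
    then have "norm (\<xi> \<omega> x) * norm (\<zeta> \<omega> y) \<le> (K * norm x) * (L * norm y)"
      by (intro mult_mono) (auto intro: order_trans[OF norm_ge_zero])
    then show ?thesis using Cauchy_Schwarz_ineq2[of "\<xi> \<omega> x" "\<zeta> \<omega> y"] by linarith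
  qed
  then show "\<exists>K. \<forall>\<omega>\<in>space M. \<bar>\<xi> \<omega> x \<bullet> \<zeta> \<omega> y\<bar> \<le> K" by blast
  have "(\<lambda>\<omega>. \<xi> \<omega> x \<bullet> \<zeta> \<omega> y) \<in> borel_measurable M"
    by (rule measurable_F_M[OF assms(3,4) m])
  then show "integrable M (\<lambda>\<omega>. \<xi> \<omega> x \<bullet> \<zeta> \<omega> y)"
    using b by (intro integrable_const_bound[where B="(K * norm x) * (L * norm y)"]) auto
qed

lemma hs_inner_coef_integrable:
  "coef a \<xi> \<Longrightarrow> coef a \<zeta> \<Longrightarrow> 0 \<le> a \<Longrightarrow> a \<le> T \<Longrightarrow> integrable M (\<lambda>\<omega>. hs_inner (\<xi> \<omega>) (\<zeta> \<omega>))"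
  unfolding hs_inner_def by (intro Bochner_Integration.integrable_sum coef_inner(3))

text \<open>In coordinates, everything except the later increment is measurable at time
  \<open>c\<close>, and that increment is centred and independent of \<open>F c\<close>.\<close>

lemma expect_inner_disjoint:
  assumes t: "0 \<le> a" "a \<le> b" "b \<le> c" "c \<le> d" "d \<le> T" and \<xi>: "coef a \<xi>" and \<zeta>: "coef c \<zeta>"
  shows "has_bochner_integral M (\<lambda>\<omega>. \<xi> \<omega> (inc a b \<omega>) \<bullet> \<zeta> \<omega> (inc c d \<omega>)) 0"
proof -
  have "has_bochner_integral M (\<lambda>\<omega>. \<Sum>e\<in>Basis. \<Sum>f\<in>Basis.
      (\<xi> \<omega> e \<bullet> \<zeta> \<omega> f) * (inc a b \<omega> \<bullet> e) * (inc c d \<omega> \<bullet> f)) (\<Sum>e\<in>(Basis :: (real ^ 'd) set). \<Sum>f\<in>(Basis :: (real ^ 'd) set). 0)"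
  proof (intro has_bochner_integral_sum)
    fix e f :: "real ^ 'd" assume ef: "e \<in> Basis" "f \<in> Basis"
    note co = coef_inner[OF coef_mono[OF \<xi>, of c] \<zeta>, of e f]
    define X where "X \<omega> = (\<xi> \<omega> e \<bullet> \<zeta> \<omega> f) * (inc a b \<omega> \<bullet> e)" for \<omega>
    have Xm: "X \<in> borel_measurable (F c)"
      unfolding X_def[abs_def]
    proof (rule borel_measurable_times)
      show "(\<lambda>\<omega>. \<xi> \<omega> e \<bullet> \<zeta> \<omega> f) \<in> borel_measurable (F c)" using co t by auto
      have "inc a b \<in> borel_measurable (F c)"
        using t by (intro measurable_F_mono[of b c] measurable_inc) auto
      then show "(\<lambda>\<omega>. inc a b \<omega> \<bullet> e) \<in> borel_measurable (F c)" by simp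
    qed
    have "integrable M X"
    proof -
      obtain K where K: "\<And>\<omega>. \<omega> \<in> space M \<Longrightarrow> \<bar>\<xi> \<omega> e \<bullet> \<zeta> \<omega> f\<bar> \<le> K" using co(2) t by auto
      have i: "integrable M (\<lambda>\<omega>. inc a b \<omega> \<bullet> e)"
      proof (cases "a = b")
        case False
        then show ?thesis using inc_moments(1)[of a b e] t ef by auto
      qed simp
      have "integrable M (\<lambda>\<omega>. K * \<bar>inc a b \<omega> \<bullet> e\<bar>)" using i by simp
      then show ?thesis
      proof (rule Bochner_Integration.integrable_bound)
        show "X \<in> borel_measurable M" using measurable_F_M[OF _ _ Xm] t by auto
        show "AE \<omega> in M. norm (X \<omega>) \<le> norm (K * \<bar>inc a b \<omega> \<bullet> e\<bar>)"
        proof (rule AE_I2)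
          fix \<omega> assume "\<omega> \<in> space M"
          then have "\<bar>\<xi> \<omega> e \<bullet> \<zeta> \<omega> f\<bar> \<le> \<bar>K\<bar>" using K by fastforce
          then show "norm (X \<omega>) \<le> norm (K * \<bar>inc a b \<omega> \<bullet> e\<bar>)"
            by (simp add: X_def abs_mult mult_right_mono)
        qed
      qed
    qed
    then have "has_bochner_integral M (\<lambda>\<omega>. X \<omega> * (inc c d \<omega> \<bullet> f)) 0"
      using t ef Xm by (intro expect_times_inc) auto
    then show "has_bochner_integral M (\<lambda>\<omega>. (\<xi> \<omega> e \<bullet> \<zeta> \<omega> f) * (inc a b \<omega> \<bullet> e) * (inc c d \<omega> \<bullet> f)) 0"
      by (simp add: X_def)
  qed
  then show ?thesis by (simp add: blinfun_inner_expand[of _ "inc a b _"] mult.assoc)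
qed

lemma expect_inner_same:
  assumes t: "0 \<le> a" "a \<le> b" "b \<le> T" and \<xi>: "coef a \<xi>" and \<zeta>: "coef a \<zeta>"
  shows "has_bochner_integral M (\<lambda>\<omega>. \<xi> \<omega> (inc a b \<omega>) \<bullet> \<zeta> \<omega> (inc a b \<omega>))
    ((b - a) * expectation (\<lambda>\<omega>. hs_inner (\<xi> \<omega>) (\<zeta> \<omega>)))"
proof -
  have "has_bochner_integral M (\<lambda>\<omega>. \<Sum>e\<in>Basis. \<Sum>f\<in>Basis.
      (\<xi> \<omega> e \<bullet> \<zeta> \<omega> f) * ((inc a b \<omega> \<bullet> e) * (inc a b \<omega> \<bullet> f)))
      (\<Sum>e\<in>(Basis :: (real ^ 'd) set). \<Sum>f\<in>(Basis :: (real ^ 'd) set).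
        if e = f then (b - a) * expectation (\<lambda>\<omega>. \<xi> \<omega> e \<bullet> \<zeta> \<omega> f) else 0)"
    using t by (intro has_bochner_integral_sum expect_times_inc_inc coef_inner[OF \<xi> \<zeta>]) auto
  moreover have "(\<Sum>e\<in>(Basis :: (real ^ 'd) set). \<Sum>f\<in>(Basis :: (real ^ 'd) set).
        if e = f then (b - a) * expectation (\<lambda>\<omega>. \<xi> \<omega> e \<bullet> \<zeta> \<omega> f) else 0)
      = (b - a) * expectation (\<lambda>\<omega>. hs_inner (\<xi> \<omega>) (\<zeta> \<omega>))"
    unfolding hs_inner_def using t coef_inner(3)[OF \<xi> \<zeta>]
    by (simp add: sum_distrib_left)
  ultimately show ?thesis by (simp add: blinfun_inner_expand[of _ "inc a b _"])
qed

text \<open>Both increments are split at \<open>c\<close> and at the end \<open>e\<close> of the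
  overlap. Of the six products only the square of the common piece has nonzero mean; the others
  involve disjoint intervals.\<close>

lemma expect_inner_ordered:
  assumes t: "0 \<le> a" "a \<le> b" "b \<le> T" "a \<le> c" "c \<le> d" "d \<le> T" and \<xi>: "coef a \<xi>" and \<zeta>: "coef c \<zeta>"
  shows "has_bochner_integral M (\<lambda>\<omega>. \<xi> \<omega> (inc a b \<omega>) \<bullet> \<zeta> \<omega> (inc c d \<omega>))
    (max 0 (min b d - c) * expectation (\<lambda>\<omega>. hs_inner (\<xi> \<omega>) (\<zeta> \<omega>)))"
proof (cases "b \<le> c")
  case True
  then show ?thesis using expect_inner_disjoint[OF t(1,2) True t(5,6) \<xi> \<zeta>] by simp
next
  case False
  define e where "e = min b d"
  have e: "c \<le> e" "e \<le> b" "e \<le> d" using False t by (auto simp: e_def)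
  have \<xi>c: "coef c \<xi>" "coef e \<xi>" and \<zeta>e: "coef e \<zeta>"
    using coef_mono[OF \<xi>] coef_mono[OF \<zeta>] t e by auto
  let ?f = "\<lambda>p q u v \<omega>. \<xi> \<omega> (inc p q \<omega>) \<bullet> \<zeta> \<omega> (inc u v \<omega>)"
  have 1: "has_bochner_integral M (?f a c c e) 0"
    using t e by (intro expect_inner_disjoint \<xi> \<zeta>) auto
  have 2: "has_bochner_integral M (?f a c e d) 0"
    using t e by (intro expect_inner_disjoint \<xi> \<zeta>e) auto
  have 3: "has_bochner_integral M (?f c e c e) ((e - c) * expectation (\<lambda>\<omega>. hs_inner (\<xi> \<omega>) (\<zeta> \<omega>)))"
    using t e by (intro expect_inner_same \<xi>c \<zeta>) auto
  have 4: "has_bochner_integral M (?f c e e d) 0"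
    using t e by (intro expect_inner_disjoint \<xi>c \<zeta>e) auto
  have "has_bochner_integral M (\<lambda>\<omega>. \<zeta> \<omega> (inc c e \<omega>) \<bullet> \<xi> \<omega> (inc e b \<omega>)) 0"
    using t e by (intro expect_inner_disjoint \<xi>c \<zeta>) auto
  then have 5: "has_bochner_integral M (?f e b c e) 0" by (simp add: inner_commute)
  \<comment> \<open>One of the two intervals ends at \<open>e\<close>, so one of the two last
    increments is 0.\<close>
  have "e = b \<or> e = d" by (auto simp: e_def)
  then have 6: "has_bochner_integral M (?f e b e d) 0" by (auto simp: has_bochner_integral_zero blinfun.zero_right)
  have "?f a b c d \<omega> = ?f a c c e \<omega> + ?f a c e d \<omega> + ?f c e c e \<omega> + ?f c e e d \<omega> + ?f e b c e \<omega> + ?f e b e d \<omega>" for \<omega>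
  proof -
    have "inc a b \<omega> = inc a c \<omega> + inc c e \<omega> + inc e b \<omega>" "inc c d \<omega> = inc c e \<omega> + inc e d \<omega>"
      by (simp_all add: inc_def)
    then show ?thesis by (simp add: blinfun.add_right inner_add_left inner_add_right)
  qed
  then show ?thesis
    using has_bochner_integral_add[OF has_bochner_integral_add[OF has_bochner_integral_add[OF
          has_bochner_integral_add[OF has_bochner_integral_add[OF 1 2] 3] 4] 5] 6] e
    by (simp add: e_def[symmetric])
qed

lemma expect_inner_increments:
  assumes t: "0 \<le> a" "a \<le> b" "b \<le> T" "0 \<le> c" "c \<le> d" "d \<le> T" and \<xi>: "coef a \<xi>" and \<zeta>: "coef c \<zeta>"
  shows "has_bochner_integral M (\<lambda>\<omega>. \<xi> \<omega> (inc a b \<omega>) \<bullet> \<zeta> \<omega> (inc c d \<omega>))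
    (max 0 (min b d - max a c) * expectation (\<lambda>\<omega>. hs_inner (\<xi> \<omega>) (\<zeta> \<omega>)))"
proof (cases "a \<le> c")
  case True
  then show ?thesis using expect_inner_ordered[OF t(1-3) True t(5,6) \<xi> \<zeta>] by (simp add: max_absorb2)
next
  case False
  then show ?thesis using expect_inner_ordered[OF t(4-6) _ t(2,3) \<zeta> \<xi>]
    by (simp add: max_absorb1 inner_commute min.commute hs_inner_commute)
qed

text \<open>Elementary processes, paired with their integrals and taken as a linear space: this avoids
  common refinements of partitions.\<close>

inductive simple :: "real \<Rightarrow> real \<Rightarrow> (real \<Rightarrow> 'w \<Rightarrow> (real ^ 'd) \<Rightarrow>\<^sub>L 'h::{real_inner, second_countable_topology}) \<Rightarrow>
    ('w \<Rightarrow> 'h) \<Rightarrow> bool" for s t where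
  base: "s \<le> a \<Longrightarrow> a \<le> b \<Longrightarrow> b \<le> t \<Longrightarrow> coef a \<xi> \<Longrightarrow>
    simple s t (\<lambda>r \<omega>. indicator {a<..b} r *\<^sub>R \<xi> \<omega>) (\<lambda>\<omega>. \<xi> \<omega> (inc a b \<omega>))"
| zero: "simple s t (\<lambda>r \<omega>. 0) (\<lambda>\<omega>. 0)"
| add: "simple s t X Y \<Longrightarrow> simple s t X' Y' \<Longrightarrow> simple s t (\<lambda>r \<omega>. X r \<omega> + X' r \<omega>) (\<lambda>\<omega>. Y \<omega> + Y' \<omega>)"
| scale: "simple s t X Y \<Longrightarrow> simple s t (\<lambda>r \<omega>. k *\<^sub>R X r \<omega>) (\<lambda>\<omega>. k *\<^sub>R Y \<omega>)"

lemma simple_diff: "simple s t X Y \<Longrightarrow> simple s t X' Y' \<Longrightarrow> simple s t (\<lambda>r \<omega>. X r \<omega> - X' r \<omega>) (\<lambda>\<omega>. Y \<omega> - Y' \<omega>)"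
  using simple.add[OF _ simple.scale[of s t X' Y' "-1"], of X Y] by simp

lemma simple_mono:
  assumes "simple s t X Y" "s' \<le> s" "t \<le> t'"
  shows "simple s' t' X Y"
  using assms by (induction rule: simple.induct) (auto intro: simple.intros)

lemma simple_outside: "simple s t X Y \<Longrightarrow> r \<notin> {s<..t} \<Longrightarrow> X r \<omega> = 0"
  by (induction rule: simple.induct) (auto simp: indicator_def)

text \<open>Bounded operators commute with elementary integrals; applied to a cut, this shows on
  which part of (0, T) a stochastic integral vanishes.\<close>

lemma simple_map:
  fixes R :: "'h::{real_inner, second_countable_topology} \<Rightarrow>\<^sub>L 'k::{real_inner, second_countable_topology}"
  assumes "simple s t X Y"
  shows "simple s t (\<lambda>r \<omega>. R o\<^sub>L X r \<omega>) (\<lambda>\<omega>. R (Y \<omega>))"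
  using assms
proof (induction rule: simple.induct)
  case (base a b \<xi>)
  have [measurable]: "blinfun_apply R \<in> borel_measurable borel"
    by (intro borel_measurable_continuous_onI linear_continuous_on blinfun.bounded_linear_right)
  obtain K where K: "\<And>\<omega>. \<omega> \<in> space M \<Longrightarrow> norm (\<xi> \<omega>) \<le> K" using base(4) unfolding coef_def by blast
  have "norm (R o\<^sub>L \<xi> \<omega>) \<le> norm R * K" if "\<omega> \<in> space M" for \<omega>
    using norm_blinfun_compose[of R "\<xi> \<omega>"] mult_left_mono[OF K[OF that], of "norm R"] by simp
  moreover have "(\<lambda>\<omega>. (R o\<^sub>L \<xi> \<omega>) x) \<in> borel_measurable (F a)" for x
  proof -
    have [measurable]: "(\<lambda>\<omega>. \<xi> \<omega> x) \<in> borel_measurable (F a)" using base(4) by (simp add: coef_def)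
    show ?thesis unfolding blinfun_apply_blinfun_compose by measurable
  qed
  ultimately have "coef a (\<lambda>\<omega>. R o\<^sub>L \<xi> \<omega>)"
    unfolding coef_def by blast
  from simple.base[OF base(1-3) this] show ?case by (simp add: bounded_bilinear.scaleR_right[OF bounded_bilinear_blinfun_compose])
next
  case (add X Y X' Y')
  from simple.add[OF add.IH] show ?case
    by (simp add: bounded_bilinear.add_right[OF bounded_bilinear_blinfun_compose] blinfun.add_right)
next
  case (scale X Y k)
  from simple.scale[OF scale.IH] show ?case
    by (simp add: bounded_bilinear.scaleR_right[OF bounded_bilinear_blinfun_compose] blinfun.scaleR_right)
qed (simp add: simple.zero blinfun.zero_right bounded_bilinear.zero_right[OF bounded_bilinear_blinfun_compose])

lemma simple_measurable:
  assumes "simple s t X Y" "0 \<le> s" "s \<le> t" "t \<le> T"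
  shows "Y \<in> borel_measurable (F t) \<and> (\<forall>x. (\<lambda>(r, \<omega>). X r \<omega> x) \<in> borel_measurable (lborel \<Otimes>\<^sub>M M))"
  using assms
proof (induction rule: simple.induct)
  case (base a b \<xi>)
  have \<xi>: "(\<lambda>\<omega>. \<xi> \<omega> x) \<in> borel_measurable (F a)" for x using base(4) by (simp add: coef_def)
  have "(\<lambda>\<omega>. \<xi> \<omega> (inc a b \<omega>)) \<in> borel_measurable (F t)"
  proof (rule measurable_blinfun_inc)
    show "(\<lambda>\<omega>. \<xi> \<omega> x) \<in> borel_measurable (F t)" for x
      using base by (intro measurable_F_mono[OF _ _ _ \<xi>]) auto
    show "inc a b \<in> borel_measurable (F t)"
      using base by (intro measurable_F_mono[of b t] measurable_inc) auto
  qed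
  moreover have "(\<lambda>(r, \<omega>). (indicator {a<..b} r *\<^sub>R \<xi> \<omega>) x) \<in> borel_measurable (lborel \<Otimes>\<^sub>M M)" for x
  proof -
    have [measurable]: "(\<lambda>\<omega>. \<xi> \<omega> x) \<in> borel_measurable M"
      using base by (intro measurable_F_M[OF _ _ \<xi>]) auto
    show ?thesis unfolding scaleR_blinfun.rep_eq by measurable
  qed
  ultimately show ?case by blast
next
  case (add X Y X' Y')
  have m: "(\<lambda>(r, \<omega>). X r \<omega> x) \<in> borel_measurable (lborel \<Otimes>\<^sub>M M)"
    "(\<lambda>(r, \<omega>). X' r \<omega> x) \<in> borel_measurable (lborel \<Otimes>\<^sub>M M)" for x
    using add by auto
  have "(\<lambda>(r, \<omega>). (X r \<omega> + X' r \<omega>) x) \<in> borel_measurable (lborel \<Otimes>\<^sub>M M)" for x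
    using borel_measurable_add[OF m(1) m(2), of x] by (simp add: plus_blinfun.rep_eq split_beta')
  then show ?case using add by (auto intro: borel_measurable_add)
next
  case (scale X Y k)
  have m: "(\<lambda>(r, \<omega>). X r \<omega> x) \<in> borel_measurable (lborel \<Otimes>\<^sub>M M)" for x
    using scale by auto
  have "(\<lambda>(r, \<omega>). (k *\<^sub>R X r \<omega>) x) \<in> borel_measurable (lborel \<Otimes>\<^sub>M M)" for x
    using borel_measurable_scaleR[OF borel_measurable_const m(1), of k x]
    by (simp add: scaleR_blinfun.rep_eq split_beta')
  then show ?case using scale by auto
qed (simp add: zero_blinfun.rep_eq)

text \<open>The polarised isometry for one pair of processes. Being bilinear, it is stable under
  sums and multiples in each argument, unlike the identity between squared norms; integrability is
  included so that the integral over time may be split.\<close>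

definition isometric :: "(real \<Rightarrow> 'w \<Rightarrow> (real ^ 'd) \<Rightarrow>\<^sub>L 'h::real_inner) \<Rightarrow> ('w \<Rightarrow> 'h) \<Rightarrow>
    (real \<Rightarrow> 'w \<Rightarrow> (real ^ 'd) \<Rightarrow>\<^sub>L 'h) \<Rightarrow> ('w \<Rightarrow> 'h) \<Rightarrow> bool" where
  "isometric X Y X' Y' \<longleftrightarrow>
    (\<exists>v. has_bochner_integral M (\<lambda>\<omega>. Y \<omega> \<bullet> Y' \<omega>) v \<and>
      has_bochner_integral M (\<lambda>\<omega>. LINT r|lborel. hs_inner (X r \<omega>) (X' r \<omega>)) v) \<and>
    (\<forall>\<omega>\<in>space M. integrable lborel (\<lambda>r. hs_inner (X r \<omega>) (X' r \<omega>)))"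

lemma isometric_commute: "isometric X Y X' Y' \<Longrightarrow> isometric X' Y' X Y"
  unfolding isometric_def by (simp add: inner_commute hs_inner_commute)

lemma isometric_zero_right: "isometric X Y (\<lambda>r \<omega>. 0) (\<lambda>\<omega>. 0)"
  unfolding isometric_def by (auto simp: has_bochner_integral_zero intro!: exI[of _ 0])

lemma isometric_add_right:
  assumes "isometric X Y X' Y'" "isometric X Y X'' Y''"
  shows "isometric X Y (\<lambda>r \<omega>. X' r \<omega> + X'' r \<omega>) (\<lambda>\<omega>. Y' \<omega> + Y'' \<omega>)"
proof -
  obtain v v' where v: "has_bochner_integral M (\<lambda>\<omega>. Y \<omega> \<bullet> Y' \<omega>) v"
      "has_bochner_integral M (\<lambda>\<omega>. LINT r|lborel. hs_inner (X r \<omega>) (X' r \<omega>)) v"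
      "has_bochner_integral M (\<lambda>\<omega>. Y \<omega> \<bullet> Y'' \<omega>) v'"
      "has_bochner_integral M (\<lambda>\<omega>. LINT r|lborel. hs_inner (X r \<omega>) (X'' r \<omega>)) v'"
    and i: "\<And>\<omega>. \<omega> \<in> space M \<Longrightarrow> integrable lborel (\<lambda>r. hs_inner (X r \<omega>) (X' r \<omega>))"
      "\<And>\<omega>. \<omega> \<in> space M \<Longrightarrow> integrable lborel (\<lambda>r. hs_inner (X r \<omega>) (X'' r \<omega>))"
    using assms unfolding isometric_def by blast
  have "has_bochner_integral M (\<lambda>\<omega>. Y \<omega> \<bullet> (Y' \<omega> + Y'' \<omega>)) (v + v')"
    using has_bochner_integral_add[OF v(1,3)] by (simp add: inner_add_right)
  moreover have "has_bochner_integral M (\<lambda>\<omega>. LINT r|lborel. hs_inner (X r \<omega>) (X' r \<omega> + X'' r \<omega>)) (v + v')"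
    using has_bochner_integral_add[OF v(2,4)]
    by (subst has_bochner_integral_cong[OF refl _ refl]) (auto simp: hs_inner_add_right i)
  ultimately show ?thesis unfolding isometric_def using i by (auto simp: hs_inner_add_right)
qed

lemma isometric_scale_right:
  assumes "isometric X Y X' Y'"
  shows "isometric X Y (\<lambda>r \<omega>. k *\<^sub>R X' r \<omega>) (\<lambda>\<omega>. k *\<^sub>R Y' \<omega>)"
proof -
  obtain v where v: "has_bochner_integral M (\<lambda>\<omega>. Y \<omega> \<bullet> Y' \<omega>) v"
      "has_bochner_integral M (\<lambda>\<omega>. LINT r|lborel. hs_inner (X r \<omega>) (X' r \<omega>)) v"
    and i: "\<And>\<omega>. \<omega> \<in> space M \<Longrightarrow> integrable lborel (\<lambda>r. hs_inner (X r \<omega>) (X' r \<omega>))"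
    using assms unfolding isometric_def by blast
  then show ?thesis
    unfolding isometric_def hs_inner_scaleR_right
    by (auto intro!: exI[of _ "k * v"] has_bochner_integral_mult_right)
qed

text \<open>An induction over each argument reduces the claim to two single intervals with random
  coefficients, where both sides equal the length of the overlap times the mean of
  \<open>hs_inner\<close>.\<close>

lemma simple_isometric:
  assumes X: "simple s t X Y" and X': "simple s t X' Y'" and st: "0 \<le> s" "t \<le> T"
  shows "isometric X Y X' Y'"
  using X
proof (induction rule: simple.induct)
  case (base a b \<xi>)
  note ab = base
  show ?case
    using X'
  proof (induction rule: simple.induct)
    case (base c d \<zeta>)
    define e where "e = max 0 (min b d - max a c)"
    have co: "coef (max a c) \<xi>" "coef (max a c) \<zeta>"
      using coef_mono[OF ab(4), of "max a c"] coef_mono[OF base(4), of "max a c"] ab base st by auto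
    have hs: "hs_inner (indicator {a<..b} r *\<^sub>R \<xi> \<omega>) (indicator {c<..d} r *\<^sub>R \<zeta> \<omega>)
        = indicator {max a c<..min b d} r * hs_inner (\<xi> \<omega>) (\<zeta> \<omega>)" for r \<omega>
      by (auto simp: hs_inner_scaleR_left hs_inner_scaleR_right indicator_def)
    have me: "measure lborel {max a c<..min b d} = e"
      by (cases "max a c \<le> min b d") (auto simp: e_def max_def)
    have i: "integrable lborel (\<lambda>r. indicator {max a c<..min b d} r * hs_inner (\<xi> \<omega>) (\<zeta> \<omega>))" for \<omega>
    proof -
      have "emeasure lborel {max a c<..min b d} < \<infinity>" by (intro emeasure_bounded_finite) auto
      then show ?thesis by (intro integrable_mult_left integrable_real_indicator) auto
    qed
    have "has_bochner_integral M (\<lambda>\<omega>. e * hs_inner (\<xi> \<omega>) (\<zeta> \<omega>)) (e * expectation (\<lambda>\<omega>. hs_inner (\<xi> \<omega>) (\<zeta> \<omega>)))"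
      using ab base st by (intro has_bochner_integral_mult_right has_bochner_integral_integrable
          hs_inner_coef_integrable[OF co]) auto
    moreover have "has_bochner_integral M (\<lambda>\<omega>. \<xi> \<omega> (inc a b \<omega>) \<bullet> \<zeta> \<omega> (inc c d \<omega>))
        (e * expectation (\<lambda>\<omega>. hs_inner (\<xi> \<omega>) (\<zeta> \<omega>)))"
      unfolding e_def using ab base st by (intro expect_inner_increments) auto
    ultimately show ?case
      unfolding isometric_def hs using i by (auto simp: me)
  next
    case zero then show ?case by (rule isometric_zero_right)
  next
    case (add X Y X' Y') then show ?case by (intro isometric_add_right)
  next
    case (scale X Y k) then show ?case by (intro isometric_scale_right)
  qed
next
  case zero
  show ?case by (rule isometric_commute[OF isometric_zero_right])
next
  case (add X Y X'' Y'')
  show ?case by (rule isometric_commute[OF isometric_add_right[OF add.IH[THEN isometric_commute]]])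
next
  case (scale X Y k)
  show ?case by (rule isometric_commute[OF isometric_scale_right[OF scale.IH[THEN isometric_commute]]])
qed

lemma simple_isometry:
  assumes X: "simple s t X Y" and st: "0 \<le> s" "t \<le> T"
  shows "(\<integral>\<^sup>+\<omega>. ennreal ((norm (Y \<omega>))\<^sup>2) \<partial>M)
    = (\<integral>\<^sup>+\<omega>. (\<integral>\<^sup>+r. ennreal ((hilbert_schmidt_norm (X r \<omega>))\<^sup>2) \<partial>lborel) \<partial>M)"
proof -
  obtain v where v: "has_bochner_integral M (\<lambda>\<omega>. (norm (Y \<omega>))\<^sup>2) v"
      "has_bochner_integral M (\<lambda>\<omega>. LINT r|lborel. (hilbert_schmidt_norm (X r \<omega>))\<^sup>2) v"
    and i: "\<And>\<omega>. \<omega> \<in> space M \<Longrightarrow> integrable lborel (\<lambda>r. (hilbert_schmidt_norm (X r \<omega>))\<^sup>2)"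
    using simple_isometric[OF X X st] unfolding isometric_def hs_inner_self power2_norm_eq_inner[symmetric] by blast
  have "(\<integral>\<^sup>+\<omega>. ennreal ((norm (Y \<omega>))\<^sup>2) \<partial>M) = ennreal v"
    using v(1) by (subst nn_integral_eq_integral) (auto simp: has_bochner_integral_iff)
  also have "\<dots> = (\<integral>\<^sup>+\<omega>. ennreal (LINT r|lborel. (hilbert_schmidt_norm (X r \<omega>))\<^sup>2) \<partial>M)"
    using v(2) by (subst nn_integral_eq_integral) (auto simp: has_bochner_integral_iff)
  also have "\<dots> = (\<integral>\<^sup>+\<omega>. (\<integral>\<^sup>+r. ennreal ((hilbert_schmidt_norm (X r \<omega>))\<^sup>2) \<partial>lborel) \<partial>M)"
    by (intro nn_integral_cong nn_integral_eq_integral[symmetric] i) auto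
  finally show ?thesis .
qed

subsection \<open>Uniqueness and additivity of the Ito integral\<close>

definition jointly_measurable where
  "jointly_measurable s t \<Phi> \<longleftrightarrow>
    (\<forall>x. (\<lambda>(r, \<omega>). indicator {s..t} r *\<^sub>R blinfun_apply (\<Phi> r \<omega>) x) \<in> borel_measurable (lborel \<Otimes>\<^sub>M M))"

definition ito_err where
  "ito_err s t X \<Phi> = (\<integral>\<^sup>+\<omega>. (\<integral>\<^sup>+r\<in>{s..t}. ennreal ((hilbert_schmidt_norm (X r \<omega> - \<Phi> r \<omega>))\<^sup>2) \<partial>lborel) \<partial>M)"

lemma simple_jointly_measurable:
  assumes "simple s' t' X Y" "0 \<le> s'" "s' \<le> t'" "t' \<le> T"
  shows "jointly_measurable s t X"
  unfolding jointly_measurable_def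
proof
  fix x
  have [measurable]: "(\<lambda>(r, \<omega>). X r \<omega> x) \<in> borel_measurable (lborel \<Otimes>\<^sub>M M)"
    using simple_measurable[OF assms] by blast
  have "(\<lambda>p. indicator {s..t} (fst p) *\<^sub>R (case p of (r, \<omega>) \<Rightarrow> X r \<omega> x)) \<in> borel_measurable (lborel \<Otimes>\<^sub>M M)"
    by measurable
  then show "(\<lambda>(r, \<omega>). indicator {s..t} r *\<^sub>R X r \<omega> x) \<in> borel_measurable (lborel \<Otimes>\<^sub>M M)"
    by (simp add: split_beta')
qed

lemma measurable_ito_err:
  fixes X \<Phi> :: "real \<Rightarrow> 'w \<Rightarrow> (real ^ 'd) \<Rightarrow>\<^sub>L 'h::{real_inner, second_countable_topology}"
  assumes X: "jointly_measurable s t X" and \<Phi>: "jointly_measurable s t \<Phi>"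
  shows "(\<lambda>(\<omega>, r). ennreal ((hilbert_schmidt_norm (X r \<omega> - \<Phi> r \<omega>))\<^sup>2) * indicator {s..t} r)
    \<in> borel_measurable (M \<Otimes>\<^sub>M lborel)"
proof -
  have m: "(\<lambda>p. indicator {s..t} (fst p) *\<^sub>R X (fst p) (snd p) x) \<in> borel_measurable (lborel \<Otimes>\<^sub>M M)"
    "(\<lambda>p. indicator {s..t} (fst p) *\<^sub>R \<Phi> (fst p) (snd p) x) \<in> borel_measurable (lborel \<Otimes>\<^sub>M M)" for x
    using X \<Phi> by (auto simp: jointly_measurable_def split_beta')
  have m': "(\<lambda>p. indicator {s..t} (snd p) *\<^sub>R X (snd p) (fst p) x) \<in> borel_measurable (M \<Otimes>\<^sub>M lborel)"
    "(\<lambda>p. indicator {s..t} (snd p) *\<^sub>R \<Phi> (snd p) (fst p) x) \<in> borel_measurable (M \<Otimes>\<^sub>M lborel)" for x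
    using measurable_compose[OF measurable_pair_swap' m(1)] measurable_compose[OF measurable_pair_swap' m(2)]
    by (auto simp: split_beta')
  have "(\<lambda>p. ennreal (\<Sum>c\<in>Basis. (norm (indicator {s..t} (snd p) *\<^sub>R X (snd p) (fst p) c
      - indicator {s..t} (snd p) *\<^sub>R \<Phi> (snd p) (fst p) c))\<^sup>2)) \<in> borel_measurable (M \<Otimes>\<^sub>M lborel)"
    by (intro measurable_compose[OF _ measurable_ennreal] borel_measurable_sum borel_measurable_power
        measurable_compose[OF borel_measurable_diff[OF m'] borel_measurable_norm])
  also have "(\<lambda>p. ennreal (\<Sum>c\<in>Basis. (norm (indicator {s..t} (snd p) *\<^sub>R X (snd p) (fst p) c
      - indicator {s..t} (snd p) *\<^sub>R \<Phi> (snd p) (fst p) c))\<^sup>2))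
      = (\<lambda>(\<omega>, r). ennreal ((hilbert_schmidt_norm (X r \<omega> - \<Phi> r \<omega>))\<^sup>2) * indicator {s..t} r)"
    by (auto simp: fun_eq_iff hilbert_schmidt_norm_sq minus_blinfun.rep_eq indicator_def)
  finally show ?thesis .
qed

text \<open>The isometry applies to the difference of the two processes, and \<Phi> is inserted
  between them. Outside the time interval both processes vanish, so the error there is 0.\<close>

lemma simple_dist_le:
  assumes X: "simple s t X Y" "simple s t X' Y'" and st: "0 \<le> s" "s \<le> t" "t \<le> T" and \<Phi>: "jointly_measurable s t \<Phi>"
  shows "(\<integral>\<^sup>+\<omega>. ennreal ((norm (Y \<omega> - Y' \<omega>))\<^sup>2) \<partial>M) \<le> 2 * ito_err s t X \<Phi> + 2 * ito_err s t X' \<Phi>"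
proof -
  let ?e = "\<lambda>X \<omega> r. ennreal ((hilbert_schmidt_norm (X r \<omega> - \<Phi> r \<omega>))\<^sup>2) * indicator {s..t} r"
  note m = measurable_ito_err[OF simple_jointly_measurable[OF X(1) st] \<Phi>]
    measurable_ito_err[OF simple_jointly_measurable[OF X(2) st] \<Phi>]
  have [measurable]: "(\<lambda>(\<omega>, r). ?e X \<omega> r) \<in> borel_measurable (M \<Otimes>\<^sub>M lborel)"
    "(\<lambda>(\<omega>, r). ?e X' \<omega> r) \<in> borel_measurable (M \<Otimes>\<^sub>M lborel)" using m by auto
  have [measurable]: "?e X \<omega> \<in> borel_measurable lborel" "?e X' \<omega> \<in> borel_measurable lborel" if "\<omega> \<in> space M" for \<omega>
    using measurable_Pair2[OF m(1) that] measurable_Pair2[OF m(2) that] by auto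
  have "(\<integral>\<^sup>+\<omega>. ennreal ((norm (Y \<omega> - Y' \<omega>))\<^sup>2) \<partial>M)
      = (\<integral>\<^sup>+\<omega>. (\<integral>\<^sup>+r. ennreal ((hilbert_schmidt_norm (X r \<omega> - X' r \<omega>))\<^sup>2) \<partial>lborel) \<partial>M)"
    by (rule simple_isometry[OF simple_diff[OF X] st(1,3)])
  also have "\<dots> \<le> (\<integral>\<^sup>+\<omega>. (\<integral>\<^sup>+r. 2 * ?e X \<omega> r + 2 * ?e X' \<omega> r \<partial>lborel) \<partial>M)"
  proof (intro nn_integral_mono)
    fix \<omega> r
    show "ennreal ((hilbert_schmidt_norm (X r \<omega> - X' r \<omega>))\<^sup>2) \<le> 2 * ?e X \<omega> r + 2 * ?e X' \<omega> r"
    proof (cases "r \<in> {s..t}")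
      case True
      then show ?thesis
        using ennreal_leI[OF hilbert_schmidt_norm_diff_sq[of "X r \<omega>" "X' r \<omega>" "\<Phi> r \<omega>"]]
        by (simp add: ennreal_mult)
    next
      case False
      then have "X r \<omega> = 0" "X' r \<omega> = 0" using X by (auto intro: simple_outside)
      then show ?thesis by (simp add: hilbert_schmidt_norm_def zero_blinfun.rep_eq)
    qed
  qed
  also have "\<dots> = (\<integral>\<^sup>+\<omega>. 2 * (\<integral>\<^sup>+r. ?e X \<omega> r \<partial>lborel) + 2 * (\<integral>\<^sup>+r. ?e X' \<omega> r \<partial>lborel) \<partial>M)"
    by (intro nn_integral_cong, subst nn_integral_add) (auto simp: nn_integral_cmult)
  also have "\<dots> = 2 * ito_err s t X \<Phi> + 2 * ito_err s t X' \<Phi>"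
    unfolding ito_err_def by (subst nn_integral_add) (auto simp: nn_integral_cmult)
  finally show ?thesis .
qed

text \<open>The approximation clause of \<open>has_ito_integral\<close> with step processes replaced
  by the linear space \<open>simple\<close>. Concatenated approximations remain in this class
  without re-indexing partitions.\<close>

definition approximable where
  "approximable s t \<Phi> I \<longleftrightarrow> I \<in> borel_measurable M \<and>
    (\<exists>X Y. (\<forall>k::nat. simple s t (X k) (Y k)) \<and> (\<lambda>k. ito_err s t (X k) \<Phi>) \<longlonglongrightarrow> 0 \<and>
      (\<lambda>k. \<integral>\<^sup>+\<omega>. ennreal ((norm (Y k \<omega> - I \<omega>))\<^sup>2) \<partial>M) \<longlonglongrightarrow> 0)"

lemma simple_sum:
  "(\<And>i. i < n \<Longrightarrow> simple s t (X i) (Y i)) \<Longrightarrow> simple s t (\<lambda>r \<omega>. \<Sum>i<n. X i r \<omega>) (\<lambda>\<omega>. \<Sum>i<n. Y i \<omega>)" for n :: nat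
proof (induction n)
  case 0
  then show ?case by (simp add: simple.zero)
next
  case (Suc n)
  have "simple s t (\<lambda>r \<omega>. (\<Sum>i<n. X i r \<omega>) + X n r \<omega>) (\<lambda>\<omega>. (\<Sum>i<n. Y i \<omega>) + Y n \<omega>)"
    by (rule simple.add[OF Suc.IH]) (auto intro: Suc.prems)
  then show ?case by simp
qed

lemma elementary_simple:
  assumes "elementary_process M F s t n \<tau> \<xi>"
  shows "simple s t (step_process n \<tau> \<xi>) (step_integral W n \<tau> \<xi>)"
proof -
  have mono: "i \<le> j \<Longrightarrow> j \<le> n \<Longrightarrow> \<tau> i \<le> \<tau> j" for i j
  proof (induction j)
    case (Suc j)
    show ?case
    proof (cases "i = Suc j")
      case False
      then have "\<tau> i \<le> \<tau> j" using Suc by auto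
      also have "\<tau> j \<le> \<tau> (Suc j)" using assms Suc.prems(2) by (simp add: elementary_process_def)
      finally show ?thesis .
    qed simp
  qed simp
  have "simple s t (\<lambda>r \<omega>. indicator {\<tau> i<..\<tau> (Suc i)} r *\<^sub>R \<xi> i \<omega>) (\<lambda>\<omega>. \<xi> i \<omega> (inc (\<tau> i) (\<tau> (Suc i)) \<omega>))" if "i < n" for i
  proof (rule simple.base)
    show "s \<le> \<tau> i" "\<tau> i \<le> \<tau> (Suc i)" "\<tau> (Suc i) \<le> t"
      using mono[of 0 i] mono[of i "Suc i"] mono[of "Suc i" n] that assms
      by (auto simp: elementary_process_def)
    show "coef (\<tau> i) (\<xi> i)" using assms that by (auto simp: elementary_process_def coef_def)
  qed
  from simple_sum[OF this] show ?thesis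
    by (simp add: step_process_def[abs_def] step_integral_def[abs_def] inc_def)
qed

lemma has_ito_integral_approximable:
  assumes "has_ito_integral M F W s t \<Phi> I"
  shows "jointly_measurable s t \<Phi>" "approximable s t \<Phi> I"
proof -
  show "jointly_measurable s t \<Phi>"
    using assms unfolding has_ito_integral_def jointly_measurable_def by blast
  obtain n \<tau> \<xi> where e: "\<And>k. elementary_process M F s t (n k) (\<tau> k) (\<xi> k)"
    and l: "(\<lambda>k. \<integral>\<^sup>+\<omega>. (\<integral>\<^sup>+r\<in>{s..t}.
        ennreal ((hilbert_schmidt_norm (step_process (n k) (\<tau> k) (\<xi> k) r \<omega> - \<Phi> r \<omega>))\<^sup>2) \<partial>lborel) \<partial>M) \<longlonglongrightarrow> 0"
      "(\<lambda>k. \<integral>\<^sup>+\<omega>. ennreal ((norm (step_integral W (n k) (\<tau> k) (\<xi> k) \<omega> - I \<omega>))\<^sup>2) \<partial>M) \<longlonglongrightarrow> 0"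
    using assms unfolding has_ito_integral_def by blast
  show "approximable s t \<Phi> I"
    unfolding approximable_def ito_err_def
  proof (intro conjI exI allI)
    show "I \<in> borel_measurable M" using assms unfolding has_ito_integral_def by blast
  qed (rule elementary_simple[OF e] l)+
qed

lemma AE_eq_of_small:
  fixes I I' :: "'w \<Rightarrow> 'h::{real_inner, second_countable_topology}"
  assumes [measurable]: "I \<in> borel_measurable M" "I' \<in> borel_measurable M"
    and le: "\<And>k::nat. (\<integral>\<^sup>+\<omega>. ennreal ((norm (I \<omega> - I' \<omega>))\<^sup>2) \<partial>M) \<le> e k" and e: "e \<longlonglongrightarrow> 0"
  shows "AE \<omega> in M. I \<omega> = I' \<omega>"
proof -
  have "(\<integral>\<^sup>+\<omega>. ennreal ((norm (I \<omega> - I' \<omega>))\<^sup>2) \<partial>M) \<le> 0"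
    using LIMSEQ_le_const[OF e] le by blast
  then have "AE \<omega> in M. ennreal ((norm (I \<omega> - I' \<omega>))\<^sup>2) = 0"
    by (subst nn_integral_0_iff_AE[symmetric]) auto
  then show ?thesis by eventually_elim simp
qed

lemma nn_integral_norm_triangle_sq:
  fixes A B C :: "'w \<Rightarrow> 'h::{real_inner, second_countable_topology}"
  assumes [measurable]: "A \<in> borel_measurable M" "B \<in> borel_measurable M" "C \<in> borel_measurable M"
  shows "(\<integral>\<^sup>+\<omega>. ennreal ((norm (A \<omega> - B \<omega>))\<^sup>2) \<partial>M)
    \<le> 2 * (\<integral>\<^sup>+\<omega>. ennreal ((norm (A \<omega> - C \<omega>))\<^sup>2) \<partial>M) + 2 * (\<integral>\<^sup>+\<omega>. ennreal ((norm (C \<omega> - B \<omega>))\<^sup>2) \<partial>M)"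
proof -
  have "(\<integral>\<^sup>+\<omega>. ennreal ((norm (A \<omega> - B \<omega>))\<^sup>2) \<partial>M)
      \<le> (\<integral>\<^sup>+\<omega>. 2 * ennreal ((norm (A \<omega> - C \<omega>))\<^sup>2) + 2 * ennreal ((norm (C \<omega> - B \<omega>))\<^sup>2) \<partial>M)"
  proof (rule nn_integral_mono)
    fix \<omega>
    have "(norm (A \<omega> - B \<omega>))\<^sup>2 \<le> 2 * (norm (A \<omega> - C \<omega>))\<^sup>2 + 2 * (norm (C \<omega> - B \<omega>))\<^sup>2"
      using norm_add_sq[of "A \<omega> - C \<omega>" "C \<omega> - B \<omega>"] by simp
    from ennreal_leI[OF this]
    show "ennreal ((norm (A \<omega> - B \<omega>))\<^sup>2) \<le> 2 * ennreal ((norm (A \<omega> - C \<omega>))\<^sup>2) + 2 * ennreal ((norm (C \<omega> - B \<omega>))\<^sup>2)"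
      by (simp add: ennreal_mult)
  qed
  also have "\<dots> = 2 * (\<integral>\<^sup>+\<omega>. ennreal ((norm (A \<omega> - C \<omega>))\<^sup>2) \<partial>M) + 2 * (\<integral>\<^sup>+\<omega>. ennreal ((norm (C \<omega> - B \<omega>))\<^sup>2) \<partial>M)"
    by (subst nn_integral_add) (auto simp: nn_integral_cmult)
  finally show ?thesis .
qed

lemma simple_measurable_M:
  assumes "simple s t X Y" "0 \<le> s" "s \<le> t" "t \<le> T"
  shows "Y \<in> borel_measurable M"
proof -
  have "Y \<in> borel_measurable (F t)" using simple_measurable[OF assms] by blast
  moreover have "0 \<le> t" using assms by linarith
  ultimately show ?thesis using measurable_F_M assms(4) by blast
qed

lemma tendsto_ennreal_cmult0: "f \<longlonglongrightarrow> 0 \<Longrightarrow> (\<lambda>k. c * f k) \<longlonglongrightarrow> 0" if "c < \<infinity>" for c :: ennreal and f :: "nat \<Rightarrow> ennreal"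
  using ennreal_tendsto_cmult[of c f 0 sequentially] that by simp

lemma tendsto_zero_ennreal_le:
  fixes f g :: "nat \<Rightarrow> ennreal"
  assumes "\<And>k. f k \<le> g k" "g \<longlonglongrightarrow> 0"
  shows "f \<longlonglongrightarrow> 0"
  by (rule tendsto_sandwich[OF _ _ tendsto_const assms(2)]) (simp_all add: assms(1))

text \<open>The distance of the two limits is compared through their approximations, whose mutual
  distance is controlled by the isometry.\<close>

lemma approximable_unique:
  assumes st: "0 \<le> s" "s \<le> t" "t \<le> T" and \<Phi>: "jointly_measurable s t \<Phi>"
    and I: "approximable s t \<Phi> I" and I': "approximable s t \<Phi> I'"
  shows "AE \<omega> in M. I \<omega> = I' \<omega>"
proof -
  obtain X Y where X: "\<And>k::nat. simple s t (X k) (Y k)" "(\<lambda>k. ito_err s t (X k) \<Phi>) \<longlonglongrightarrow> 0"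
      "(\<lambda>k. \<integral>\<^sup>+\<omega>. ennreal ((norm (Y k \<omega> - I \<omega>))\<^sup>2) \<partial>M) \<longlonglongrightarrow> 0"
    using I unfolding approximable_def by blast
  obtain X' Y' where X': "\<And>k::nat. simple s t (X' k) (Y' k)" "(\<lambda>k. ito_err s t (X' k) \<Phi>) \<longlonglongrightarrow> 0"
      "(\<lambda>k. \<integral>\<^sup>+\<omega>. ennreal ((norm (Y' k \<omega> - I' \<omega>))\<^sup>2) \<partial>M) \<longlonglongrightarrow> 0"
    using I' unfolding approximable_def by blast
  have m: "I \<in> borel_measurable M" "I' \<in> borel_measurable M" "\<And>k. Y k \<in> borel_measurable M" "\<And>k. Y' k \<in> borel_measurable M"
    using I I' simple_measurable_M[OF X(1) st] simple_measurable_M[OF X'(1) st]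
    by (auto simp: approximable_def)
  let ?d = "\<lambda>A B. \<integral>\<^sup>+\<omega>. ennreal ((norm (A \<omega> - B \<omega>))\<^sup>2) \<partial>M"
  define e where "e k = 2 * ?d (Y k) I + 2 * (2 * (2 * ito_err s t (X k) \<Phi> + 2 * ito_err s t (X' k) \<Phi>) + 2 * ?d (Y' k) I')" for k
  show ?thesis
  proof (rule AE_eq_of_small[OF m(1,2)])
    fix k
    have "?d I I' \<le> 2 * ?d I (Y k) + 2 * ?d (Y k) I'"
      by (rule nn_integral_norm_triangle_sq[OF m(1,2,3)])
    also have "?d I (Y k) = ?d (Y k) I" by (simp add: norm_minus_commute)
    also have "?d (Y k) I' \<le> 2 * ?d (Y k) (Y' k) + 2 * ?d (Y' k) I'"
      by (rule nn_integral_norm_triangle_sq[OF m(3,2,4)])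
    also have "?d (Y k) (Y' k) \<le> 2 * ito_err s t (X k) \<Phi> + 2 * ito_err s t (X' k) \<Phi>"
      by (rule simple_dist_le[OF X(1) X'(1) st \<Phi>])
    finally show "?d I I' \<le> e k" unfolding e_def by (simp add: mult_left_mono add_left_mono add_right_mono)
  next
    have "e \<longlonglongrightarrow> 0 + 2 * (2 * (0 + 0) + 0)"
      unfolding e_def[abs_def]
      by (intro tendsto_add tendsto_mult_ennreal tendsto_const tendsto_ennreal_cmult0 X X') auto
    then show "e \<longlonglongrightarrow> 0" by simp
  qed
qed

text \<open>The approximating processes live on the disjoint intervals (s, u] and (u, t], so their
  sum approximates \<Phi> with at most the sum of the errors.\<close>

lemma approximable_append:
  assumes st: "0 \<le> s" "s \<le> u" "u \<le> t" "t \<le> T"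
    and \<Phi>: "jointly_measurable s u \<Phi>" "jointly_measurable u t \<Phi>"
    and I: "approximable s u \<Phi> I" and I': "approximable u t \<Phi> I'"
  shows "approximable s t \<Phi> (\<lambda>\<omega>. I \<omega> + I' \<omega>)"
proof -
  obtain X Y where X: "\<And>k::nat. simple s u (X k) (Y k)" "(\<lambda>k. ito_err s u (X k) \<Phi>) \<longlonglongrightarrow> 0"
      "(\<lambda>k. \<integral>\<^sup>+\<omega>. ennreal ((norm (Y k \<omega> - I \<omega>))\<^sup>2) \<partial>M) \<longlonglongrightarrow> 0"
    using I unfolding approximable_def by blast
  obtain X' Y' where X': "\<And>k::nat. simple u t (X' k) (Y' k)" "(\<lambda>k. ito_err u t (X' k) \<Phi>) \<longlonglongrightarrow> 0"
      "(\<lambda>k. \<integral>\<^sup>+\<omega>. ennreal ((norm (Y' k \<omega> - I' \<omega>))\<^sup>2) \<partial>M) \<longlonglongrightarrow> 0"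
    using I' unfolding approximable_def by blast
  have m [measurable]: "I \<in> borel_measurable M" "I' \<in> borel_measurable M" "\<And>k. Y k \<in> borel_measurable M" "\<And>k. Y' k \<in> borel_measurable M"
    using I I' simple_measurable_M[OF X(1)] simple_measurable_M[OF X'(1)] st
    by (auto simp: approximable_def)
  have S: "simple s t (\<lambda>r \<omega>. X k r \<omega> + X' k r \<omega>) (\<lambda>\<omega>. Y k \<omega> + Y' k \<omega>)" for k
    using st by (intro simple.add simple_mono[OF X(1)] simple_mono[OF X'(1)]) auto
  have err: "ito_err s t (\<lambda>r \<omega>. X k r \<omega> + X' k r \<omega>) \<Phi> \<le> ito_err s u (X k) \<Phi> + ito_err u t (X' k) \<Phi>" for k
  proof -
    let ?e = "\<lambda>s t X \<omega> r. ennreal ((hilbert_schmidt_norm (X r \<omega> - \<Phi> r \<omega>))\<^sup>2) * indicator {s..t} r"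
    have mm: "(\<lambda>(\<omega>, r). ?e s u (X k) \<omega> r) \<in> borel_measurable (M \<Otimes>\<^sub>M lborel)"
      "(\<lambda>(\<omega>, r). ?e u t (X' k) \<omega> r) \<in> borel_measurable (M \<Otimes>\<^sub>M lborel)"
      using st by (auto intro!: measurable_ito_err \<Phi> simple_jointly_measurable[OF X(1)] simple_jointly_measurable[OF X'(1)])
    note [measurable] = mm
    have [measurable]: "?e s u (X k) \<omega> \<in> borel_measurable lborel" "?e u t (X' k) \<omega> \<in> borel_measurable lborel" if "\<omega> \<in> space M" for \<omega>
      using measurable_Pair2[OF mm(1) that] measurable_Pair2[OF mm(2) that] by auto
    have "ito_err s t (\<lambda>r \<omega>. X k r \<omega> + X' k r \<omega>) \<Phi> \<le> (\<integral>\<^sup>+\<omega>. (\<integral>\<^sup>+r. ?e s u (X k) \<omega> r + ?e u t (X' k) \<omega> r \<partial>lborel) \<partial>M)"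
      unfolding ito_err_def
    proof (intro nn_integral_mono)
      fix \<omega> r
      have "r \<in> {s..u} \<Longrightarrow> X' k r \<omega> = 0" "r \<in> {u<..t} \<Longrightarrow> X k r \<omega> = 0"
        using simple_outside[OF X(1), of r] simple_outside[OF X'(1), of r] by auto
      then show "ennreal ((hilbert_schmidt_norm (X k r \<omega> + X' k r \<omega> - \<Phi> r \<omega>))\<^sup>2) * indicator {s..t} r
          \<le> ?e s u (X k) \<omega> r + ?e u t (X' k) \<omega> r"
        using st by (cases "r \<le> u") (auto simp: indicator_def)
    qed
    also have "\<dots> = (\<integral>\<^sup>+\<omega>. (\<integral>\<^sup>+r. ?e s u (X k) \<omega> r \<partial>lborel) + (\<integral>\<^sup>+r. ?e u t (X' k) \<omega> r \<partial>lborel) \<partial>M)"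
      by (intro nn_integral_cong, subst nn_integral_add) auto
    also have "\<dots> = ito_err s u (X k) \<Phi> + ito_err u t (X' k) \<Phi>"
      unfolding ito_err_def by (subst nn_integral_add) auto
    finally show ?thesis .
  qed
  have "(\<lambda>k. ito_err s u (X k) \<Phi> + ito_err u t (X' k) \<Phi>) \<longlonglongrightarrow> 0"
    using tendsto_add[OF X(2) X'(2)] by simp
  then have 1: "(\<lambda>k. ito_err s t (\<lambda>r \<omega>. X k r \<omega> + X' k r \<omega>) \<Phi>) \<longlonglongrightarrow> 0"
    by (rule tendsto_zero_ennreal_le[OF err])
  let ?d = "\<lambda>A B. \<integral>\<^sup>+\<omega>. ennreal ((norm (A \<omega> - B \<omega>))\<^sup>2) \<partial>M"
  have le: "(\<integral>\<^sup>+\<omega>. ennreal ((norm (Y k \<omega> + Y' k \<omega> - (I \<omega> + I' \<omega>)))\<^sup>2) \<partial>M) \<le> 2 * ?d (Y k) I + 2 * ?d (Y' k) I'" for k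
    using nn_integral_norm_triangle_sq[of "\<lambda>\<omega>. Y k \<omega> + Y' k \<omega>" "\<lambda>\<omega>. I \<omega> + I' \<omega>" "\<lambda>\<omega>. I \<omega> + Y' k \<omega>"]
    by (simp add: add_diff_add)
  have "(\<lambda>k. 2 * ?d (Y k) I + 2 * ?d (Y' k) I') \<longlonglongrightarrow> 0 + 0"
    by (intro tendsto_add tendsto_ennreal_cmult0 X X') auto
  then have 2: "(\<lambda>k. \<integral>\<^sup>+\<omega>. ennreal ((norm (Y k \<omega> + Y' k \<omega> - (I \<omega> + I' \<omega>)))\<^sup>2) \<partial>M) \<longlonglongrightarrow> 0"
    by (intro tendsto_zero_ennreal_le[OF le]) simp
  show ?thesis
    unfolding approximable_def
  proof (intro conjI exI allI)
    show "(\<lambda>\<omega>. I \<omega> + I' \<omega>) \<in> borel_measurable M" by measurable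
  qed (rule S 1 2)+
qed

text \<open>Since \<open>R\<close> annihilates \<Phi>, the image under \<open>R\<close> of an
  approximating process is bounded by the approximation error, and the isometry transfers this to
  the integrals.\<close>

lemma approximable_kernel:
  fixes R :: "'h::{real_inner, second_countable_topology} \<Rightarrow>\<^sub>L 'h"
  assumes st: "0 \<le> s" "s \<le> t" "t \<le> T" and \<Phi>: "jointly_measurable s t \<Phi>"
    and I: "approximable s t \<Phi> I" and R: "\<And>x. norm (R x) \<le> norm x"
    and ker: "\<And>r \<omega> x. r \<in> {s..t} \<Longrightarrow> R (\<Phi> r \<omega> x) = 0"
  shows "AE \<omega> in M. R (I \<omega>) = 0"
proof -
  obtain X Y where X: "\<And>k::nat. simple s t (X k) (Y k)" "(\<lambda>k. ito_err s t (X k) \<Phi>) \<longlonglongrightarrow> 0"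
      "(\<lambda>k. \<integral>\<^sup>+\<omega>. ennreal ((norm (Y k \<omega> - I \<omega>))\<^sup>2) \<partial>M) \<longlonglongrightarrow> 0"
    using I unfolding approximable_def by blast
  have Rm [measurable]: "blinfun_apply R \<in> borel_measurable borel"
    by (intro borel_measurable_continuous_onI linear_continuous_on blinfun.bounded_linear_right)
  have m [measurable]: "I \<in> borel_measurable M" "\<And>k. Y k \<in> borel_measurable M"
    using I simple_measurable_M[OF X(1) st] by (auto simp: approximable_def)
  let ?d = "\<lambda>A B. \<integral>\<^sup>+\<omega>. ennreal ((norm (A \<omega> - B \<omega>))\<^sup>2) \<partial>M"
  have YR: "(\<integral>\<^sup>+\<omega>. ennreal ((norm (R (Y k \<omega>)))\<^sup>2) \<partial>M) \<le> ito_err s t (X k) \<Phi>" for k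
    unfolding simple_isometry[OF simple_map[OF X(1)] st(1,3)] ito_err_def
  proof (intro nn_integral_mono)
    fix \<omega> r
    show "ennreal ((hilbert_schmidt_norm (R o\<^sub>L X k r \<omega>))\<^sup>2)
        \<le> ennreal ((hilbert_schmidt_norm (X k r \<omega> - \<Phi> r \<omega>))\<^sup>2) * indicator {s..t} r"
    proof (cases "r \<in> {s..t}")
      case True
      have "norm (R (X k r \<omega> c)) \<le> norm ((X k r \<omega> - \<Phi> r \<omega>) c)" for c
        using R[of "(X k r \<omega> - \<Phi> r \<omega>) c"] ker[OF True, of \<omega> c]
        by (simp add: minus_blinfun.rep_eq blinfun.diff_right)
      then have "(hilbert_schmidt_norm (R o\<^sub>L X k r \<omega>))\<^sup>2 \<le> (hilbert_schmidt_norm (X k r \<omega> - \<Phi> r \<omega>))\<^sup>2"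
        unfolding hilbert_schmidt_norm_sq by (intro sum_mono power_mono) auto
      then show ?thesis using True by (simp add: ennreal_leI)
    next
      case False
      then have "X k r \<omega> = 0" using simple_outside[OF X(1), of r] by auto
      then show ?thesis by (simp add: hilbert_schmidt_norm_def zero_blinfun.rep_eq blinfun.zero_right)
    qed
  qed
  show ?thesis
  proof (rule AE_eq_of_small)
    fix k
    have "?d (\<lambda>\<omega>. R (I \<omega>)) (\<lambda>\<omega>. 0) \<le> 2 * ?d (\<lambda>\<omega>. R (I \<omega>)) (\<lambda>\<omega>. R (Y k \<omega>)) + 2 * ?d (\<lambda>\<omega>. R (Y k \<omega>)) (\<lambda>\<omega>. 0)"
      by (rule nn_integral_norm_triangle_sq) measurable
    also have "?d (\<lambda>\<omega>. R (I \<omega>)) (\<lambda>\<omega>. R (Y k \<omega>)) \<le> ?d (Y k) I"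
    proof (intro nn_integral_mono ennreal_leI power_mono)
      fix \<omega>
      show "norm (R (I \<omega>) - R (Y k \<omega>)) \<le> norm (Y k \<omega> - I \<omega>)"
        using R[of "I \<omega> - Y k \<omega>"] by (simp add: blinfun.diff_right norm_minus_commute)
    qed simp
    also have "?d (\<lambda>\<omega>. R (Y k \<omega>)) (\<lambda>\<omega>. 0) \<le> ito_err s t (X k) \<Phi>" using YR by simp
    finally show "?d (\<lambda>\<omega>. R (I \<omega>)) (\<lambda>\<omega>. 0) \<le> 2 * ?d (Y k) I + 2 * ito_err s t (X k) \<Phi>"
      by (simp add: mult_left_mono add_left_mono add_right_mono)
  next
    have "(\<lambda>k. 2 * ?d (Y k) I + 2 * ito_err s t (X k) \<Phi>) \<longlonglongrightarrow> 0 + 0"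
      by (intro tendsto_add tendsto_ennreal_cmult0 X) auto
    then show "(\<lambda>k. 2 * ?d (Y k) I + 2 * ito_err s t (X k) \<Phi>) \<longlonglongrightarrow> 0" by simp
  qed measurable
qed

end

subsection \<open>Existence and moments of the Ito integral\<close>

lemma nn_integral_AE_lim_le:
  fixes f :: "nat \<Rightarrow> 'a \<Rightarrow> ennreal"
  assumes [measurable]: "\<And>k. f k \<in> borel_measurable M"
    and lim: "AE x in M. (\<lambda>k. f k x) \<longlonglongrightarrow> g x"
    and le: "\<And>k. N \<le> k \<Longrightarrow> (\<integral>\<^sup>+x. f k x \<partial>M) \<le> c"
  shows "(\<integral>\<^sup>+x. g x \<partial>M) \<le> c"
proof -
  have "(\<integral>\<^sup>+x. g x \<partial>M) = (\<integral>\<^sup>+x. liminf (\<lambda>k. f k x) \<partial>M)"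
    by (rule nn_integral_cong_AE, use lim in eventually_elim) (auto intro: lim_imp_Liminf[symmetric])
  also have "\<dots> \<le> liminf (\<lambda>k. \<integral>\<^sup>+x. f k x \<partial>M)" by (rule nn_integral_liminf) measurable
  also have "\<dots> \<le> liminf (\<lambda>k. c)"
    using le by (intro Liminf_mono) (auto simp: eventually_sequentially)
  also have "\<dots> = c" by (simp add: Liminf_const)
  finally show ?thesis .
qed

context brownian
begin

text \<open>The interval containing \<open>r\<close> ends at the first partition point not before
  \<open>r\<close>. Intervals are open on the left, so \<open>r\<close> must exceed the first
  point.\<close>

lemma partition_step:
  fixes \<xi> :: "nat \<Rightarrow> 'w \<Rightarrow> (real ^ 'd) \<Rightarrow>\<^sub>L 'h::real_normed_vector"
  assumes mono: "\<And>i j. i \<le> j \<Longrightarrow> \<tau> i \<le> \<tau> j" and r: "\<tau> 0 < r" "r \<le> \<tau> n"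
  shows "\<exists>i<n. \<tau> i < r \<and> r \<le> \<tau> (Suc i) \<and> step_process n \<tau> \<xi> r \<omega> = \<xi> i \<omega>"
proof -
  define m where "m = (LEAST i. r \<le> \<tau> i)"
  have m: "r \<le> \<tau> m" unfolding m_def by (rule LeastI[of _ n]) (rule r)
  have "m \<noteq> 0" using m r(1) by (cases m) auto
  then obtain i where i: "m = Suc i" using not0_implies_Suc by blast
  have ir: "\<tau> i < r" using not_less_Least[of i "\<lambda>i. r \<le> \<tau> i"] i by (auto simp: m_def)
  have "i < n"
  proof (rule ccontr)
    assume "\<not> i < n"
    then have "\<tau> n \<le> \<tau> i" by (intro mono) simp
    then show False using ir r(2) by simp
  qed
  have "indicator {\<tau> j<..\<tau> (Suc j)} r *\<^sub>R \<xi> j \<omega> = (if j = i then \<xi> i \<omega> else 0)" for j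
  proof -
    consider "j = i" | "Suc j \<le> i" | "Suc i \<le> j" by linarith
    then show ?thesis
    proof cases
      case 2
      then show ?thesis using mono[OF 2] ir by (auto simp: indicator_def)
    next
      case 3
      then show ?thesis using mono[OF 3] m i by (auto simp: indicator_def)
    qed (use ir m i in \<open>simp add: indicator_def\<close>)
  qed
  then have "step_process n \<tau> \<xi> r \<omega> = \<xi> i \<omega>"
    using \<open>i < n\<close> by (simp add: step_process_def)
  then show ?thesis using \<open>i < n\<close> ir m i by auto
qed

lemma exists_approximating_partition:
  fixes \<Phi> :: "real \<Rightarrow> (real ^ 'd) \<Rightarrow>\<^sub>L 'h::{real_inner, second_countable_topology}"
  assumes st: "0 \<le> s" "s \<le> t" "t \<le> T" and \<Phi>: "continuous_on {s..t} \<Phi>" and e: "0 < e"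
  shows "\<exists>n \<tau>. elementary_process M F s t n \<tau> (\<lambda>i _. \<Phi> (\<tau> i)) \<and> \<tau> 0 = s \<and> \<tau> n = t \<and>
    ito_err s t (step_process n \<tau> (\<lambda>i _. \<Phi> (\<tau> i))) (\<lambda>r _. \<Phi> r) \<le> ennreal e"
proof -
  \<comment> \<open>The summand 1 keeps the quotient meaningful when s = t.\<close>
  define \<epsilon> where "\<epsilon> = e / (t - s + 1)"
  have \<epsilon>: "0 < \<epsilon>" "\<epsilon> * (t - s) \<le> e" using e st by (simp_all add: \<epsilon>_def field_simps)
  \<comment> \<open>Continuity is in operator norm; the factor CARD('d) accounts for the passage to
    the Hilbert-Schmidt norm.\<close>
  define \<eta> where "\<eta> = sqrt (\<epsilon> / real CARD('d))"
  have \<eta>: "0 < \<eta>" "real CARD('d) * \<eta>\<^sup>2 = \<epsilon>" using \<epsilon> by (simp_all add: \<eta>_def)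
  have "uniformly_continuous_on {s..t} \<Phi>"
    by (rule compact_uniformly_continuous[OF \<Phi>]) simp
  then obtain \<delta> where \<delta>: "0 < \<delta>"
      "\<And>r r'. r \<in> {s..t} \<Longrightarrow> r' \<in> {s..t} \<Longrightarrow> dist r' r < \<delta> \<Longrightarrow> dist (\<Phi> r') (\<Phi> r) < \<eta>"
    using \<eta>(1) unfolding uniformly_continuous_on_def by metis
  obtain n :: nat where "(t - s) / \<delta> < real n" using reals_Archimedean2 by blast
  moreover have "0 \<le> (t - s) / \<delta>" using st \<delta>(1) by simp
  ultimately have n: "0 < n" "(t - s) / real n < \<delta>"
  proof -
    assume a: "(t - s) / \<delta> < real n" "0 \<le> (t - s) / \<delta>"
    then have "0 < real n" by linarith
    moreover have "t - s < \<delta> * real n" using a(1) \<delta>(1) by (simp add: pos_divide_less_eq mult.commute)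
    ultimately show "0 < n" "(t - s) / real n < \<delta>" by (simp_all add: pos_divide_less_eq)
  qed
  define \<tau> where "\<tau> i = s + real i * ((t - s) / real n)" for i
  have \<tau>: "\<tau> 0 = s" "\<tau> n = t" using n by (simp_all add: \<tau>_def)
  have mono: "\<tau> i \<le> \<tau> j" if "i \<le> j" for i j
    using mult_right_mono[of "real i" "real j" "(t - s) / real n"] that st by (simp add: \<tau>_def)
  have el: "elementary_process M F s t n \<tau> (\<lambda>i _. \<Phi> (\<tau> i))"
    unfolding elementary_process_def using \<tau> mono by auto
  have "ito_err s t (step_process n \<tau> (\<lambda>i _. \<Phi> (\<tau> i))) (\<lambda>r _. \<Phi> r)
      \<le> (\<integral>\<^sup>+\<omega>. (\<integral>\<^sup>+r. ennreal \<epsilon> * indicator {s..t} r \<partial>lborel) \<partial>M)"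
    unfolding ito_err_def
  proof (rule nn_integral_mono, rule nn_integral_mono_AE)
    fix \<omega> :: 'w
    \<comment> \<open>At r = s the step process is 0, as all its intervals are open on the left;
      this single point is discarded.\<close>
    show "AE r in lborel. ennreal ((hilbert_schmidt_norm (step_process n \<tau> (\<lambda>i _. \<Phi> (\<tau> i)) r \<omega> - \<Phi> r))\<^sup>2)
        * indicator {s..t} r \<le> ennreal \<epsilon> * indicator {s..t} r"
      using AE_lborel_singleton[of s]
    proof eventually_elim
      case (elim r)
      show ?case
      proof (cases "r \<in> {s..t}")
        case True
        then obtain i where i: "i < n" "\<tau> i < r" "r \<le> \<tau> (Suc i)"
            "step_process n \<tau> (\<lambda>i _. \<Phi> (\<tau> i)) r \<omega> = \<Phi> (\<tau> i)"
          using partition_step[of \<tau> r n "\<lambda>i _. \<Phi> (\<tau> i)" \<omega>] mono \<tau> elim by auto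
        have "real (Suc i) * h - real i * h = h" for h by (simp add: algebra_simps)
        from this[of "(t - s) / real n"] have "\<tau> (Suc i) - \<tau> i = (t - s) / real n"
          unfolding \<tau>_def by linarith
        then have "dist (\<tau> i) r < \<delta>" using i n(2) by (simp add: dist_real_def)
        moreover have "\<tau> i \<in> {s..t}" using mono[of 0 i] mono[of i n] i(1) \<tau> by auto
        ultimately have "dist (\<Phi> (\<tau> i)) (\<Phi> r) < \<eta>" using \<delta>(2) True by blast
        then have "(norm (\<Phi> (\<tau> i) - \<Phi> r))\<^sup>2 \<le> \<eta>\<^sup>2" by (intro power_mono) (auto simp: dist_norm)
        then have "real CARD('d) * (norm (\<Phi> (\<tau> i) - \<Phi> r))\<^sup>2 \<le> \<epsilon>"
          unfolding \<eta>(2)[symmetric] by (intro mult_left_mono) auto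
        then have "(hilbert_schmidt_norm (\<Phi> (\<tau> i) - \<Phi> r))\<^sup>2 \<le> \<epsilon>"
          using hilbert_schmidt_norm_le[of "\<Phi> (\<tau> i) - \<Phi> r"] by linarith
        then show ?thesis using True i(4) by (simp add: ennreal_leI)
      qed simp
    qed
  qed
  also have "\<dots> = ennreal (\<epsilon> * (t - s))"
    using st \<epsilon>(1) by (simp add: nn_integral_cmult emeasure_space_1 ennreal_mult)
  also have "\<dots> \<le> ennreal e" using \<epsilon>(2) by (rule ennreal_leI)
  finally show ?thesis using el \<tau> by blast
qed

text \<open>Integrals of step approximations form a fast Cauchy sequence and so converge almost
  surely as well as in mean square. The uniform cosh bound passes to the limit by Fatou and yields
  every moment.\<close>

lemma has_ito_integral_exists:
  fixes \<Phi> :: "real \<Rightarrow> (real ^ 'd) \<Rightarrow>\<^sub>L 'h::{real_inner, banach, second_countable_topology}"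
  assumes st: "0 \<le> s" "s \<le> t" "t \<le> T" and \<Phi>: "continuous_on {s..t} \<Phi>"
  shows "\<exists>I. has_ito_integral M F W s t (\<lambda>r _. \<Phi> r) I \<and> I \<in> borel_measurable (F t) \<and>
    (\<forall>q>0. integrable M (\<lambda>\<omega>. norm (I \<omega>) powr q))"
proof -
  \<comment> \<open>The error (1/8)^k outweighs the factor 2^k required by
    \<open>norm_series_Cauchy\<close> and leaves a geometric series of ratio 1/4.\<close>
  have "\<forall>k. \<exists>n \<tau>. elementary_process M F s t n \<tau> (\<lambda>i _. \<Phi> (\<tau> i)) \<and> \<tau> 0 = s \<and> \<tau> n = t \<and>
      ito_err s t (step_process n \<tau> (\<lambda>i _. \<Phi> (\<tau> i))) (\<lambda>r _. \<Phi> r) \<le> ennreal ((1 / 8) ^ k)"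
    by (intro allI exists_approximating_partition st \<Phi>) simp
  then obtain n \<tau> where el: "\<And>k::nat. elementary_process M F s t (n k) (\<tau> k) (\<lambda>i _. \<Phi> (\<tau> k i))"
    and \<tau>: "\<And>k. \<tau> k 0 = s" "\<And>k. \<tau> k (n k) = t"
    and err: "\<And>k. ito_err s t (step_process (n k) (\<tau> k) (\<lambda>i _. \<Phi> (\<tau> k i))) (\<lambda>r _. \<Phi> r) \<le> ennreal ((1 / 8) ^ k)"
    by metis
  define X where "X k = step_process (n k) (\<tau> k) (\<lambda>i (_::'w). \<Phi> (\<tau> k i))" for k
  define Y where "Y k = step_integral W (n k) (\<tau> k) (\<lambda>i (_::'w). \<Phi> (\<tau> k i))" for k
  have S: "simple s t (X k) (Y k)" for k unfolding X_def Y_def by (rule elementary_simple[OF el])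
  have jm: "jointly_measurable s t (\<lambda>r _. \<Phi> r)"
    unfolding jointly_measurable_def
  proof
    fix x
    have "continuous_on {s..t} (\<lambda>r. \<Phi> r x)"
      by (intro bounded_linear.continuous_on[OF blinfun.bounded_linear_left] \<Phi>)
    then have [measurable]: "(\<lambda>r. indicator {s..t} r *\<^sub>R \<Phi> r x) \<in> borel_measurable borel"
      by (intro borel_measurable_continuous_on_indicator) auto
    show "(\<lambda>(r, \<omega>). indicator {s..t} r *\<^sub>R \<Phi> r x) \<in> borel_measurable (lborel \<Otimes>\<^sub>M M)" by measurable
  qed
  have YF: "Y k \<in> borel_measurable (F t)" for k using simple_measurable[OF S st] by blast
  have [measurable]: "Y k \<in> borel_measurable M" for k by (rule simple_measurable_M[OF S st])
  let ?d = "\<lambda>A B. \<integral>\<^sup>+\<omega>. ennreal ((norm (A \<omega> - B \<omega>))\<^sup>2) \<partial>M"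
  have dist: "?d (Y k) (Y j) \<le> ennreal (4 * (1 / 8) ^ k)" if "k \<le> j" for k j
  proof -
    have "?d (Y k) (Y j) \<le> 2 * ito_err s t (X k) (\<lambda>r _. \<Phi> r) + 2 * ito_err s t (X j) (\<lambda>r _. \<Phi> r)"
      by (rule simple_dist_le[OF S S st jm])
    also have "\<dots> \<le> 2 * ennreal ((1 / 8) ^ k) + 2 * ennreal ((1 / 8) ^ k)"
    proof -
      have "ennreal ((1 / 8) ^ j) \<le> ennreal ((1 / 8) ^ k)"
        using that by (intro ennreal_leI power_decreasing) auto
      then have "ito_err s t (X j) (\<lambda>r _. \<Phi> r) \<le> ennreal ((1 / 8) ^ k)"
        using err[of j] unfolding X_def by (rule order_trans[rotated])
      then show ?thesis using err[of k] unfolding X_def by (intro add_mono mult_left_mono) auto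
    qed
    also have "\<dots> = ennreal (4 * (1 / 8) ^ k)"
    proof -
      have "4 * (1 / 8) ^ k = 2 * (1 / 8) ^ k + (2 * (1 / 8) ^ k :: real)" by simp
      then show ?thesis by (simp only: ennreal_plus ennreal_mult ennreal_numeral zero_le_power zero_le_numeral
            zero_le_divide_1_iff mult_nonneg_nonneg)
    qed
    finally show ?thesis .
  qed
  have "(\<integral>\<^sup>+\<omega>. (\<Sum>k. ennreal (2 ^ k * (norm (Y (Suc k) \<omega> - Y k \<omega>))\<^sup>2)) \<partial>M)
      = (\<Sum>k. \<integral>\<^sup>+\<omega>. ennreal (2 ^ k * (norm (Y (Suc k) \<omega> - Y k \<omega>))\<^sup>2) \<partial>M)"
    by (rule nn_integral_suminf) measurable
  also have "\<dots> \<le> (\<Sum>k. ennreal (4 * (1 / 4) ^ k))"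
  proof (intro suminf_le allI)
    fix k
    have "(\<integral>\<^sup>+\<omega>. ennreal (2 ^ k * (norm (Y (Suc k) \<omega> - Y k \<omega>))\<^sup>2) \<partial>M) = ennreal (2 ^ k) * ?d (Y k) (Y (Suc k))"
      by (subst nn_integral_cmult[symmetric]) (auto simp: ennreal_mult norm_minus_commute)
    also have "\<dots> \<le> ennreal (2 ^ k) * ennreal (4 * (1 / 8) ^ k)"
      by (intro mult_left_mono dist) auto
    also have "\<dots> = ennreal (4 * (1 / 4) ^ k)"
    proof -
      have "2 ^ k * (4 * (1 / 8) ^ k) = 4 * ((2 * (1 / 8)) ^ k :: real)" by (simp only: power_mult_distrib mult_ac)
      then show ?thesis by (simp add: ennreal_mult[symmetric])
    qed
    finally show "(\<integral>\<^sup>+\<omega>. ennreal (2 ^ k * (norm (Y (Suc k) \<omega> - Y k \<omega>))\<^sup>2) \<partial>M) \<le> ennreal (4 * (1 / 4) ^ k)" .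
  qed auto
  also have "\<dots> = ennreal (\<Sum>k. 4 * (1 / 4) ^ k)"
    by (intro suminf_ennreal2) (auto intro!: summable_mult summable_geometric)
  also have "\<dots> < \<infinity>" by simp
  finally have "AE \<omega> in M. (\<Sum>k. ennreal (2 ^ k * (norm (Y (Suc k) \<omega> - Y k \<omega>))\<^sup>2)) \<noteq> \<infinity>"
    by (intro nn_integral_PInf_AE) auto
  then have conv: "AE \<omega> in M. convergent (\<lambda>k. Y k \<omega>)"
  proof eventually_elim
    case (elim \<omega>)
    then have "summable (\<lambda>k. 2 ^ k * (norm (Y (Suc k) \<omega> - Y k \<omega>))\<^sup>2)"
      by (intro summable_suminf_not_top) auto
    then show ?case by (rule norm_series_Cauchy[of "\<lambda>k. Y k \<omega>"])
  qed
  \<comment> \<open>A pointwise limit of \<open>F t\<close>-measurable functions is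
    \<open>F t\<close>-measurable without modification on a null set.\<close>
  define I where "I \<omega> = lim (\<lambda>k. Y k \<omega>)" for \<omega>
  have lim: "AE \<omega> in M. (\<lambda>k. Y k \<omega>) \<longlonglongrightarrow> I \<omega>"
    using conv by eventually_elim (simp add: I_def convergent_LIMSEQ_iff)
  have IF: "I \<in> borel_measurable (F t)"
    unfolding I_def[abs_def] by (rule borel_measurable_lim_metric[OF YF])
  have t: "0 \<le> t" using st by linarith
  have [measurable]: "I \<in> borel_measurable M" by (rule measurable_F_M[OF t st(3) IF])
  have YI: "?d (Y k) I \<le> ennreal (4 * (1 / 8) ^ k)" for k
  proof (rule nn_integral_AE_lim_le[where f="\<lambda>j \<omega>. ennreal ((norm (Y k \<omega> - Y j \<omega>))\<^sup>2)" and N=k])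
    show "AE \<omega> in M. (\<lambda>j. ennreal ((norm (Y k \<omega> - Y j \<omega>))\<^sup>2)) \<longlonglongrightarrow> ennreal ((norm (Y k \<omega> - I \<omega>))\<^sup>2)"
      using lim by eventually_elim (intro tendsto_intros)
  qed (use dist in auto)
  have "bounded (\<Phi> ` {s..t})" by (intro compact_imp_bounded compact_continuous_image \<Phi>) simp
  then obtain K where K: "\<And>r. r \<in> {s..t} \<Longrightarrow> norm (\<Phi> r) \<le> K" unfolding bounded_iff by blast
  \<comment> \<open>Bounds the exponent for every partition: the mesh lengths add up to t - s, and
    each squared Hilbert-Schmidt norm is at most CARD('d) K^2.\<close>
  define c where "c = (real CARD('d))\<^sup>2 / 2 * ((t - s) * (real CARD('d) * K\<^sup>2))"
  have cosh_meas [measurable]: "(cosh :: real \<Rightarrow> real) \<in> borel_measurable borel"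
    by (intro borel_measurable_continuous_onI continuous_intros)
  have coshY: "(\<integral>\<^sup>+\<omega>. ennreal (cosh (norm (Y k \<omega>))) \<partial>M) \<le> ennreal (exp c)" for k
  proof -
    have \<tau>_mono: "\<tau> k i \<le> \<tau> k (Suc i)" if "i < n k" for i
      using el[of k] that by (simp add: elementary_process_def)
    have up: "s \<le> \<tau> k i \<and> \<tau> k i \<le> t" if "i \<le> n k" for i
    proof
      show "s \<le> \<tau> k i" using that
      proof (induction i)
        case (Suc i)
        then show ?case using \<tau>_mono[of i] by simp
      qed (simp add: \<tau>)
      show "\<tau> k i \<le> t" using that
      proof (induction i rule: inc_induct)
        case (step i)
        then show ?case using \<tau>_mono[of i] by simp
      qed (simp add: \<tau>)
    qed
    have "(\<Sum>i<n k. (\<tau> k (Suc i) - \<tau> k i) * (hilbert_schmidt_norm (\<Phi> (\<tau> k i)))\<^sup>2)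
        \<le> (\<Sum>i<n k. (\<tau> k (Suc i) - \<tau> k i) * (real CARD('d) * K\<^sup>2))"
    proof (intro sum_mono mult_left_mono)
      fix i assume i: "i \<in> {..<n k}"
      have "norm (\<Phi> (\<tau> k i)) \<le> K" using K up[of i] i by auto
      then have "real CARD('d) * (norm (\<Phi> (\<tau> k i)))\<^sup>2 \<le> real CARD('d) * K\<^sup>2"
        by (intro mult_left_mono power_mono) auto
      then show "(hilbert_schmidt_norm (\<Phi> (\<tau> k i)))\<^sup>2 \<le> real CARD('d) * K\<^sup>2"
        by (rule order_trans[OF hilbert_schmidt_norm_le])
      show "0 \<le> \<tau> k (Suc i) - \<tau> k i" using \<tau>_mono[of i] i by simp
    qed
    also have "\<dots> = (t - s) * (real CARD('d) * K\<^sup>2)"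
      by (simp only: sum_distrib_right[symmetric] sum_lessThan_telescope \<tau>)
    finally have le: "(real CARD('d))\<^sup>2 / 2 * (\<Sum>i<n k. (\<tau> k (Suc i) - \<tau> k i) * (hilbert_schmidt_norm (\<Phi> (\<tau> k i)))\<^sup>2) \<le> c"
      unfolding c_def by (rule mult_left_mono) simp
    have "(\<integral>\<^sup>+\<omega>. ennreal (cosh (norm (\<Sum>i<n k. \<Phi> (\<tau> k i) (inc (\<tau> k i) (\<tau> k (Suc i)) \<omega>)))) \<partial>M)
      \<le> ennreal (exp ((real CARD('d))\<^sup>2 / 2 * (\<Sum>i<n k. (\<tau> k (Suc i) - \<tau> k i) * (hilbert_schmidt_norm (\<Phi> (\<tau> k i)))\<^sup>2)))"
      using step_cosh_moment[of "\<tau> k" "n k" "\<lambda>i. \<Phi> (\<tau> k i)"] \<tau> st \<tau>_mono by simp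
    also have "\<dots> \<le> ennreal (exp c)" using le by (intro ennreal_leI) simp
    finally show ?thesis by (simp add: Y_def step_integral_def inc_def)
  qed
  have coshI: "(\<integral>\<^sup>+\<omega>. ennreal (cosh (norm (I \<omega>))) \<partial>M) \<le> ennreal (exp c)"
  proof (rule nn_integral_AE_lim_le[where f="\<lambda>j \<omega>. ennreal (cosh (norm (Y j \<omega>)))" and N=0])
    show "AE \<omega> in M. (\<lambda>j. ennreal (cosh (norm (Y j \<omega>)))) \<longlonglongrightarrow> ennreal (cosh (norm (I \<omega>)))"
      using lim by eventually_elim (intro tendsto_intros)
  qed (use coshY in auto)
  have pow: "integrable M (\<lambda>\<omega>. norm (I \<omega>) powr q)" if q: "0 < q" for q
  proof -
    obtain K where K: "0 \<le> K" "\<And>x. 0 \<le> x \<Longrightarrow> x powr q \<le> K * cosh x" using powr_le_cosh[OF q] by blast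
    have "integrable M (\<lambda>\<omega>. cosh (norm (I \<omega>)))"
      using coshI by (intro integrableI_bounded) (auto intro: le_less_trans)
    then have "integrable M (\<lambda>\<omega>. K * cosh (norm (I \<omega>)))" by simp
    then show ?thesis
      by (rule Bochner_Integration.integrable_bound) (use K in auto)
  qed
  have "has_ito_integral M F W s t (\<lambda>r _. \<Phi> r) I"
    unfolding has_ito_integral_def
  proof (intro conjI allI)
    show "(\<lambda>(r, \<omega>). indicator {s..t} r *\<^sub>R \<Phi> r x) \<in> borel_measurable (lborel \<Otimes>\<^sub>M M)" for x
      using jm unfolding jointly_measurable_def by blast
    show "integrable M (\<lambda>\<omega>. (norm (I \<omega>))\<^sup>2)"
      using pow[of 2] by (simp add: powr_numeral)
    have "(\<lambda>k. (1 / 8 :: real) ^ k) \<longlonglongrightarrow> 0" by (intro LIMSEQ_realpow_zero) auto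
    then have "(\<lambda>k. ennreal ((1 / 8) ^ k)) \<longlonglongrightarrow> ennreal 0" by (rule tendsto_ennrealI)
    then have z: "(\<lambda>k. ennreal ((1 / 8) ^ k)) \<longlonglongrightarrow> 0" by simp
    have z4: "(\<lambda>k. ennreal (4 * (1 / 8) ^ k)) \<longlonglongrightarrow> 0"
      using tendsto_ennreal_cmult0[OF _ z, of 4] by (simp add: ennreal_mult)
    show "\<exists>n \<tau> \<xi>. (\<forall>k. elementary_process M F s t (n k) (\<tau> k) (\<xi> k)) \<and>
      (\<lambda>k. \<integral>\<^sup>+\<omega>. (\<integral>\<^sup>+r\<in>{s..t}.
        ennreal ((hilbert_schmidt_norm (step_process (n k) (\<tau> k) (\<xi> k) r \<omega> - \<Phi> r))\<^sup>2) \<partial>lborel) \<partial>M)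
        \<longlonglongrightarrow> 0 \<and>
      (\<lambda>k. \<integral>\<^sup>+\<omega>. ennreal ((norm (step_integral W (n k) (\<tau> k) (\<xi> k) \<omega> - I \<omega>))\<^sup>2) \<partial>M)
        \<longlonglongrightarrow> 0"
    proof (intro exI conjI allI)
      show "elementary_process M F s t (n k) (\<tau> k) (\<lambda>i _. \<Phi> (\<tau> k i))" for k by (rule el)
      show "(\<lambda>k. \<integral>\<^sup>+\<omega>. (\<integral>\<^sup>+r\<in>{s..t}.
        ennreal ((hilbert_schmidt_norm (step_process (n k) (\<tau> k) (\<lambda>i _. \<Phi> (\<tau> k i)) r \<omega> - \<Phi> r))\<^sup>2) \<partial>lborel) \<partial>M)
        \<longlonglongrightarrow> 0"
        using tendsto_zero_ennreal_le[OF err z] unfolding ito_err_def .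
      show "(\<lambda>k. \<integral>\<^sup>+\<omega>. ennreal ((norm (step_integral W (n k) (\<tau> k) (\<lambda>i _. \<Phi> (\<tau> k i)) \<omega> - I \<omega>))\<^sup>2) \<partial>M)
        \<longlonglongrightarrow> 0"
        using tendsto_zero_ennreal_le[OF YI z4] unfolding Y_def .
    qed
  qed measurable
  then show ?thesis using IF pow by blast
qed

text \<open>The two functions differ on a null set, and all null sets belong to \<open>F 0\<close>.
  This gives adaptedness of an arbitrary version of a solution.\<close>

lemma measurable_F_AE:
  fixes f g :: "'w \<Rightarrow> 'b::topological_space"
  assumes t: "0 \<le> t" "t \<le> T" and f: "f \<in> borel_measurable M" and g: "g \<in> borel_measurable (F t)"
    and eq: "AE \<omega> in M. f \<omega> = g \<omega>"
  shows "f \<in> borel_measurable (F t)"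
proof (rule measurableI)
  have sp: "space (F t) = space M" using subalgebra_F[OF t] by (simp add: subalgebra_def)
  have null: "N \<in> sets (F t)" if "N \<in> null_sets M" for N
  proof -
    have "null_sets M \<subseteq> sets (F 0)" using usual by (simp add: usual_filtered_space_def)
    moreover have "sets (F 0) \<subseteq> sets (F t)" using F_mono[of 0 t] t by (simp add: subalgebra_def)
    ultimately show ?thesis using that by blast
  qed
  fix A :: "'b set" assume A: "A \<in> sets borel"
  obtain N where N: "{\<omega> \<in> space M. f \<omega> \<noteq> g \<omega>} \<subseteq> N" "N \<in> null_sets M"
    using eq by (auto elim!: AE_E simp: null_sets_def)
  have "f -` A \<inter> space M \<inter> N \<in> null_sets M"
    by (rule null_set_Int1[OF N(2) measurable_sets[OF f A]])
  moreover have "f -` A \<inter> space (F t) = (g -` A \<inter> space (F t) - N) \<union> (f -` A \<inter> space M \<inter> N)"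
    using N(1) by (auto simp: sp)
  ultimately show "f -` A \<inter> space (F t) \<in> sets (F t)"
    using null[OF N(2)] null measurable_sets[OF g A] by simp
qed simp

end

subsection \<open>The fractional kernel\<close>

definition volterra_kernel :: "real \<Rightarrow> real \<Rightarrow> real" where
  "volterra_kernel \<alpha> u = indicator {0<..} u * fractional_kernel \<alpha> u"

text \<open>The integral of k^2 over (0, c), finite near 0 because 2 \<alpha> - 1 is
  positive.\<close>

definition kernel_energy :: "real \<Rightarrow> real \<Rightarrow> real" where
  "kernel_energy \<alpha> c = (1 / Gamma \<alpha>)\<^sup>2 * (c powr (2 * \<alpha> - 1) / (2 * \<alpha> - 1))"

lemma measurable_kernel [measurable]: "volterra_kernel \<alpha> \<in> borel_measurable borel"
  unfolding volterra_kernel_def[abs_def] fractional_kernel_def by measurable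

lemma kernel_sq_integral:
  assumes \<alpha>: "1 / 2 < \<alpha>" and c: "0 \<le> c"
  shows "(\<integral>\<^sup>+u. ennreal ((volterra_kernel \<alpha> u)\<^sup>2) * indicator {..c} u \<partial>lborel) = ennreal (kernel_energy \<alpha> c)"
proof -
  have "ennreal ((volterra_kernel \<alpha> u)\<^sup>2) * indicator {..c} u
      = ennreal ((1 / Gamma \<alpha>)\<^sup>2) * (ennreal (u powr (2 * \<alpha> - 2)) * indicator {0..c} u)" for u
  proof (cases "0 < u")
    case True
    have "(u powr (\<alpha> - 1))\<^sup>2 = u powr (2 * \<alpha> - 2)"
      by (simp add: power2_eq_square powr_add[symmetric])
    then show ?thesis using True
      by (simp add: volterra_kernel_def fractional_kernel_def power_mult_distrib power_divide ennreal_mult[symmetric]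
          indicator_def)
  qed (auto simp: volterra_kernel_def indicator_def)
  then have "(\<integral>\<^sup>+u. ennreal ((volterra_kernel \<alpha> u)\<^sup>2) * indicator {..c} u \<partial>lborel)
      = ennreal ((1 / Gamma \<alpha>)\<^sup>2) * (\<integral>\<^sup>+u. ennreal (u powr (2 * \<alpha> - 2)) * indicator {0..c} u \<partial>lborel)"
    by (simp add: nn_integral_cmult)
  also have "(\<integral>\<^sup>+u. ennreal (u powr (2 * \<alpha> - 2)) * indicator {0..c} u \<partial>lborel)
      = ennreal (c powr (2 * \<alpha> - 2 + 1) / (2 * \<alpha> - 2 + 1))"
    by (rule nn_integral_has_integral_lebesgue'[OF _ has_integral_powr_from_0]) (use \<alpha> c in auto)
  also have "2 * \<alpha> - 2 + 1 = 2 * \<alpha> - 1" by simp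
  finally show ?thesis using \<alpha> by (simp add: kernel_energy_def ennreal_mult[symmetric])
qed

lemma kernel_shift_sq_integral:
  assumes \<alpha>: "1 / 2 < \<alpha>" and r: "r \<le> c"
  shows "(\<integral>\<^sup>+\<xi>. ennreal ((volterra_kernel \<alpha> (\<xi> - r))\<^sup>2) * indicator {..c} \<xi> \<partial>lborel) = ennreal (kernel_energy \<alpha> (c - r))"
proof -
  have "(\<integral>\<^sup>+\<xi>. ennreal ((volterra_kernel \<alpha> (\<xi> - r))\<^sup>2) * indicator {..c} \<xi> \<partial>lborel)
      = (\<integral>\<^sup>+u. ennreal ((volterra_kernel \<alpha> (r + 1 * u - r))\<^sup>2) * indicator {..c} (r + 1 * u) \<partial>lborel)"
    by (subst nn_integral_real_affine[where c=1 and t=r]) simp_all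
  also have "\<dots> = (\<integral>\<^sup>+u. ennreal ((volterra_kernel \<alpha> u)\<^sup>2) * indicator {..c - r} u \<partial>lborel)"
    by (intro nn_integral_cong) (auto simp: indicator_def)
  also have "\<dots> = ennreal (kernel_energy \<alpha> (c - r))"
    using r by (intro kernel_sq_integral[OF \<alpha>]) simp
  finally show ?thesis .
qed

lemma kernel_energy_nonneg: "1 / 2 < \<alpha> \<Longrightarrow> 0 \<le> kernel_energy \<alpha> c"
  by (simp add: kernel_energy_def)

lemma kernel_energy_mono:
  assumes "1 / 2 < \<alpha>" "0 \<le> c" "c \<le> d"
  shows "kernel_energy \<alpha> c \<le> kernel_energy \<alpha> d"
  using assms unfolding kernel_energy_def
  by (intro mult_left_mono divide_right_mono powr_mono2) auto

lemma kernel_decreasing: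
  assumes "\<alpha> < 1" "0 < \<alpha>" "0 < u" "u \<le> v"
  shows "0 \<le> volterra_kernel \<alpha> v" "volterra_kernel \<alpha> v \<le> volterra_kernel \<alpha> u"
proof -
  have G: "0 < Gamma \<alpha>" using assms by (intro Gamma_real_pos)
  then show "0 \<le> volterra_kernel \<alpha> v" by (simp add: volterra_kernel_def fractional_kernel_def)
  show "volterra_kernel \<alpha> v \<le> volterra_kernel \<alpha> u"
    using powr_mono2'[of "\<alpha> - 1" u v] assms G
    by (simp add: volterra_kernel_def fractional_kernel_def divide_right_mono)
qed

definition cut_kernel :: "real \<Rightarrow> real \<Rightarrow> real \<Rightarrow> real \<Rightarrow> real" where
  "cut_kernel \<alpha> T r \<xi> = indicator {0<..<T} \<xi> * volterra_kernel \<alpha> (\<xi> - r)"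

lemma measurable_cut_kernel [measurable]: "cut_kernel \<alpha> T r \<in> borel_measurable borel"
  unfolding cut_kernel_def[abs_def] by measurable

lemma sigma_op_apply: "sigma_op \<alpha> T r x = L2_of (\<lambda>\<xi>. cut_kernel \<alpha> T r \<xi> *\<^sub>R x)"
proof -
  have "indicator {r<..} \<xi> = (indicator {0<..} (\<xi> - r) :: real)" for \<xi> by (simp add: indicator_def)
  then show ?thesis
    by (simp add: sigma_op.rep_eq L2_restrict_def cut_kernel_def volterra_kernel_def mult.assoc)
qed

lemma cut_kernel_sq_integral:
  assumes "1 / 2 < \<alpha>" "0 \<le> r" "r \<le> T"
  shows "(\<integral>\<^sup>+\<xi>. ennreal ((cut_kernel \<alpha> T r \<xi>)\<^sup>2) \<partial>lborel) = ennreal (kernel_energy \<alpha> (T - r))"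
  unfolding kernel_shift_sq_integral[OF assms(1,3), symmetric]
  by (rule nn_integral_cong_AE, use AE_lborel_singleton[of T] in eventually_elim)
     (use assms(2) in \<open>auto simp: cut_kernel_def volterra_kernel_def indicator_def\<close>)

lemma sq_integrable_cut_kernel:
  assumes "1 / 2 < \<alpha>" "0 \<le> r" "r \<le> T"
  shows "sq_integrable (\<lambda>\<xi>. cut_kernel \<alpha> T r \<xi> *\<^sub>R (x :: 'a::euclidean_space))"
proof -
  have "integrable lborel (\<lambda>\<xi>. (cut_kernel \<alpha> T r \<xi>)\<^sup>2)"
    using cut_kernel_sq_integral[OF assms] by (intro integrableI_bounded) auto
  then have "integrable lborel (\<lambda>\<xi>. (norm x)\<^sup>2 * (cut_kernel \<alpha> T r \<xi>)\<^sup>2)" by simp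
  then show ?thesis by (simp add: sq_integrable_def power_mult_distrib mult.commute)
qed

lemma sigma_op_mem:
  assumes "1 / 2 < \<alpha>" "0 \<le> r" "r \<le> T"
  shows "sigma_op \<alpha> T r x \<in> L2_on ({0<..<T} \<inter> {r<..})"
  using L2_rep_of[OF sq_integrable_cut_kernel[OF assms, of x]]
  unfolding sigma_op_apply L2_on_def mem_Collect_eq
  by eventually_elim (auto simp: cut_kernel_def volterra_kernel_def indicator_def)

text \<open>The kernel is decreasing, so \<open>(k(u) - k(u + h))\<^sup>2 \<le> k(u)\<^sup>2 - k(u + h)\<^sup>2\<close>; the right-hand side
  telescopes under the integral.\<close>

lemma sigma_op_holder:
  assumes \<alpha>: "1 / 2 < \<alpha>" "\<alpha> < 1" and r: "0 \<le> r" "r \<le> r'" "r' \<le> T"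
  shows "(norm (sigma_op \<alpha> T r' x - sigma_op \<alpha> T r x))\<^sup>2 \<le> 2 * kernel_energy \<alpha> (r' - r) * (norm x)\<^sup>2"
proof -
  define a b where "a = cut_kernel \<alpha> T r'" and "b = cut_kernel \<alpha> T r"
  have [measurable]: "a \<in> borel_measurable borel" "b \<in> borel_measurable borel" by (simp_all add: a_def b_def)
  let ?D = "\<integral>\<^sup>+\<xi>. ennreal ((a \<xi> - b \<xi>)\<^sup>2) \<partial>lborel"
  let ?E = "\<integral>\<^sup>+\<xi>. ennreal ((volterra_kernel \<alpha> (\<xi> - r))\<^sup>2) * indicator {..r'} \<xi> \<partial>lborel"
  \<comment> \<open>Up to r' the later kernel is 0, so the square of the earlier one appears twice
    on the left; this is the origin of the factor 2. After r' monotonicity of the kernel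
    suffices.\<close>
  have pt: "ennreal ((b \<xi>)\<^sup>2) + ennreal ((a \<xi> - b \<xi>)\<^sup>2)
      \<le> ennreal ((a \<xi>)\<^sup>2) + 2 * (ennreal ((volterra_kernel \<alpha> (\<xi> - r))\<^sup>2) * indicator {..r'} \<xi>)" for \<xi>
  proof -
    consider "\<xi> \<notin> {0<..<T}" | "\<xi> \<in> {0<..<T}" "\<xi> \<le> r'" | "\<xi> \<in> {0<..<T}" "r' < \<xi>" by force
    then show ?thesis
    proof cases
      case 1
      then show ?thesis by (simp add: a_def b_def cut_kernel_def)
    next
      case 2
      then have "a \<xi> = 0" "b \<xi> = volterra_kernel \<alpha> (\<xi> - r)" by (simp_all add: a_def b_def cut_kernel_def volterra_kernel_def)
      then show ?thesis using 2 by (simp add: mult_2)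
    next
      case 3
      then have ab: "a \<xi> = volterra_kernel \<alpha> (\<xi> - r')" "b \<xi> = volterra_kernel \<alpha> (\<xi> - r)" by (simp_all add: a_def b_def cut_kernel_def)
      have "0 \<le> b \<xi>" "b \<xi> \<le> a \<xi>"
        unfolding ab using kernel_decreasing[of \<alpha> "\<xi> - r'" "\<xi> - r"] \<alpha> r 3 by auto
      then have "b \<xi> * b \<xi> \<le> a \<xi> * b \<xi>" by (intro mult_right_mono)
      then have "(b \<xi>)\<^sup>2 + (a \<xi> - b \<xi>)\<^sup>2 \<le> (a \<xi>)\<^sup>2" by (simp add: power2_eq_square algebra_simps)
      from ennreal_leI[OF this] have "ennreal ((b \<xi>)\<^sup>2) + ennreal ((a \<xi> - b \<xi>)\<^sup>2) \<le> ennreal ((a \<xi>)\<^sup>2)" by simp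
      then show ?thesis using 3 by simp
    qed
  qed
  have "(\<integral>\<^sup>+\<xi>. ennreal ((b \<xi>)\<^sup>2) \<partial>lborel) + ?D \<le> (\<integral>\<^sup>+\<xi>. ennreal ((a \<xi>)\<^sup>2) \<partial>lborel) + 2 * ?E"
  proof -
    have "(\<integral>\<^sup>+\<xi>. ennreal ((b \<xi>)\<^sup>2) + ennreal ((a \<xi> - b \<xi>)\<^sup>2) \<partial>lborel)
        \<le> (\<integral>\<^sup>+\<xi>. ennreal ((a \<xi>)\<^sup>2) + 2 * (ennreal ((volterra_kernel \<alpha> (\<xi> - r))\<^sup>2) * indicator {..r'} \<xi>) \<partial>lborel)"
      by (intro nn_integral_mono pt)
    then show ?thesis by (simp add: nn_integral_add nn_integral_cmult)
  qed
  then have "ennreal (kernel_energy \<alpha> (T - r)) + ?D \<le> ennreal (kernel_energy \<alpha> (T - r')) + 2 * ennreal (kernel_energy \<alpha> (r' - r))"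
    using cut_kernel_sq_integral[of \<alpha> r T] cut_kernel_sq_integral[of \<alpha> r' T]
      kernel_shift_sq_integral[of \<alpha> r r'] \<alpha> r by (simp add: a_def b_def)
  \<comment> \<open>The later kernel has less room before \<open>T\<close>, so its energy is at most
    that of the earlier one; the latter then cancels.\<close>
  also have "\<dots> \<le> ennreal (kernel_energy \<alpha> (T - r)) + 2 * ennreal (kernel_energy \<alpha> (r' - r))"
    using \<alpha> r by (intro add_right_mono ennreal_leI kernel_energy_mono) auto
  finally have D: "?D \<le> 2 * ennreal (kernel_energy \<alpha> (r' - r))"
    by (simp only: ennreal_add_left_cancel_le) simp
  have "sq_integrable (\<lambda>\<xi>. a \<xi> *\<^sub>R x)" "sq_integrable (\<lambda>\<xi>. b \<xi> *\<^sub>R x)"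
    unfolding a_def b_def using \<alpha> r by (auto intro!: sq_integrable_cut_kernel)
  note ab = this sq_integrable_diff[OF this]
  have "ennreal ((norm (sigma_op \<alpha> T r' x - sigma_op \<alpha> T r x))\<^sup>2)
      = (\<integral>\<^sup>+\<xi>. ennreal ((a \<xi> - b \<xi>)\<^sup>2) * ennreal ((norm x)\<^sup>2) \<partial>lborel)"
    unfolding sigma_op_apply a_def[symmetric] b_def[symmetric] L2_of_diff[OF ab(1,2)] nn_integral_L2_of[OF ab(3), symmetric]
    by (intro nn_integral_cong) (simp add: scaleR_diff_left[symmetric] power_mult_distrib ennreal_mult)
  also have "\<dots> = ?D * ennreal ((norm x)\<^sup>2)" by (rule nn_integral_multc) measurable
  also have "\<dots> \<le> 2 * ennreal (kernel_energy \<alpha> (r' - r)) * ennreal ((norm x)\<^sup>2)"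
    by (rule mult_right_mono[OF D]) simp
  also have "\<dots> = ennreal (2 * kernel_energy \<alpha> (r' - r) * (norm x)\<^sup>2)"
    using kernel_energy_nonneg[OF \<alpha>(1)] by (simp add: ennreal_mult)
  finally show ?thesis using kernel_energy_nonneg[OF \<alpha>(1), of "r' - r"] by simp
qed

text \<open>The modulus is a constant times |r' - r| to the power \<alpha> - 1/2. Continuity in
  operator norm is what the existence proof for the stochastic integral asks of its
  integrand.\<close>

lemma continuous_on_sigma_op:
  assumes \<alpha>: "1 / 2 < \<alpha>" "\<alpha> < 1"
  shows "continuous_on {0..T} (sigma_op \<alpha> T :: real \<Rightarrow> (real ^ 'd) \<Rightarrow>\<^sub>L 'd::finite Hspace)"
  unfolding continuous_on_def
proof
  let ?\<sigma> = "sigma_op \<alpha> T :: real \<Rightarrow> (real ^ 'd) \<Rightarrow>\<^sub>L 'd Hspace"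
  fix r assume r: "r \<in> {0..T}"
  have bound: "norm (?\<sigma> r' - ?\<sigma> r) \<le> sqrt (2 * kernel_energy \<alpha> \<bar>r' - r\<bar>)" if r': "r' \<in> {0..T}" for r'
  proof (rule norm_blinfun_bound)
    fix x :: "real ^ 'd"
    have "(norm ((?\<sigma> r' - ?\<sigma> r) x))\<^sup>2 \<le> 2 * kernel_energy \<alpha> \<bar>r' - r\<bar> * (norm x)\<^sup>2"
    proof (cases "r \<le> r'")
      case True
      then show ?thesis using sigma_op_holder[OF \<alpha>, of r r' T x] r r' by (simp add: minus_blinfun.rep_eq)
    next
      case False
      then show ?thesis using sigma_op_holder[OF \<alpha>, of r' r T x] r r'
        by (simp add: minus_blinfun.rep_eq norm_minus_commute)
    qed
    then have "norm ((?\<sigma> r' - ?\<sigma> r) x) \<le> sqrt (2 * kernel_energy \<alpha> \<bar>r' - r\<bar> * (norm x)\<^sup>2)"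
      by (rule real_le_rsqrt)
    then show "norm ((?\<sigma> r' - ?\<sigma> r) x) \<le> sqrt (2 * kernel_energy \<alpha> \<bar>r' - r\<bar>) * norm x"
      by (simp add: real_sqrt_mult)
  qed (simp add: kernel_energy_nonneg[OF \<alpha>(1)])
  have "((\<lambda>r'. \<bar>r' - r\<bar>) \<longlongrightarrow> \<bar>r - r\<bar>) (at r within {0..T})" by (intro tendsto_intros)
  then have "((\<lambda>r'. \<bar>r' - r\<bar> powr (2 * \<alpha> - 1)) \<longlongrightarrow> 0) (at r within {0..T})"
    using \<alpha> by (intro tendsto_zero_powrI[OF _ tendsto_const]) auto
  then have "((\<lambda>r'. sqrt (2 * ((1 / Gamma \<alpha>)\<^sup>2 * (\<bar>r' - r\<bar> powr (2 * \<alpha> - 1) / (2 * \<alpha> - 1)))))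
      \<longlongrightarrow> sqrt (2 * ((1 / Gamma \<alpha>)\<^sup>2 * (0 / (2 * \<alpha> - 1))))) (at r within {0..T})"
    using \<alpha> by (intro tendsto_intros) auto
  then have "((\<lambda>r'. sqrt (2 * kernel_energy \<alpha> \<bar>r' - r\<bar>)) \<longlongrightarrow> 0) (at r within {0..T})"
    by (simp add: kernel_energy_def)
  then have "((\<lambda>r'. ?\<sigma> r' - ?\<sigma> r) \<longlongrightarrow> 0) (at r within {0..T})"
    by (rule Lim_null_comparison[rotated]) (auto simp: eventually_at_filter intro!: always_eventually bound)
  then show "(?\<sigma> \<longlongrightarrow> ?\<sigma> r) (at r within {0..T})" by (simp add: LIM_zero_iff)
qed

subsection \<open>The stochastic convolution\<close>

context brownian
begin

definition noise :: "real \<Rightarrow> real \<Rightarrow> real \<Rightarrow> 'w \<Rightarrow> 'd Hspace" where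
  "noise \<alpha> s t = ito_integral M F W s t (\<lambda>r _. sigma_op \<alpha> T r)"

context
  fixes \<alpha> :: real
  assumes \<alpha>: "1 / 2 < \<alpha>" "\<alpha> < 1"
begin

text \<open>\<open>ito_integral\<close> selects an unknown version; uniqueness transfers
  measurability up to a null set, and moments, from the constructed integral to the selected
  one.\<close>

lemma noise:
  assumes st: "0 \<le> s" "s \<le> t" "t \<le> T"
  shows "has_ito_integral M F W s t (\<lambda>r _. sigma_op \<alpha> T r) (noise \<alpha> s t)"
    "\<exists>I\<in>borel_measurable (F t). AE \<omega> in M. noise \<alpha> s t \<omega> = I \<omega>"
    "0 < q \<Longrightarrow> integrable M (\<lambda>\<omega>. norm (noise \<alpha> s t \<omega>) powr q)"
proof -
  have "continuous_on {s..t} (sigma_op \<alpha> T :: real \<Rightarrow> (real ^ 'd) \<Rightarrow>\<^sub>L 'd Hspace)"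
    using st by (intro continuous_on_subset[OF continuous_on_sigma_op[OF \<alpha>, of T]]) auto
  from has_ito_integral_exists[OF st this] obtain I :: "'w \<Rightarrow> 'd Hspace" where
    I: "has_ito_integral M F W s t (\<lambda>r _. sigma_op \<alpha> T r) I" "I \<in> borel_measurable (F t)"
      "\<And>q. 0 < q \<Longrightarrow> integrable M (\<lambda>\<omega>. norm (I \<omega>) powr q)"
    by blast
  show h: "has_ito_integral M F W s t (\<lambda>r _. sigma_op \<alpha> T r) (noise \<alpha> s t)"
    unfolding noise_def ito_integral_def by (rule someI[of _ I]) (rule I)
  have eq: "AE \<omega> in M. noise \<alpha> s t \<omega> = I \<omega>"
    by (rule approximable_unique[OF st has_ito_integral_approximable[OF h] has_ito_integral_approximable(2)[OF I(1)]])
  then show "\<exists>I\<in>borel_measurable (F t). AE \<omega> in M. noise \<alpha> s t \<omega> = I \<omega>" using I(2) by blast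
  have [measurable]: "noise \<alpha> s t \<in> borel_measurable M" "I \<in> borel_measurable M"
    using h I(1) unfolding has_ito_integral_def by auto
  show "integrable M (\<lambda>\<omega>. norm (noise \<alpha> s t \<omega>) powr q)" if "0 < q"
    using eq by (intro integrable_cong_AE_imp[OF I(3)[OF that]]) (auto elim: eventually_mono)
qed

lemma noise_measurable:
  "0 \<le> s \<Longrightarrow> s \<le> t \<Longrightarrow> t \<le> T \<Longrightarrow> noise \<alpha> s t \<in> borel_measurable M"
  using noise(1) unfolding has_ito_integral_def by blast

text \<open>For r >= s the values of \<sigma>(r) live on (r, T), hence are annihilated by the cut.
  The complement of (0, T) gives values in \<open>H\<close>, and the half-line before
  \<open>u\<close> gives the vanishing needed for restarting at \<open>u\<close>.\<close>

lemma noise_cut: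
  assumes st: "0 \<le> s" "s \<le> t" "t \<le> T" and A: "A \<in> sets borel" "A \<inter> ({0<..<T} \<inter> {s..}) = {}"
  shows "AE \<omega> in M. L2_cut A (noise \<alpha> s t \<omega>) = 0"
proof -
  define R :: "'d Hspace \<Rightarrow>\<^sub>L 'd Hspace" where "R = Blinfun (L2_cut A)"
  have R: "blinfun_apply R = L2_cut A"
    unfolding R_def by (intro bounded_linear_Blinfun_apply bounded_linear_L2_mult[OF multiplier_indicator] A)
  have "AE \<omega> in M. R (noise \<alpha> s t \<omega>) = 0"
  proof (rule approximable_kernel[OF st has_ito_integral_approximable[OF noise(1)[OF st]]])
    show "norm (R x) \<le> norm x" for x
      unfolding R using norm_L2_mult_bound[OF multiplier_indicator[OF A(1)], of x] by simp
    fix r and x :: "real ^ 'd" assume r: "r \<in> {s..t}"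
    have "sigma_op \<alpha> T r x \<in> L2_on ({0<..<T} \<inter> {r<..})" using sigma_op_mem[of \<alpha> r T x] \<alpha> r st by auto
    then have "AE y in lborel. y \<in> A \<longrightarrow> L2_rep (sigma_op \<alpha> T r x) y = 0"
      unfolding L2_on_def mem_Collect_eq by eventually_elim (use A(2) r in force)
    then show "R (sigma_op \<alpha> T r x) = 0" unfolding R by (simp add: L2_cut_eq_0_iff A)
  qed
  then show ?thesis by (simp add: R)
qed

lemma noise_in:
  assumes "0 \<le> s" "s \<le> t" "t \<le> T"
  shows "AE \<omega> in M. noise \<alpha> s t \<omega> \<in> L2_on {0<..<T}"
  using noise_cut[OF assms, of "- {0<..<T}"] by (auto simp: L2_on_iff)

lemma noise_append:
  assumes st: "0 \<le> s" "s \<le> u" "u \<le> t" "t \<le> T"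
  shows "AE \<omega> in M. noise \<alpha> s t \<omega> = noise \<alpha> s u \<omega> + noise \<alpha> u t \<omega>"
proof -
  have 0: "0 \<le> u" "u \<le> T" "s \<le> t" using st by auto
  note a = has_ito_integral_approximable[OF noise(1)]
  show ?thesis
    by (rule approximable_unique[OF st(1) 0(3) st(4) a(1)[OF st(1) 0(3) st(4)] a(2)[OF st(1) 0(3) st(4)]
      approximable_append[OF st a(1)[OF st(1,2) 0(2)] a(1)[OF 0(1) st(3,4)] a(2)[OF st(1,2) 0(2)] a(2)[OF 0(1) st(3,4)]]])
qed

end

end

subsection \<open>Solutions\<close>

lemma powr_add_le:
  fixes a b c q :: real
  assumes "0 \<le> a" "0 \<le> b" "0 \<le> c" "0 < q"
  shows "(a + b + c) powr q \<le> 3 powr q * (a powr q + b powr q + c powr q)"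
proof -
  define m where "m = max a (max b c)"
  have "(a + b + c) powr q \<le> (3 * m) powr q"
    using assms by (intro powr_mono2) (auto simp: m_def)
  also have "\<dots> = 3 powr q * m powr q" using assms by (intro powr_mult)
  also have "m powr q \<le> a powr q + b powr q + c powr q" by (auto simp: m_def max_def)
  finally show ?thesis by simp
qed

locale volterra_equation = brownian M F T W + volterra_drift T C B
  for M :: "'w measure" and F :: "real \<Rightarrow> 'w measure" and T :: real and W :: "real \<Rightarrow> 'w \<Rightarrow> real ^ 'd"
    and C :: real and B :: "(real \<Rightarrow> real ^ 'd) \<Rightarrow> 'd Hsquare" +
  fixes \<alpha> :: real
  assumes \<alpha>: "1 / 2 < \<alpha>" "\<alpha> < 1"
begin

lemma is_solution_iff:
  "is_solution M F T W \<alpha> B q s t \<phi> w \<longleftrightarrow> w \<in> Lq_space M M T q \<and>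
    (AE \<omega> in M. w \<omega> = \<phi> \<omega> + slice_int s t (G (w \<omega>)) + noise \<alpha> s t \<omega>)"
  by (simp add: is_solution_def noise_def slice_int_def)

text \<open>Identifies any solution almost surely with the deterministic solution map, so uniqueness
  of random solutions is immediate.\<close>

lemma is_solution_sol:
  assumes st: "0 \<le> s" "s \<le> t" "t \<le> T" and \<phi>: "\<phi> \<in> Lq_space M M T q"
    and w: "is_solution M F T W \<alpha> B q s t \<phi> w"
  shows "AE \<omega> in M. w \<omega> = sol s t (\<phi> \<omega> + noise \<alpha> s t \<omega>)"
  using w[unfolded is_solution_iff, THEN conjunct2] noise_in[OF \<alpha> st] AE_space
proof eventually_elim
  case (elim \<omega>)
  have in_H: "w \<omega> \<in> H" "\<phi> \<omega> \<in> H"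
    using w \<phi> elim(3) by (auto simp: is_solution_def Lq_space_def)
  show ?case
  proof (rule sol(3))
    show "\<phi> \<omega> + noise \<alpha> s t \<omega> \<in> H" using in_H elim(2) by (intro H_add)
    show "\<phi> \<omega> + noise \<alpha> s t \<omega> + slice_int s t (G (w \<omega>)) = w \<omega>" using elim(1) by (simp add: ac_simps)
  qed (use in_H st in auto)
qed

lemma solution_exists:
  assumes st: "0 \<le> s" "s \<le> t" "t \<le> T" and q: "0 < q" and \<phi>: "\<phi> \<in> Lq_space M M T q"
  shows "\<exists>w. is_solution M F T W \<alpha> B q s t \<phi> w"
proof -
  define \<eta> where "\<eta> \<omega> = \<phi> \<omega> + noise \<alpha> s t \<omega>" for \<omega>
  \<comment> \<open>\<open>Lq_space\<close> demands values in \<open>H\<close> for every \<omega>,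
    whereas the input lies in \<open>H\<close> only almost surely; bad paths receive 0.\<close>
  define w where "w \<omega> = indicator H (\<eta> \<omega>) *\<^sub>R sol s t (\<eta> \<omega>)" for \<omega>
  have [measurable]: "\<phi> \<in> borel_measurable M" using \<phi> by (simp add: Lq_space_def)
  have [measurable]: "noise \<alpha> s t \<in> borel_measurable M" by (rule noise_measurable[OF \<alpha> st])
  have \<eta>m: "\<eta> \<in> borel_measurable M" unfolding \<eta>_def[abs_def] by measurable
  have wm [measurable]: "w \<in> borel_measurable M"
    unfolding w_def[abs_def] by (rule measurable_compose[OF \<eta>m measurable_sol_cut[OF st(1)]])
  have wH: "w \<omega> \<in> H" for \<omega>
    using sol(1)[OF _ st(1)] subspace_0[OF subspace_L2_on[of "{0<..<T}"]] by (auto simp: w_def indicator_def)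
  obtain K where K: "0 \<le> K" "\<And>\<eta>. \<eta> \<in> H \<Longrightarrow> norm (sol s t \<eta>) \<le> K * (1 + norm \<eta>)"
    using sol_growth[OF st(1)] by blast
  have bound: "norm (w \<omega>) powr q \<le> K powr q * (3 powr q * (1 + norm (\<phi> \<omega>) powr q + norm (noise \<alpha> s t \<omega>) powr q))" for \<omega>
  proof -
    have "norm (w \<omega>) \<le> K * (1 + norm (\<eta> \<omega>))"
      using K by (auto simp: w_def indicator_def)
    also have "\<dots> \<le> K * (1 + norm (\<phi> \<omega>) + norm (noise \<alpha> s t \<omega>))"
      using norm_triangle_ineq[of "\<phi> \<omega>" "noise \<alpha> s t \<omega>"] K(1) by (intro mult_left_mono) (auto simp: \<eta>_def)
    finally have "norm (w \<omega>) powr q \<le> (K * (1 + norm (\<phi> \<omega>) + norm (noise \<alpha> s t \<omega>))) powr q"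
      using q by (intro powr_mono2) auto
    also have "\<dots> = K powr q * (1 + norm (\<phi> \<omega>) + norm (noise \<alpha> s t \<omega>)) powr q"
      using K(1) by (intro powr_mult)
    also have "\<dots> \<le> K powr q * (3 powr q * (1 powr q + norm (\<phi> \<omega>) powr q + norm (noise \<alpha> s t \<omega>) powr q))"
      using q by (intro mult_left_mono powr_add_le) auto
    finally show ?thesis by simp
  qed
  have "integrable M (\<lambda>\<omega>. K powr q * (3 powr q * (1 + norm (\<phi> \<omega>) powr q + norm (noise \<alpha> s t \<omega>) powr q)))"
    using \<phi> noise(3)[OF \<alpha> st q] by (auto simp: Lq_space_def)
  then have "integrable M (\<lambda>\<omega>. norm (w \<omega>) powr q)"
    by (rule Bochner_Integration.integrable_bound) (use bound in \<open>auto intro!: order_trans[OF bound]\<close>)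
  then have "w \<in> Lq_space M M T q" using wm wH by (simp add: Lq_space_def)
  moreover have "AE \<omega> in M. w \<omega> = \<phi> \<omega> + slice_int s t (G (w \<omega>)) + noise \<alpha> s t \<omega>"
    using noise_in[OF \<alpha> st] AE_space
  proof eventually_elim
    case (elim \<omega>)
    have "\<phi> \<omega> \<in> H" using \<phi> elim(2) by (simp add: Lq_space_def)
    then have \<eta>: "\<eta> \<omega> \<in> H" unfolding \<eta>_def using elim(1) by (intro H_add)
    then have "w \<omega> = sol s t (\<eta> \<omega>)" by (simp add: w_def)
    then show ?case using sol(2)[OF \<eta> st(1), of t] by (simp add: \<eta>_def ac_simps)
  qed
  ultimately show ?thesis unfolding is_solution_iff by blast
qed

text \<open>The solution agrees almost surely with a Borel function of the initial value and an
  \<open>F t\<close>-measurable version of the stochastic integral.\<close>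

lemma solution_adapted:
  assumes st: "0 \<le> s" "s \<le> t" "t \<le> T" and \<phi>: "\<phi> \<in> Lq_space M (F s) T q"
    and w: "is_solution M F T W \<alpha> B q s t \<phi> w"
  shows "w \<in> Lq_space M (F t) T q"
proof -
  have t: "0 \<le> t" "s \<le> T" using st by auto
  have \<phi>s: "\<phi> \<in> borel_measurable (F s)" using \<phi> by (simp add: Lq_space_def)
  have \<phi>M: "\<phi> \<in> Lq_space M M T q"
    using \<phi> measurable_F_M[OF st(1) t(2) \<phi>s] by (simp add: Lq_space_def)
  obtain I where I: "I \<in> borel_measurable (F t)" "AE \<omega> in M. noise \<alpha> s t \<omega> = I \<omega>"
    using noise(2)[OF \<alpha> st] by blast
  have "(\<lambda>\<omega>. \<phi> \<omega> + I \<omega>) \<in> borel_measurable (F t)"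
    by (rule borel_measurable_add[OF measurable_F_mono[OF st \<phi>s] I(1)])
  from measurable_compose[OF this measurable_sol_cut[OF st(1)]]
  have g: "(\<lambda>\<omega>. indicator H (\<phi> \<omega> + I \<omega>) *\<^sub>R sol s t (\<phi> \<omega> + I \<omega>)) \<in> borel_measurable (F t)" .
  have wL: "w \<in> Lq_space M M T q" using w by (simp add: is_solution_def)
  have "AE \<omega> in M. w \<omega> = indicator H (\<phi> \<omega> + I \<omega>) *\<^sub>R sol s t (\<phi> \<omega> + I \<omega>)"
    using is_solution_sol[OF st \<phi>M w] I(2) noise_in[OF \<alpha> st] AE_space
  proof eventually_elim
    case (elim \<omega>)
    have "\<phi> \<omega> \<in> H" using \<phi> elim(4) by (simp add: Lq_space_def)
    then have "\<phi> \<omega> + noise \<alpha> s t \<omega> \<in> H" using elim(3) by (rule H_add)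
    then show ?case using elim(1,2) by simp
  qed
  then have "w \<in> borel_measurable (F t)"
    using wL by (intro measurable_F_AE[OF t(1) st(3) _ g]) (auto simp: Lq_space_def)
  then show ?thesis using wL by (simp add: Lq_space_def)
qed

text \<open>Path by path the restarted solution solves the equation on the whole of [s, t] with
  initial value \<phi>; uniqueness then identifies it.\<close>

lemma solution_cocycle:
  assumes st: "0 \<le> s" "s \<le> u" "u \<le> t" "t \<le> T" and \<phi>: "\<phi> \<in> Lq_space M M T q"
    and wu: "is_solution M F T W \<alpha> B q s u \<phi> wu" and wt: "is_solution M F T W \<alpha> B q s t \<phi> wt"
    and v: "is_solution M F T W \<alpha> B q u t wu v"
  shows "AE \<omega> in M. wt \<omega> = v \<omega>"
proof -
  have 0: "0 \<le> u" "u \<le> T" "s \<le> t" using st by auto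
  have cut: "AE \<omega> in M. L2_cut {..<u} (noise \<alpha> u t \<omega>) = 0"
    by (rule noise_cut[OF \<alpha> 0(1) st(3,4)]) auto
  show ?thesis
    using is_solution_sol[OF st(1) 0(3) st(4) \<phi> wt] wu[unfolded is_solution_iff, THEN conjunct2]
      v[unfolded is_solution_iff, THEN conjunct2] cut noise_in[OF \<alpha> st(1,2) 0(2)]
      noise_in[OF \<alpha> 0(1) st(3,4)] noise_append[OF \<alpha> st] AE_space
  proof eventually_elim
    case (elim \<omega>)
    have in_H: "\<phi> \<omega> \<in> H" "wu \<omega> \<in> H" "v \<omega> \<in> H"
      using \<phi> wu v elim(8) by (auto simp: is_solution_def Lq_space_def)
    have "v \<omega> = \<phi> \<omega> + slice_int s t (G (v \<omega>)) + (noise \<alpha> s u \<omega> + noise \<alpha> u t \<omega>)"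
      by (rule sol_cocycle[OF st in_H(1) elim(5,6,4) in_H(2) elim(2)[symmetric] in_H(3) elim(3)[symmetric]])
    then have "\<phi> \<omega> + noise \<alpha> s t \<omega> + slice_int s t (G (v \<omega>)) = v \<omega>"
      unfolding elim(7) by (simp add: ac_simps)
    moreover have "\<phi> \<omega> + noise \<alpha> s t \<omega> \<in> H"
      unfolding elim(7) by (intro H_add in_H elim(5,6))
    ultimately have "v \<omega> = sol s t (\<phi> \<omega> + noise \<alpha> s t \<omega>)" using in_H(3) st(1) by (intro sol(3))
    then show ?case using elim(1) by simp
  qed
qed

end

theorem theorem3:
  fixes T \<alpha> :: real
    and M :: "'w measure"
    and F :: "real \<Rightarrow> 'w measure"
    and W :: "real \<Rightarrow> 'w \<Rightarrow> real ^ 'd"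
    and B :: "(real \<Rightarrow> real ^ 'd) \<Rightarrow> 'd Hsquare"
  assumes "0 < T" and "1 / 2 < \<alpha>" and "\<alpha> < 1"
    and "usual_filtered_space M F T"
    and "brownian_motion M F T W"
    and "volterra_lipschitz T B"
  shows
    "(\<forall>q\<ge>2. \<forall>\<phi>\<in>Lq_space M M T q. \<forall>s t. 0 \<le> s \<and> s \<le> t \<and> t \<le> T \<longrightarrow>
        (\<exists>w. is_solution M F T W \<alpha> B q s t \<phi> w \<and>
          (\<forall>w'. is_solution M F T W \<alpha> B q s t \<phi> w' \<longrightarrow> (AE \<omega> in M. w' \<omega> = w \<omega>)))) \<and>
     (\<forall>q\<ge>2. \<forall>s t. 0 \<le> s \<and> s \<le> t \<and> t \<le> T \<longrightarrow>
        (\<forall>\<phi>\<in>Lq_space M (F s) T q. \<forall>w. is_solution M F T W \<alpha> B q s t \<phi> w \<longrightarrow>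
          w \<in> Lq_space M (F t) T q)) \<and>
     (\<forall>q\<ge>2. \<forall>\<phi>\<in>Lq_space M M T q. \<forall>s u t. 0 \<le> s \<and> s < u \<and> u < t \<and> t \<le> T \<longrightarrow>
        (\<forall>w\<^sub>u w\<^sub>t v.
          is_solution M F T W \<alpha> B q s u \<phi> w\<^sub>u \<longrightarrow>
          is_solution M F T W \<alpha> B q s t \<phi> w\<^sub>t \<longrightarrow>
          is_solution M F T W \<alpha> B q u t w\<^sub>u v \<longrightarrow>
          (AE \<omega> in M. w\<^sub>t \<omega> = v \<omega>)))"
proof -
  obtain C where C: "0 < C" "\<And>v w. v \<in> paths T \<Longrightarrow> w \<in> paths T \<Longrightarrow>
      norm (B v - B w) \<le> C * norm (path_class T v - path_class T w)"
    using assms(6) unfolding volterra_lipschitz_def by blast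
  have volterra: "AE r in lborel. r \<in> {0<..<T} \<longrightarrow>
      (AE \<xi> in lborel. \<xi> \<in> {0<..<r} \<longrightarrow> L2_rep (L2_slice (B w) r) \<xi> = 0)" if "w \<in> paths T" for w
    using assms(1,6) that unfolding volterra_lipschitz_def by blast
  have causal: "AE r in lborel. r \<in> {0<..<t} \<longrightarrow> L2_slice (B v) r = L2_slice (B w) r"
    if "v \<in> paths T" "w \<in> paths T" "0 < t" "t \<le> T" "\<And>\<xi>. \<xi> \<in> {0<..<t} \<Longrightarrow> v \<xi> = w \<xi>" for v w t
    using assms(6) that unfolding volterra_lipschitz_def by blast
  interpret prob_space M using assms(4) by (simp add: usual_filtered_space_def)
  interpret volterra_equation M F T W C B \<alpha>
    using assms C volterra causal by unfold_locales (auto simp: volterra_lipschitz_def)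
  show ?thesis
  proof (intro conjI allI impI ballI; (elim conjE)?)
    fix q s t :: real and \<phi> :: "'w \<Rightarrow> 'd Hspace" assume a: "2 \<le> q" "\<phi> \<in> Lq_space M M T q" "0 \<le> s" "s \<le> t" "t \<le> T"
    then obtain w where w: "is_solution M F T W \<alpha> B q s t \<phi> w"
      using solution_exists[of s t q \<phi>] by auto
    have "AE \<omega> in M. w' \<omega> = w \<omega>" if "is_solution M F T W \<alpha> B q s t \<phi> w'" for w'
      using is_solution_sol[OF a(3-5,2) that] is_solution_sol[OF a(3-5,2) w] by eventually_elim simp
    with w show "\<exists>w. is_solution M F T W \<alpha> B q s t \<phi> w \<and>
        (\<forall>w'. is_solution M F T W \<alpha> B q s t \<phi> w' \<longrightarrow> (AE \<omega> in M. w' \<omega> = w \<omega>))" by blast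
  next
    fix q s t :: real and \<phi> w :: "'w \<Rightarrow> 'd Hspace"
    assume "\<phi> \<in> Lq_space M (F s) T q" "is_solution M F T W \<alpha> B q s t \<phi> w" "0 \<le> s" "s \<le> t" "t \<le> T"
    then show "w \<in> Lq_space M (F t) T q" by (intro solution_adapted[of s t \<phi> q w])
  next
    fix q s u t :: real and \<phi> wu wt v :: "'w \<Rightarrow> 'd Hspace"
    assume "\<phi> \<in> Lq_space M M T q" "0 \<le> s" "s < u" "u < t" "t \<le> T"
      "is_solution M F T W \<alpha> B q s u \<phi> wu" "is_solution M F T W \<alpha> B q s t \<phi> wt"
      "is_solution M F T W \<alpha> B q u t wu v"
    then show "AE \<omega> in M. wt \<omega> = v \<omega>" by (intro solution_cocycle[of s u t \<phi> q wu wt v]) auto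
  qed
qed

end
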